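(* Let $R$ be a local ring of Krull dimension one with regular maximal ideal $M$, let $m\in M$ be a nonzerodivisor, and let $\widetilde{R}$ be the $mR$-adic completion of $R$. The following are equivalent: (1) $M^n$ can be generated by two elements for some $n\ge2$. (2) $\widetilde{R}$ is a Noetherian local ring of multiplicity at most $2$. (3) Every regular ideal of $R$ can be generated by two elements.
   Context: All rings are commutative with identity; a local ring is a ring with a unique maximal ideal (not necessarily Noetherian). An ideal is regular if it contains a nonzerodivisor. The multiplicity of a Noetherian local ring $(A,\mathfrak n)$ of dimension $d$ is $d!$ times the leading coefficient of the polynomial that agrees with the length of $A/\mathfrak n^k$ for large $k$. ($\widetilde R$ does not depend on the choice of $m$.) *)

theory Defs
  imports "HOL-Algebra.Ideal_Product" "HOL-Algebra.QuotRing" "HOL-Algebra.Ring_Divisibility"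
    "HOL-Computational_Algebra.Polynomial" "HOL-Library.Extended_Nat"
begin

definition nonzerodivisor :: "('a, 'b) ring_scheme \<Rightarrow> 'a \<Rightarrow> bool" where
  "nonzerodivisor R x \<longleftrightarrow> x \<in> carrier R \<and>
     (\<forall>y \<in> carrier R. x \<otimes>\<^bsub>R\<^esub> y = \<zero>\<^bsub>R\<^esub> \<longrightarrow> y = \<zero>\<^bsub>R\<^esub>)"

definition regular_ideal :: "('a, 'b) ring_scheme \<Rightarrow> 'a set \<Rightarrow> bool" where
  "regular_ideal R I \<longleftrightarrow> ideal I R \<and> (\<exists>x \<in> I. nonzerodivisor R x)"

definition local_ring :: "('a, 'b) ring_scheme \<Rightarrow> bool" where
  "local_ring R \<longleftrightarrow> cring R \<and> (\<exists>!M. maximalideal M R)"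

definition max_ideal :: "('a, 'b) ring_scheme \<Rightarrow> 'a set" where
  "max_ideal R = (THE M. maximalideal M R)"

definition krull_dim :: "('a, 'b) ring_scheme \<Rightarrow> enat" where
  "krull_dim R = Sup {enat n | n. \<exists>P. (\<forall>i\<le>n. primeideal (P i) R) \<and> (\<forall>i<n. P i \<subset> P (Suc i))}"

definition two_generated :: "('a, 'b) ring_scheme \<Rightarrow> 'a set \<Rightarrow> bool" where
  "two_generated R I \<longleftrightarrow> (\<exists>a \<in> carrier R. \<exists>b \<in> carrier R. I = Idl\<^bsub>R\<^esub> {a, b})"

primrec ideal_pow :: "('a, 'b) ring_scheme \<Rightarrow> 'a set \<Rightarrow> nat \<Rightarrow> 'a set" where
  "ideal_pow R I 0 = carrier R"
| "ideal_pow R I (Suc n) = ideal_prod R I (ideal_pow R I n)"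

text \<open>Length of the A-module A/I: supremum of lengths of strict chains of ideals
  I = J0 < J1 < ... < Jn = A (these correspond to chains of submodules of A/I).\<close>
definition colength :: "('a, 'b) ring_scheme \<Rightarrow> 'a set \<Rightarrow> enat" where
  "colength A I = Sup {enat n | n. \<exists>J. J 0 = I \<and> J n = carrier A \<and>
      (\<forall>i\<le>n. ideal (J i) A) \<and> (\<forall>i<n. J i \<subset> J (Suc i))}"

definition hilbert_samuel_poly :: "('a, 'b) ring_scheme \<Rightarrow> real poly" where
  "hilbert_samuel_poly A = (THE P. \<forall>\<^sub>F k in sequentially.
      \<exists>l. colength A (ideal_pow A (max_ideal A) k) = enat l \<and> real l = poly P (real k))"

definition local_multiplicity :: "('a, 'b) ring_scheme \<Rightarrow> real" where
  "local_multiplicity A = fact (the_enat (krull_dim A)) * lead_coeff (hilbert_samuel_poly A)"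

text \<open>The mR-adic completion of R: the inverse limit of the rings R/m^k R, realised as
  compatible sequences of cosets x k of m^k R (x (Suc k) maps to x k under
  R/m^(k+1)R -> R/m^kR, i.e. x (Suc k) is contained in x k), with componentwise operations.\<close>
definition adic_completion :: "('a, 'b) ring_scheme \<Rightarrow> 'a \<Rightarrow> (nat \<Rightarrow> 'a set) ring" where
  "adic_completion R m =
    \<lparr>carrier = {x. (\<forall>k. x k \<in> carrier (R Quot (PIdl\<^bsub>R\<^esub> (m [^]\<^bsub>R\<^esub> k))))
                    \<and> (\<forall>k. x (Suc k) \<subseteq> x k)},
     monoid.mult = (\<lambda>x y k. x k \<otimes>\<^bsub>R Quot (PIdl\<^bsub>R\<^esub> (m [^]\<^bsub>R\<^esub> k))\<^esub> y k),
     one = (\<lambda>k. \<one>\<^bsub>R Quot (PIdl\<^bsub>R\<^esub> (m [^]\<^bsub>R\<^esub> k))\<^esub>),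
     zero = (\<lambda>k. \<zero>\<^bsub>R Quot (PIdl\<^bsub>R\<^esub> (m [^]\<^bsub>R\<^esub> k))\<^esub>),
     add = (\<lambda>x y k. x k \<oplus>\<^bsub>R Quot (PIdl\<^bsub>R\<^esub> (m [^]\<^bsub>R\<^esub> k))\<^esub> y k)\<rparr>"

end

theory Submission
  imports Defs "HOL-Library.Multiset_Order"
begin

text \<open>
  Let L be the n-th power of M, with n at least 2, and suppose that it is generated by two elements.
  Then some y in M satisfies L = y M^(n-1), whatever the residue field: modulo M L take two
  independent products p = x x' w and q = z z' v of n elements of M. If none of the factors
  x, x', z, z' works as y, multiplication by each of them has rank one modulo M L, so x z' v and
  z x' w vanish modulo M L and y = x + z works. As y is a nonzerodivisor, one can descend to
  M^2 = y M and M = (y, c). Then an ideal that contains a power of y but is not contained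
  in (y) is either the whole ring or generated by some b outside (y) and a power of y,
  which gives (3); the same argument in the y-adically complete ring shows that an ideal without
  powers of y is principal up to a power of y, whence the completion is Noetherian of dimension
  at most one.

  For the multiplicity, monomials in generators of the maximal ideal that are not combinations
  of smaller ones modulo the next power form an order ideal counting the length of M^k / M^(k+1);
  since M^k contains m^k these lengths are bounded on average, which forces them to be eventually
  constant, and the constant is the multiplicity. If it is at most 2, high powers of the maximal
  ideal of the completion have two generators, and these can be pulled back to R by Nakayama.
\<close>

section \<open>Ideals of commutative rings\<close>

text \<open>Two standard tools fail here. The residue field may be finite, so y cannot be chosen as
  a generic element; it is found among the factors of products that are independent modulo M L, or
  as a sum of two such factors. The nonzerodivisor m replaces them: dimension one makes a power of
  every element of M a multiple of m, and cancelling m identifies the kernel of the projection from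
  the completion to R/m^k R with the multiples of m^k, so that elements can be handled up to powers
  of m.

  If the length of M^k / M^(k+1) is eventually e, the Hilbert-Samuel polynomial is d + eX, with
  leading coefficient e only if e is nonzero. Bounding the multiplicity therefore requires that the
  powers of the maximal ideal of the completion are distinct. The factorial of the dimension is at
  least 1, which suffices to pass from (2) to (1); in the other direction dimension at most one
  makes it equal to 1.\<close>

context cring
begin

lemma ideal_carr: "ideal I R \<Longrightarrow> x \<in> I \<Longrightarrow> x \<in> carrier R"
  by (rule ideal.Icarr)

lemma ideal_zero: "ideal I R \<Longrightarrow> \<zero> \<in> I"
  by (simp add: additive_subgroup.zero_closed ideal.axioms(1))

lemma ideal_add: "ideal I R \<Longrightarrow> x \<in> I \<Longrightarrow> y \<in> I \<Longrightarrow> x \<oplus> y \<in> I"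
  by (simp add: additive_subgroup.a_closed ideal.axioms(1))

lemma ideal_neg: "ideal I R \<Longrightarrow> x \<in> I \<Longrightarrow> \<ominus> x \<in> I"
  by (simp add: additive_subgroup.a_inv_closed ideal.axioms(1))

lemma ideal_diff: "ideal I R \<Longrightarrow> x \<in> I \<Longrightarrow> y \<in> I \<Longrightarrow> x \<ominus> y \<in> I"
  by (simp add: a_minus_def ideal_add ideal_neg)

lemma ideal_mult: "ideal I R \<Longrightarrow> x \<in> I \<Longrightarrow> r \<in> carrier R \<Longrightarrow> x \<otimes> r \<in> I"
  by (rule ideal.I_r_closed)

lemma ideal_mult': "ideal I R \<Longrightarrow> x \<in> I \<Longrightarrow> r \<in> carrier R \<Longrightarrow> r \<otimes> x \<in> I"
  by (rule ideal.I_l_closed)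

lemmas ideal_simps = ideal_zero ideal_add ideal_neg ideal_diff ideal_mult ideal_mult'

lemma ideal_diff_cancel:
  assumes "ideal I R" "x \<ominus> y \<in> I" "y \<in> I" "x \<in> carrier R"
  shows "x \<in> I"
proof -
  have "y \<in> carrier R" using assms ideal_carr by blast
  then have "x = (x \<ominus> y) \<oplus> y" using assms(4) by algebra
  then show ?thesis using ideal_add[OF assms(1-3)] by simp
qed

lemma ideal_add_cancel:
  assumes "ideal I R" "x \<oplus> y \<in> I" "y \<in> I" "x \<in> carrier R"
  shows "x \<in> I"
proof -
  have "y \<in> carrier R" using assms ideal_carr by blast
  then have "x = (x \<oplus> y) \<ominus> y" using assms(4) by algebra
  then show ?thesis using ideal_diff[OF assms(1-3)] by simp
qed

lemma idealI_cring:
  assumes "I \<subseteq> carrier R" "\<zero> \<in> I" "\<And>x y. x \<in> I \<Longrightarrow> y \<in> I \<Longrightarrow> x \<oplus> y \<in> I"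
    and "\<And>x r. x \<in> I \<Longrightarrow> r \<in> carrier R \<Longrightarrow> x \<otimes> r \<in> I"
  shows "ideal I R"
proof (rule idealI[OF ring_axioms])
  show "subgroup I (add_monoid R)"
  proof
    fix x assume x: "x \<in> I"
    then have "\<ominus> x = x \<otimes> (\<ominus> \<one>)" using assms(1) by (simp add: r_minus subset_iff)
    then show "inv\<^bsub>add_monoid R\<^esub> x \<in> I" using assms(4)[OF x] by (simp add: a_inv_def)
  qed (use assms(1-3) in auto)
  show "x \<otimes> a \<in> I" if "a \<in> I" "x \<in> carrier R" for a x
    using assms(4)[OF that] that assms(1) m_comm by (metis subsetD)
qed (rule assms(4))

text \<open>The ideal I + cR. Two-generated ideals, the exchange argument and composition series all
  arise by adding one generator at a time.\<close>

definition adj :: "'a set \<Rightarrow> 'a \<Rightarrow> 'a set" where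
  "adj I c = {i \<oplus> c \<otimes> r | i r. i \<in> I \<and> r \<in> carrier R}"

lemma adjI: "i \<in> I \<Longrightarrow> r \<in> carrier R \<Longrightarrow> i \<oplus> c \<otimes> r \<in> adj I c"
  by (auto simp: adj_def)

lemma adj_ideal:
  assumes I: "ideal I R" and c: "c \<in> carrier R"
  shows "ideal (adj I c) R"
proof (rule idealI_cring)
  show "adj I c \<subseteq> carrier R" using assms ideal_carr by (auto simp: adj_def)
  show "\<zero> \<in> adj I c" using adjI[OF ideal_zero[OF I] zero_closed, of c] c by simp
next
  fix x y assume "x \<in> adj I c" "y \<in> adj I c"
  then obtain i r j s where h: "i \<in> I" "r \<in> carrier R" "x = i \<oplus> c \<otimes> r"
    "j \<in> I" "s \<in> carrier R" "y = j \<oplus> c \<otimes> s" by (auto simp: adj_def)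
  have "i \<in> carrier R" "j \<in> carrier R" using h I ideal_carr by auto
  then have "x \<oplus> y = (i \<oplus> j) \<oplus> c \<otimes> (r \<oplus> s)" using h c by algebra
  then show "x \<oplus> y \<in> adj I c" using h adjI ideal_add[OF I] by simp
next
  fix x t assume "x \<in> adj I c" and t: "t \<in> carrier R"
  then obtain i r where h: "i \<in> I" "r \<in> carrier R" "x = i \<oplus> c \<otimes> r" by (auto simp: adj_def)
  have "i \<in> carrier R" using h I ideal_carr by auto
  then have "x \<otimes> t = (i \<otimes> t) \<oplus> c \<otimes> (r \<otimes> t)" using h c t by algebra
  then show "x \<otimes> t \<in> adj I c" using h t adjI ideal_mult[OF I] by simp
qed

lemma adj_supset: "ideal I R \<Longrightarrow> c \<in> carrier R \<Longrightarrow> I \<subseteq> adj I c"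
  using adjI[OF _ zero_closed, of _ I c] ideal_carr by fastforce

lemma adj_self: "ideal I R \<Longrightarrow> c \<in> carrier R \<Longrightarrow> c \<in> adj I c"
  using adjI[OF ideal_zero one_closed, of I c] by simp

lemma adj_least:
  assumes "ideal J R" "I \<subseteq> J" "c \<in> J"
  shows "adj I c \<subseteq> J"
proof
  fix x assume "x \<in> adj I c"
  then obtain i r where "i \<in> J" "r \<in> carrier R" "x = i \<oplus> c \<otimes> r"
    using assms(2) by (auto simp: adj_def)
  then show "x \<in> J" using ideal_add[OF assms(1)] ideal_mult[OF assms(1,3)] by simp
qed

lemma adj_absorb: "ideal I R \<Longrightarrow> c \<in> I \<Longrightarrow> adj I c = I"
  by (meson adj_least adj_supset ideal_carr subset_antisym subset_refl)

section \<open>Ideals with one or two generators\<close>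

lemma PIdl_iff: "x \<in> PIdl a \<longleftrightarrow> (\<exists>r \<in> carrier R. x = a \<otimes> r)" if "a \<in> carrier R"
proof -
  have "x = r \<otimes> a \<longleftrightarrow> x = a \<otimes> r" if "r \<in> carrier R" for r
    using that \<open>a \<in> carrier R\<close> m_comm by metis
  then show ?thesis by (auto simp: cgenideal_def)
qed

lemma PIdlI: "a \<in> carrier R \<Longrightarrow> r \<in> carrier R \<Longrightarrow> a \<otimes> r \<in> PIdl a"
  by (auto simp: PIdl_iff)

lemma Idl2: "Idl {a, b} = adj (PIdl a) b" if "a \<in> carrier R" "b \<in> carrier R"
proof
  show "Idl {a, b} \<subseteq> adj (PIdl a) b"
    using that adj_self[OF cgenideal_ideal] subsetD[OF adj_supset[OF cgenideal_ideal] cgenideal_self]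
    by (intro genideal_minimal adj_ideal cgenideal_ideal) auto
  show "adj (PIdl a) b \<subseteq> Idl {a, b}"
    using that genideal_ideal[of "{a, b}"] genideal_self[of "{a, b}"] cgenideal_minimal
    by (intro adj_least) auto
qed

lemma Idl2_iff: "x \<in> Idl {a, b} \<longleftrightarrow> (\<exists>r \<in> carrier R. \<exists>s \<in> carrier R. x = a \<otimes> r \<oplus> b \<otimes> s)"
  if "a \<in> carrier R" "b \<in> carrier R"
  using that by (auto simp: Idl2 adj_def PIdl_iff)

text \<open>The colon ideal (K : z). With it, a claim about products z x has to be tested only for x
  in a generating set.\<close>

lemma ideal_colon:
  assumes "ideal K R" "z \<in> carrier R"
  shows "ideal {x \<in> carrier R. z \<otimes> x \<in> K} R"
proof (rule idealI_cring)
  fix x y assume h: "x \<in> {x \<in> carrier R. z \<otimes> x \<in> K}" "y \<in> {x \<in> carrier R. z \<otimes> x \<in> K}"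
  have "z \<otimes> (x \<oplus> y) = z \<otimes> x \<oplus> z \<otimes> y" using assms h r_distr by blast
  then show "x \<oplus> y \<in> {x \<in> carrier R. z \<otimes> x \<in> K}" using h ideal_add[OF assms(1)] by simp
next
  fix x r assume h: "x \<in> {x \<in> carrier R. z \<otimes> x \<in> K}" "r \<in> carrier R"
  then have "z \<otimes> (x \<otimes> r) = z \<otimes> x \<otimes> r" using assms m_assoc by simp
  then show "x \<otimes> r \<in> {x \<in> carrier R. z \<otimes> x \<in> K}" using h ideal_mult[OF assms(1)] by simp
qed (use assms ideal_zero in auto)

lemma Idl_mult_subset:
  assumes K: "ideal K R" and A: "A \<subseteq> carrier R" and z: "z \<in> carrier R"
    and "\<And>a. a \<in> A \<Longrightarrow> z \<otimes> a \<in> K" and "x \<in> Idl A"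
  shows "z \<otimes> x \<in> K"
proof -
  have "Idl A \<subseteq> {x \<in> carrier R. z \<otimes> x \<in> K}"
    using assms by (intro genideal_minimal ideal_colon) auto
  then show ?thesis using assms(5) by blast
qed

lemma ideal_prod_subset:
  assumes "ideal K R" "\<And>i j. i \<in> I \<Longrightarrow> j \<in> J \<Longrightarrow> i \<otimes> j \<in> K"
  shows "ideal_prod R I J \<subseteq> K"
proof
  fix x assume "x \<in> ideal_prod R I J"
  then show "x \<in> K" by induct (use assms ideal_add in auto)
qed

lemma ideal_prod_Idl_subset:
  assumes K: "ideal K R" and A: "A \<subseteq> carrier R" and B: "B \<subseteq> carrier R"
    and AB: "\<And>a b. a \<in> A \<Longrightarrow> b \<in> B \<Longrightarrow> a \<otimes> b \<in> K"
  shows "ideal_prod R (Idl A) (Idl B) \<subseteq> K"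
proof (rule ideal_prod_subset[OF K])
  fix i j assume i: "i \<in> Idl A" and j: "j \<in> Idl B"
  have ic: "i \<in> carrier R" using genideal_ideal[OF A] i ideal_carr by blast
  show "i \<otimes> j \<in> K"
  proof (rule Idl_mult_subset[OF K B ic _ j])
    fix b assume b: "b \<in> B"
    have "b \<otimes> i \<in> K"
      by (rule Idl_mult_subset[OF K A _ _ i]) (use b B AB A m_comm in \<open>auto simp: subset_iff\<close>)
    then show "i \<otimes> b \<in> K" using b B ic m_comm by (metis subsetD)
  qed
qed

section \<open>Powers of an ideal\<close>

lemma ideal_pow_ideal: "ideal I R \<Longrightarrow> ideal (ideal_pow R I n) R"
  by (induct n) (auto simp: oneideal ideal_prod_is_ideal)

lemma ideal_pow_Suc_subset: "ideal I R \<Longrightarrow> ideal_pow R I (Suc n) \<subseteq> ideal_pow R I n"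
  using ideal_prod_inter[OF _ ideal_pow_ideal, of I I n] by simp

lemma ideal_pow_antimono: "ideal I R \<Longrightarrow> k \<le> n \<Longrightarrow> ideal_pow R I n \<subseteq> ideal_pow R I k"
  by (rule lift_Suc_antimono_le[of "ideal_pow R I"]) (use ideal_pow_Suc_subset in blast)+

lemma ideal_pow_1: "ideal I R \<Longrightarrow> ideal_pow R I (Suc 0) = I"
proof
  assume I: "ideal I R"
  show "ideal_pow R I (Suc 0) \<subseteq> I" using ideal_prod_inter[OF I oneideal] by auto
  show "I \<subseteq> ideal_pow R I (Suc 0)"
    using ideal_prod.prod[of _ I \<one> "carrier R" R] I ideal_carr by fastforce
qed

lemma ideal_pow_mult:
  assumes I: "ideal I R" and "x \<in> ideal_pow R I a" "y \<in> ideal_pow R I b"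
  shows "x \<otimes> y \<in> ideal_pow R I (a + b)"
  using assms(2)
proof (induct a arbitrary: x)
  case 0
  then show ?case using ideal_mult'[OF ideal_pow_ideal[OF I] assms(3)] by simp
next
  case (Suc a)
  have y: "y \<in> carrier R" using ideal_carr[OF ideal_pow_ideal[OF I] assms(3)] .
  have "ideal_pow R I (Suc a) \<subseteq> {x \<in> carrier R. y \<otimes> x \<in> ideal_pow R I (Suc a + b)}"
    unfolding ideal_pow.simps(2)
  proof (rule ideal_prod_subset[OF ideal_colon[OF _ y]])
    show "ideal (ideal_pow R I (Suc a + b)) R" using ideal_pow_ideal[OF I] .
    fix i j assume i: "i \<in> I" and j: "j \<in> ideal_pow R I a"
    have c: "i \<in> carrier R" "j \<in> carrier R"
      using ideal_carr[OF I i] ideal_carr[OF ideal_pow_ideal[OF I] j] .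
    have "y \<otimes> (i \<otimes> j) = i \<otimes> (j \<otimes> y)" using c y m_lcomm m_comm by simp
    also have "\<dots> \<in> ideal_pow R I (Suc a + b)"
      using ideal_prod.prod[OF i Suc(1)[OF j]] by simp
    finally show "i \<otimes> j \<in> {x \<in> carrier R. y \<otimes> x \<in> ideal_pow R I (Suc a + b)}"
      using c by simp
  qed
  then show ?case using Suc(2) y m_comm by auto
qed

text \<open>With \<open>ideal_pow_mult\<close> this makes powers additive in the exponent, although
  the recursion peels off one factor at a time. The induction replaces K by its colon ideal with
  respect to the factor removed.\<close>

lemma ideal_pow_Idl_gen:
  assumes I: "ideal I R" and K: "ideal K R"
    and "\<And>x y. x \<in> ideal_pow R I a \<Longrightarrow> y \<in> ideal_pow R I b \<Longrightarrow> x \<otimes> y \<in> K"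
  shows "ideal_pow R I (a + b) \<subseteq> K"
  using assms(2,3)
proof (induct a arbitrary: K)
  case 0
  then show ?case using ideal_carr[OF ideal_pow_ideal[OF I]] one_closed
    by (metis add_0 ideal_pow.simps(1) l_one subsetI)
next
  case (Suc a)
  show ?case unfolding add_Suc ideal_pow.simps(2)
  proof (rule ideal_prod_subset[OF Suc(2)])
    fix i j assume i: "i \<in> I" and j: "j \<in> ideal_pow R I (a + b)"
    have ic: "i \<in> carrier R" using ideal_carr[OF I i] .
    have "ideal_pow R I (a + b) \<subseteq> {x \<in> carrier R. i \<otimes> x \<in> K}"
    proof (rule Suc(1)[OF ideal_colon[OF Suc(2) ic]])
      fix x y assume x: "x \<in> ideal_pow R I a" and y: "y \<in> ideal_pow R I b"
      have c: "x \<in> carrier R" "y \<in> carrier R"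
        using ideal_carr[OF ideal_pow_ideal[OF I] x] ideal_carr[OF ideal_pow_ideal[OF I] y] .
      have "i \<otimes> x \<in> ideal_pow R I (Suc a)" using ideal_prod.prod[OF i x] by simp
      from Suc(3)[OF this y] show "x \<otimes> y \<in> {x \<in> carrier R. i \<otimes> x \<in> K}"
        using c ic m_assoc by simp
    qed
    then show "i \<otimes> j \<in> K" using j by blast
  qed
qed

lemma pow_mem_ideal_pow: "ideal I R \<Longrightarrow> x \<in> I \<Longrightarrow> x [^] (n::nat) \<in> ideal_pow R I n"
proof (induct n)
  case (Suc n)
  have "x [^] Suc n = x \<otimes> x [^] n" using ideal_carr[OF Suc(2,3)] m_comm by simp
  then show ?case using ideal_prod.prod[OF Suc(3) Suc(1)[OF Suc(2,3)], of R] by simp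
qed auto

text \<open>Zorn's lemma, with S arbitrary so that it serves twice: S = {1} leads to maximal ideals,
  a multiplicative S to prime ideals.\<close>

lemma exists_ideal_maximal_avoiding:
  assumes I: "ideal I R" and disj: "I \<inter> S = {}"
  shows "\<exists>P. ideal P R \<and> I \<subseteq> P \<and> P \<inter> S = {} \<and> (\<forall>J. ideal J R \<longrightarrow> P \<subseteq> J \<longrightarrow> J \<inter> S = {} \<longrightarrow> J = P)"
proof -
  let ?A = "{P. ideal P R \<and> I \<subseteq> P \<and> P \<inter> S = {}}"
  have "\<exists>P\<in>?A. \<forall>J\<in>?A. P \<subseteq> J \<longrightarrow> J = P"
  proof (rule subset_Zorn_nonempty)
    show "?A \<noteq> {}" using assms by blast
    fix C assume C: "C \<noteq> {}" "subset.chain ?A C"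
    then have "subset.chain {I. ideal I R} C" by (auto simp: pred_on.chain_def)
    then have "ideal (\<Union>C) R" using chain_Union_is_ideal[of C] C(1) by simp
    moreover have CA: "C \<subseteq> ?A" using C(2) by (simp add: pred_on.chain_def)
    moreover have "I \<subseteq> \<Union>C" using C(1) CA by blast
    moreover have "\<Union>C \<inter> S = {}" using CA by blast
    ultimately show "\<Union>C \<in> ?A" by simp
  qed
  then obtain P where P: "P \<in> ?A" "\<forall>J\<in>?A. P \<subseteq> J \<longrightarrow> J = P" by blast
  then have "\<forall>J. ideal J R \<longrightarrow> P \<subseteq> J \<longrightarrow> J \<inter> S = {} \<longrightarrow> J = P" by auto
  then show ?thesis using P(1) by blast
qed

text \<open>An ideal P maximal among those missing S is prime: if a and b lie outside P, then P + aR
  and P + bR meet S, and the product of the two elements found lies in S and in P + abR, which is P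
  when ab is in P.\<close>

lemma exists_prime_avoiding:
  assumes I: "ideal I R" and disj: "I \<inter> S = {}" and S: "\<one> \<in> S"
    "\<And>x y. x \<in> S \<Longrightarrow> y \<in> S \<Longrightarrow> x \<otimes> y \<in> S"
  shows "\<exists>P. primeideal P R \<and> I \<subseteq> P \<and> P \<inter> S = {}"
proof -
  obtain P where P: "ideal P R" "I \<subseteq> P" "P \<inter> S = {}"
    and mx: "\<And>J. ideal J R \<Longrightarrow> P \<subseteq> J \<Longrightarrow> J \<inter> S = {} \<Longrightarrow> J = P"
    using exists_ideal_maximal_avoiding[OF I disj] by blast
  have "primeideal P R"
  proof (rule primeidealI[OF P(1) is_cring])
    show "carrier R \<noteq> P" using S(1) P(3) one_closed by blast
    fix a b assume ab: "a \<in> carrier R" "b \<in> carrier R" "a \<otimes> b \<in> P"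
    show "a \<in> P \<or> b \<in> P"
    proof (rule ccontr)
      assume n: "\<not> ?thesis"
      have hit: "\<exists>p\<in>P. \<exists>r\<in>carrier R. p \<oplus> c \<otimes> r \<in> S" if c: "c \<in> carrier R" "c \<notin> P" for c
        using mx[OF adj_ideal[OF P(1) c(1)] adj_supset[OF P(1) c(1)]] adj_self[OF P(1) c(1)] c(2)
        by (auto simp: adj_def)
      obtain p r q s where h: "p \<in> P" "r \<in> carrier R" "p \<oplus> a \<otimes> r \<in> S"
         "q \<in> P" "s \<in> carrier R" "q \<oplus> b \<otimes> s \<in> S" using hit[OF ab(1)] hit[OF ab(2)] n by blast
      have c: "p \<in> carrier R" "q \<in> carrier R" using h P(1) ideal_carr by auto
      have "(p \<oplus> a \<otimes> r) \<otimes> (q \<oplus> b \<otimes> s) = p \<otimes> (q \<oplus> b \<otimes> s) \<oplus> q \<otimes> (a \<otimes> r) \<oplus> (a \<otimes> b) \<otimes> (r \<otimes> s)"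
        using c h ab by algebra
      also have "\<dots> \<in> P" using c h ab P(1) by (simp add: ideal_simps)
      finally show False using S(2)[OF h(3,6)] P(3) by blast
    qed
  qed
  then show ?thesis using P by blast
qed

section \<open>Nonzerodivisors\<close>

lemma nzd_cancel:
  assumes "nonzerodivisor R x" "a \<in> carrier R" "b \<in> carrier R" "x \<otimes> a = x \<otimes> b"
  shows "a = b"
proof -
  have x: "x \<in> carrier R" using assms by (simp add: nonzerodivisor_def)
  have "x \<otimes> (a \<ominus> b) = x \<otimes> a \<ominus> x \<otimes> b" using assms(2,3) x by algebra
  then have "x \<otimes> (a \<ominus> b) = \<zero>" using assms(2-4) x by (simp add: r_neg a_minus_def)
  then have "a \<ominus> b = \<zero>" using assms(1-3) unfolding nonzerodivisor_def by blast
  then show ?thesis using assms by simp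
qed

lemma nzd_pow: "nonzerodivisor R x \<Longrightarrow> nonzerodivisor R (x [^] (n::nat))"
proof (induct n)
  case (Suc n)
  have x: "x \<in> carrier R" using Suc(2) by (simp add: nonzerodivisor_def)
  have "y = \<zero>" if y: "y \<in> carrier R" "x [^] Suc n \<otimes> y = \<zero>" for y
  proof -
    have "x [^] n \<otimes> (x \<otimes> y) = \<zero>" using y x m_assoc by simp
    then have "x \<otimes> y = \<zero>" using Suc x y(1) unfolding nonzerodivisor_def by blast
    then show ?thesis using Suc(2) y(1) unfolding nonzerodivisor_def by blast
  qed
  then show ?case using x unfolding nonzerodivisor_def by blast
qed (simp add: nonzerodivisor_def)

lemma nzd_factor:
  assumes "nonzerodivisor R (x \<otimes> y)" "x \<in> carrier R" "y \<in> carrier R"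
  shows "nonzerodivisor R x"
  unfolding nonzerodivisor_def
proof (intro conjI ballI impI)
  fix z assume z: "z \<in> carrier R" "x \<otimes> z = \<zero>"
  have "x \<otimes> y \<otimes> z = y \<otimes> (x \<otimes> z)" using z(1) assms by algebra
  then show "z = \<zero>" using assms z unfolding nonzerodivisor_def by simp
qed fact

end

section \<open>Local rings\<close>

text \<open>Fixing M and asking for units outside it avoids the description operator in
  \<open>max_ideal\<close>. The same results then apply to R and to its completion, where the
  candidate for M is given explicitly.\<close>

locale local_cring = cring +
  fixes M :: "'a set"
  assumes M_ideal: "ideal M R"
    and one_notin_M: "\<one> \<notin> M"
    and Units_outside: "\<And>x. x \<in> carrier R \<Longrightarrow> x \<notin> M \<Longrightarrow> x \<in> Units R"

context cring
begin

lemma unit_mult_mem_ideal: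
  assumes I: "ideal I R" and u: "u \<in> Units R" and x: "x \<in> carrier R" and ux: "u \<otimes> x \<in> I"
  shows "x \<in> I"
proof -
  have "inv u \<otimes> (u \<otimes> x) = x" using u x by (simp add: m_assoc[symmetric] Units_closed)
  then show ?thesis using ideal_mult'[OF I ux Units_inv_closed[OF u]] by simp
qed

lemma unit_mem_ideal:
  assumes I: "ideal I R" and u: "u \<in> Units R" and uI: "u \<in> I"
  shows "I = carrier R"
proof -
  have "\<one> \<in> I" using unit_mult_mem_ideal[OF I u one_closed] u uI by (simp add: Units_closed)
  then show ?thesis using I ideal.one_imp_carrier by blast
qed

lemma two_generated_carrier: "two_generated R (carrier R)"
proof -
  have "Idl {\<one>, \<zero>} = carrier R"
    using genideal_self[of "{\<one>, \<zero>}"] genideal_ideal[of "{\<one>, \<zero>}"] ideal.one_imp_carrier[of "Idl {\<one>, \<zero>}" R]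
    by simp
  then show ?thesis unfolding two_generated_def by (metis one_closed zero_closed)
qed

text \<open>A nonunit x generates an ideal without 1. An ideal that is maximal among those
  containing x and missing 1 is a maximal ideal, hence equal to M.\<close>

lemma local_ring_local_cring:
  assumes "local_ring R"
  shows "local_cring R (max_ideal R)"
proof -
  have ex: "\<exists>!M. maximalideal M R" using assms by (simp add: local_ring_def)
  then have mx: "maximalideal (max_ideal R) R" unfolding max_ideal_def by (rule theI')
  then have id: "ideal (max_ideal R) R" by (simp add: maximalideal.axioms(1))
  have nc: "max_ideal R \<noteq> carrier R"
    using mx by (auto simp: maximalideal_def maximalideal_axioms_def)
  show ?thesis
  proof (intro local_cring.intro local_cring_axioms.intro is_cring id)
    show "\<one> \<notin> max_ideal R" using nc id ideal.one_imp_carrier by blast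
    fix x assume x: "x \<in> carrier R" "x \<notin> max_ideal R"
    show "x \<in> Units R"
    proof (rule ccontr)
      assume nu: "x \<notin> Units R"
      have "PIdl x \<inter> {\<one>} = {}"
      proof (rule ccontr)
        assume "PIdl x \<inter> {\<one>} \<noteq> {}"
        then obtain r where "r \<in> carrier R" "\<one> = x \<otimes> r" using x PIdl_iff by auto
        then have "r \<otimes> x = \<one>" "x \<otimes> r = \<one>" using x m_comm by auto
        then show False using nu x \<open>r \<in> carrier R\<close> by (auto simp: Units_def)
      qed
      from exists_ideal_maximal_avoiding[OF cgenideal_ideal[OF x(1)] this]
      obtain P where P: "ideal P R" "PIdl x \<subseteq> P" "P \<inter> {\<one>} = {}"
        and mxP: "\<And>J. ideal J R \<Longrightarrow> P \<subseteq> J \<Longrightarrow> J \<inter> {\<one>} = {} \<Longrightarrow> J = P" by blast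
      have "maximalideal P R"
      proof (rule maximalidealI[OF P(1)])
        show "carrier R \<noteq> P" using P(3) by auto
        fix J assume J: "ideal J R" "P \<subseteq> J"
        show "J = P \<or> J = carrier R"
        proof (cases "\<one> \<in> J")
          case True
          then show ?thesis using J(1) ideal.one_imp_carrier by blast
        next
          case False
          then show ?thesis using mxP[OF J] by simp
        qed
      qed
      then have "P = max_ideal R" using ex mx by blast
      then show False using x P(2) cgenideal_self[OF x(1)] by blast
    qed
  qed
qed

end

context local_cring
begin

lemma M_carr: "x \<in> M \<Longrightarrow> x \<in> carrier R"
  using ideal_carr[OF M_ideal] .

abbreviation Mpow :: "nat \<Rightarrow> 'a set" where "Mpow \<equiv> ideal_pow R M"

lemma Mpow_ideal: "ideal (Mpow n) R"
  by (rule ideal_pow_ideal[OF M_ideal])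

lemma M_maximal: "maximalideal M R"
proof (rule maximalidealI[OF M_ideal])
  show "carrier R \<noteq> M" using one_notin_M by auto
  fix J assume J: "ideal J R" "M \<subseteq> J" "J \<subseteq> carrier R"
  show "J = M \<or> J = carrier R"
    using unit_mem_ideal[OF J(1) Units_outside] J by blast
qed

lemma proper_subset_M: "ideal I R \<Longrightarrow> \<one> \<notin> I \<Longrightarrow> I \<subseteq> M"
  using unit_mem_ideal[OF _ Units_outside] ideal_carr by blast

lemma maximal_unique: "maximalideal P R \<Longrightarrow> P = M"
proof -
  assume P: "maximalideal P R"
  then have id: "ideal P R" by (simp add: maximalideal.axioms(1))
  have nc: "carrier R \<noteq> P" using P by (auto simp: maximalideal_def maximalideal_axioms_def)
  then have "P \<subseteq> M" using proper_subset_M[OF id] id ideal.one_imp_carrier by blast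
  then have "M = P \<or> M = carrier R"
    using P M_ideal ideal_carr[OF M_ideal] by (auto simp: maximalideal_def maximalideal_axioms_def)
  then show ?thesis using one_notin_M by auto
qed

lemma is_local_ring: "local_ring R"
  unfolding local_ring_def using is_cring M_maximal maximal_unique by blast

lemma max_ideal_eq: "max_ideal R = M"
  unfolding max_ideal_def by (rule the_equality, rule M_maximal, rule maximal_unique)

lemma M_prime: "primeideal M R"
  using maximalideal_prime[OF M_maximal] .

lemma prime_subset_M: "primeideal P R \<Longrightarrow> P \<subseteq> M"
proof -
  assume P: "primeideal P R"
  then have id: "ideal P R" and "carrier R \<noteq> P"
    by (simp_all add: primeideal_def primeideal_axioms_def)
  then have "\<one> \<notin> P" using ideal.one_imp_carrier[OF id] by blast
  then show ?thesis using proper_subset_M[OF id] by blast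
qed

lemma one_minus_unit: "x \<in> M \<Longrightarrow> \<one> \<ominus> x \<in> Units R"
proof (rule Units_outside)
  assume x: "x \<in> M"
  then show "\<one> \<ominus> x \<in> carrier R" using M_carr by simp
  show "\<one> \<ominus> x \<notin> M" using ideal_diff_cancel[OF M_ideal _ x, of \<one>] one_notin_M by auto
qed

text \<open>Nakayama for two generators by elimination: 1 - m1 is a unit, so a can be expressed by k
  and b. After substitution into the second equation, b times an element of 1 + M lies in K.\<close>

lemma nakayama_two:
  assumes K: "ideal K R" and c: "a \<in> carrier R" "b \<in> carrier R" and k: "k \<in> K" "l \<in> K"
    and m: "m1 \<in> M" "m2 \<in> M" "m3 \<in> M" "m4 \<in> M"
    and a: "a = k \<oplus> (a \<otimes> m1 \<oplus> b \<otimes> m2)" and b: "b = l \<oplus> (a \<otimes> m3 \<oplus> b \<otimes> m4)"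
  shows "a \<in> K" "b \<in> K"
proof -
  have kc: "k \<in> carrier R" "l \<in> carrier R" using k ideal_carr[OF K] by auto
  have mc: "m1 \<in> carrier R" "m2 \<in> carrier R" "m3 \<in> carrier R" "m4 \<in> carrier R" using m M_carr by auto
  define u where "u = inv (\<one> \<ominus> m1)"
  have un: "\<one> \<ominus> m1 \<in> Units R" using one_minus_unit m by simp
  have uc: "u \<in> carrier R" "u \<otimes> (\<one> \<ominus> m1) = \<one>" using un by (auto simp: u_def)
  have "a \<otimes> (\<one> \<ominus> m1) = a \<ominus> a \<otimes> m1" using c mc by algebra
  also have "\<dots> = (k \<oplus> (a \<otimes> m1 \<oplus> b \<otimes> m2)) \<ominus> a \<otimes> m1" using a by simp
  also have "\<dots> = k \<oplus> b \<otimes> m2" using c mc kc by algebra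
  finally have "a \<otimes> (u \<otimes> (\<one> \<ominus> m1)) = u \<otimes> (k \<oplus> b \<otimes> m2)"
    using c mc kc uc m_lcomm[of a u "\<one> \<ominus> m1"] by simp
  then have a': "a = u \<otimes> (k \<oplus> b \<otimes> m2)" using uc c by simp
  have mm: "m4 \<oplus> u \<otimes> m2 \<otimes> m3 \<in> M" using m uc mc by (simp add: ideal_simps[OF M_ideal])
  have "(\<one> \<ominus> (m4 \<oplus> u \<otimes> m2 \<otimes> m3)) \<otimes> b = b \<ominus> (b \<otimes> m4 \<oplus> u \<otimes> m2 \<otimes> m3 \<otimes> b)"
    using c mc uc(1) by algebra
  also have "\<dots> = (l \<oplus> (u \<otimes> (k \<oplus> b \<otimes> m2) \<otimes> m3 \<oplus> b \<otimes> m4)) \<ominus> (b \<otimes> m4 \<oplus> u \<otimes> m2 \<otimes> m3 \<otimes> b)"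
    using b a' by simp
  also have "\<dots> = l \<oplus> k \<otimes> (u \<otimes> m3)" using c mc uc(1) kc by algebra
  also have "\<dots> \<in> K" using k mc uc K by (simp add: ideal_simps)
  finally show bK: "b \<in> K" using unit_mult_mem_ideal[OF K one_minus_unit[OF mm]] c by blast
  have "u \<otimes> (k \<oplus> b \<otimes> m2) = k \<otimes> u \<oplus> b \<otimes> (m2 \<otimes> u)" using c mc uc(1) kc by algebra
  also have "\<dots> \<in> K" using k mc uc K bK by (simp add: ideal_simps)
  finally show "a \<in> K" by (subst a')
qed

lemma M_mult_Idl2:
  assumes c: "a \<in> carrier R" "b \<in> carrier R" and x: "x \<in> ideal_prod R M (Idl {a, b})"
  shows "\<exists>m \<in> M. \<exists>n \<in> M. x = a \<otimes> m \<oplus> b \<otimes> n"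
proof -
  let ?T = "{a \<otimes> m \<oplus> b \<otimes> n | m n. m \<in> M \<and> n \<in> M}"
  have id: "ideal ?T R"
  proof (rule idealI_cring)
    show "?T \<subseteq> carrier R" using c M_carr by auto
    have "\<zero> = a \<otimes> \<zero> \<oplus> b \<otimes> \<zero>" using c by simp
    then show "\<zero> \<in> ?T" using ideal_zero[OF M_ideal] by blast
  next
    fix x y assume "x \<in> ?T" "y \<in> ?T"
    then obtain m n m' n' where h: "m \<in> M" "n \<in> M" "m' \<in> M" "n' \<in> M"
      "x = a \<otimes> m \<oplus> b \<otimes> n" "y = a \<otimes> m' \<oplus> b \<otimes> n'" by blast
    have "m \<in> carrier R" "n \<in> carrier R" "m' \<in> carrier R" "n' \<in> carrier R" using h M_carr by auto
    then have "x \<oplus> y = a \<otimes> (m \<oplus> m') \<oplus> b \<otimes> (n \<oplus> n')" unfolding h(5,6) using c by algebra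
    then show "x \<oplus> y \<in> ?T" using h ideal_add[OF M_ideal] by blast
  next
    fix x r assume "x \<in> ?T" and r: "r \<in> carrier R"
    then obtain m n where h: "m \<in> M" "n \<in> M" "x = a \<otimes> m \<oplus> b \<otimes> n" by blast
    have "m \<in> carrier R" "n \<in> carrier R" using h M_carr by auto
    then have "x \<otimes> r = a \<otimes> (m \<otimes> r) \<oplus> b \<otimes> (n \<otimes> r)" unfolding h(3) using c r by algebra
    then show "x \<otimes> r \<in> ?T" using h r ideal_mult[OF M_ideal] by blast
  qed
  have "ideal_prod R M (Idl {a, b}) \<subseteq> ?T"
  proof (rule ideal_prod_subset[OF id])
    fix i j assume i: "i \<in> M" and j: "j \<in> Idl {a, b}"
    obtain r s where h: "r \<in> carrier R" "s \<in> carrier R" "j = a \<otimes> r \<oplus> b \<otimes> s"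
      using j Idl2_iff[OF c] by blast
    have "i \<otimes> j = a \<otimes> (i \<otimes> r) \<oplus> b \<otimes> (i \<otimes> s)" unfolding h(3) using c h(1,2) M_carr[OF i] by algebra
    then show "i \<otimes> j \<in> ?T" using h i ideal_mult[OF M_ideal] by blast
  qed
  then show ?thesis using x by blast
qed

text \<open>Otherwise some prime P contains r but no power of x, so P differs from M. As r is a
  nonzerodivisor, P is not minimal: there is a prime Q inside P that avoids r. The chain Q, P, M
  contradicts dimension one.\<close>

lemma rad_principal:
  assumes dim: "krull_dim R = 1" and r: "nonzerodivisor R r" "r \<in> M" and x: "x \<in> M"
  shows "\<exists>k. x [^] (k::nat) \<in> PIdl r"
proof (rule ccontr)
  assume n: "\<not> ?thesis"
  have rc: "r \<in> carrier R" and xc: "x \<in> carrier R" using r x M_carr by auto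
  let ?S = "range (\<lambda>k::nat. x [^] k)"
  have "\<exists>P. primeideal P R \<and> PIdl r \<subseteq> P \<and> P \<inter> ?S = {}"
  proof (rule exists_prime_avoiding[OF cgenideal_ideal[OF rc]])
    show "PIdl r \<inter> ?S = {}" using n by auto
    show "\<one> \<in> ?S" using nat_pow_0[of x] by (metis rangeI)
    fix u v assume "u \<in> ?S" "v \<in> ?S"
    then show "u \<otimes> v \<in> ?S" using nat_pow_mult[OF xc] by auto
  qed
  then obtain P where P: "primeideal P R" "PIdl r \<subseteq> P" "P \<inter> ?S = {}" by blast
  have Pid: "ideal P R" using P(1) by (simp add: primeideal.axioms(1))
  have rP: "r \<in> P" using P(2) cgenideal_self[OF rc] by blast
  have xP: "x \<notin> P" using P(3) nat_pow_eone[OF xc] by (metis disjoint_iff rangeI)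
  \<comment> \<open>A prime that misses this multiplicative set lies inside P (take i = 0) and does
    not contain r (take i = 1 and s = 1).\<close>
  let ?S2 = "{r [^] (i::nat) \<otimes> s | i s. s \<in> carrier R \<and> s \<notin> P}"
  have oneP: "\<one> \<notin> P" using P(1) Pid ideal.one_imp_carrier[of P R]
    by (auto simp: primeideal_def primeideal_axioms_def)
  have "\<exists>Q. primeideal Q R \<and> {\<zero>} \<subseteq> Q \<and> Q \<inter> ?S2 = {}"
  proof (rule exists_prime_avoiding[OF zeroideal])
    have nz: "r [^] i \<otimes> s \<noteq> \<zero>" if "s \<in> carrier R" "s \<notin> P" for i :: nat and s
      using nzd_pow[OF r(1), of i] that ideal_zero[OF Pid] unfolding nonzerodivisor_def by blast
    have "\<zero> \<notin> ?S2"
    proof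
      assume "\<zero> \<in> ?S2"
      then obtain i s where "\<zero> = r [^] (i::nat) \<otimes> s" "s \<in> carrier R" "s \<notin> P" by blast
      then show False using nz[of s i] by simp
    qed
    then show "{\<zero>} \<inter> ?S2 = {}" by blast
    have "\<one> = r [^] (0::nat) \<otimes> \<one>" by simp
    then show "\<one> \<in> ?S2" using oneP one_closed by blast
    fix u v assume "u \<in> ?S2" "v \<in> ?S2"
    then obtain i s j t where h: "s \<in> carrier R" "s \<notin> P" "t \<in> carrier R" "t \<notin> P"
      "u = r [^] (i::nat) \<otimes> s" "v = r [^] (j::nat) \<otimes> t" by blast
    have "u \<otimes> v = (r [^] i \<otimes> r [^] j) \<otimes> (s \<otimes> t)" unfolding h(5,6)
      using h(1,3) nat_pow_closed[OF rc] by (simp add: m_assoc m_lcomm)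
    then have "u \<otimes> v = r [^] (i + j) \<otimes> (s \<otimes> t)" using nat_pow_mult[OF rc] by simp
    moreover have "s \<otimes> t \<notin> P" using P(1) h(1-4) by (auto simp: primeideal_def primeideal_axioms_def)
    ultimately show "u \<otimes> v \<in> ?S2" using h m_closed by blast
  qed
  then obtain Q where Q: "primeideal Q R" "Q \<inter> ?S2 = {}" by blast
  have Qid: "ideal Q R" using Q(1) by (simp add: primeideal.axioms(1))
  have "Q \<subseteq> P"
  proof
    fix s assume s: "s \<in> Q"
    show "s \<in> P"
    proof (rule ccontr)
      assume "s \<notin> P"
      moreover have sc: "s \<in> carrier R" using ideal_carr[OF Qid s] .
      moreover have "s = r [^] (0::nat) \<otimes> s" using sc by simp
      ultimately have "s \<in> ?S2" by blast
      then show False using s Q(2) by blast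
    qed
  qed
  moreover have "r \<notin> Q"
  proof
    assume "r \<in> Q"
    moreover have "r = r [^] (1::nat) \<otimes> \<one>" using rc by simp
    ultimately show False using Q(2) oneP one_closed by blast
  qed
  ultimately have QP: "Q \<subset> P" using rP by blast
  have PM: "P \<subset> M" using prime_subset_M[OF P(1)] xP x by blast
  define C where "C i = (if i = 0 then Q else if i = Suc 0 then P else M)" for i :: nat
  have "\<forall>i\<le>2. primeideal (C i) R" by (simp add: C_def Q P M_prime)
  moreover have "\<forall>i<2. C i \<subset> C (Suc i)" using QP PM by (auto simp: C_def less_2_cases_iff)
  ultimately have "enat 2 \<le> krull_dim R" unfolding krull_dim_def by (intro Sup_upper) blast
  then show False using dim by (simp add: one_enat_def)
qed

end

section \<open>Reductions of two-generated powers of the maximal ideal\<close>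

context local_cring
begin

lemma unit_combination_generates:
  assumes c: "a \<in> carrier R" "b \<in> carrier R" and r: "r \<in> carrier R" and s: "s \<in> Units R"
    and J: "ideal J R" and a: "a \<in> J" and p: "a \<otimes> r \<oplus> b \<otimes> s \<in> J"
  shows "b \<in> J"
proof -
  have sc: "s \<in> carrier R" using s by (rule Units_closed)
  have "s \<otimes> b = (a \<otimes> r \<oplus> b \<otimes> s) \<ominus> a \<otimes> r" using c r sc by algebra
  then have "s \<otimes> b \<in> J" using J a p r by (simp add: ideal_simps)
  then show ?thesis using unit_mult_mem_ideal[OF J s c(2)] by blast
qed

text \<open>As s is a unit, b can be exchanged for p. In the resulting expression of q by a and p,
  the coefficient w of a must be a unit, since otherwise a w lies in K and q in K + pR.\<close>

lemma exchange_aux: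
  assumes c: "a \<in> carrier R" "b \<in> carrier R"
    and K: "ideal K R" and MK: "\<And>x m. x \<in> Idl {a, b} \<Longrightarrow> m \<in> M \<Longrightarrow> x \<otimes> m \<in> K"
    and rs: "r \<in> carrier R" "s \<in> carrier R" "s \<notin> M"
    and p: "p = a \<otimes> r \<oplus> b \<otimes> s"
    and q: "q \<in> Idl {a, b}" "q \<notin> adj K p"
  shows "Idl {a, b} \<subseteq> adj (adj K p) q"
proof -
  have pc: "p \<in> carrier R" using p rs c by simp
  have s: "s \<in> Units R" using Units_outside rs by simp
  have sub: "{a, b} \<subseteq> carrier R" using c by simp
  have L: "ideal (Idl {a, b}) R" using genideal_ideal[OF sub] .
  have aL: "a \<in> Idl {a, b}" using genideal_self[OF sub] by simp
  have qc: "q \<in> carrier R" using ideal_carr[OF L q(1)] .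
  have T: "ideal (adj K p) R" using adj_ideal[OF K pc] .
  have T2: "ideal (adj (adj K p) q) R" using adj_ideal[OF T qc] .
  obtain u v where uv: "u \<in> carrier R" "v \<in> carrier R" "q = a \<otimes> u \<oplus> b \<otimes> v"
    using q(1) Idl2_iff[OF c] by blast
  define s' where "s' = inv s"
  have s': "s' \<in> carrier R" "s \<otimes> s' = \<one>" using s by (auto simp: s'_def)
  have sc: "s \<in> carrier R" using rs by simp
  define w where "w = u \<ominus> r \<otimes> (s' \<otimes> v)"
  have w: "w \<in> carrier R" using uv s' rs by (simp add: w_def)
  have "p \<otimes> (s' \<otimes> v) \<oplus> a \<otimes> w = (a \<otimes> r \<oplus> b \<otimes> s) \<otimes> (s' \<otimes> v) \<oplus> a \<otimes> (u \<ominus> r \<otimes> (s' \<otimes> v))"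
    by (simp add: p w_def)
  also have "\<dots> = a \<otimes> u \<oplus> b \<otimes> ((s \<otimes> s') \<otimes> v)" using c rs(1) sc s'(1) uv(1,2) by algebra
  also have "\<dots> = q" using s' uv by simp
  finally have qe: "q = a \<otimes> w \<oplus> p \<otimes> (s' \<otimes> v)" using pc s' uv w c
    by (metis a_comm m_closed)
  have "w \<notin> M"
  proof
    assume "w \<in> M"
    then have "a \<otimes> w \<in> K" using MK aL by blast
    then have "q \<in> adj K p" unfolding qe using adjI s' uv by simp
    then show False using q(2) by blast
  qed
  then have wu: "w \<in> Units R" using Units_outside w by simp
  have pT: "p \<in> adj (adj K p) q" using adj_self[OF K pc] adj_supset[OF T qc] by blast
  have qT: "q \<in> adj (adj K p) q" using adj_self[OF T qc] .
  have aT: "a \<in> adj (adj K p) q"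
  proof (rule unit_combination_generates[OF pc c(1) _ wu T2 pT])
    show "s' \<otimes> v \<in> carrier R" using s' uv by simp
    have "p \<otimes> (s' \<otimes> v) \<oplus> a \<otimes> w = q" using qe pc s' uv w c by (metis a_comm m_closed)
    then show "p \<otimes> (s' \<otimes> v) \<oplus> a \<otimes> w \<in> adj (adj K p) q" using qT by simp
  qed
  have bT: "b \<in> adj (adj K p) q"
    using unit_combination_generates[OF c rs(1) s T2 aT] pT p by simp
  show ?thesis using aT bT by (intro genideal_minimal T2) simp
qed

text \<open>Steinitz exchange: modulo K the ideal (a, b) becomes a vector space of dimension at most
  two over R/M, so two of its elements that are independent modulo K generate it.\<close>

lemma exchange:
  assumes c: "a \<in> carrier R" "b \<in> carrier R"
    and K: "ideal K R" and MK: "\<And>x m. x \<in> Idl {a, b} \<Longrightarrow> m \<in> M \<Longrightarrow> x \<otimes> m \<in> K"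
    and p: "p \<in> Idl {a, b}" "p \<notin> K"
    and q: "q \<in> Idl {a, b}" "q \<notin> adj K p"
  shows "Idl {a, b} \<subseteq> adj (adj K p) q"
proof -
  obtain r s where rs: "r \<in> carrier R" "s \<in> carrier R" "p = a \<otimes> r \<oplus> b \<otimes> s"
    using p(1) Idl2_iff[OF c] by blast
  have ab: "a \<in> Idl {a, b}" "b \<in> Idl {a, b}" using genideal_self[of "{a, b}"] c by auto
  show ?thesis
  proof (cases "s \<in> M")
    case False
    then show ?thesis using exchange_aux[OF c K MK rs(1,2) False rs(3) q] by blast
  next
    case True
    have "r \<notin> M" using MK[OF ab(1)] MK[OF ab(2) True] p(2) ideal_add[OF K] rs(3) by blast
    moreover have "p = b \<otimes> s \<oplus> a \<otimes> r" using rs c by (simp add: a_comm)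
    moreover have "Idl {a, b} = Idl {b, a}" by (simp add: insert_commute)
    ultimately show ?thesis
      using exchange_aux[OF c(2,1) K _ rs(2,1), of p q] q MK by simp
  qed
qed

text \<open>Independence modulo K is symmetric: in a relation p = k + q u the factor u would be a
  unit, as p is not in K, and solving for q would put q into K + pR.\<close>

lemma adj_sym_avoid:
  assumes K: "ideal K R" and c: "p \<in> carrier R" "q \<in> carrier R"
    and MK: "\<And>m. m \<in> M \<Longrightarrow> q \<otimes> m \<in> K" and p: "p \<notin> K" and q: "q \<notin> adj K p"
  shows "p \<notin> adj K q"
proof
  assume "p \<in> adj K q"
  then obtain k u where h: "k \<in> K" "u \<in> carrier R" "p = k \<oplus> q \<otimes> u" by (auto simp: adj_def)
  have kc: "k \<in> carrier R" using h(1) ideal_carr[OF K] by blast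
  show False
  proof (cases "u \<in> M")
    case True
    then show False using MK[OF True] h ideal_add[OF K] p by blast
  next
    case False
    have "q \<in> adj K p"
    proof (rule unit_combination_generates[OF kc c(2) one_closed Units_outside[OF h(2) False]])
      show "ideal (adj K p) R" using adj_ideal[OF K c(1)] .
      show "k \<in> adj K p" using adj_supset[OF K c(1)] h(1) by blast
      show "k \<otimes> \<one> \<oplus> q \<otimes> u \<in> adj K p" using adj_self[OF K c(1)] h kc by simp
    qed
    then show False using q by blast
  qed
qed

text \<open>Two distinct lines of a vector space meet in zero; here vectors are classes modulo K and
  the lines are spanned by p and q.\<close>

lemma adj_inter:
  assumes K: "ideal K R" and c: "p \<in> carrier R" "q \<in> carrier R"
    and MK: "\<And>m. m \<in> M \<Longrightarrow> p \<otimes> m \<in> K" and pq: "p \<notin> adj K q"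
    and e: "e \<in> adj K p" "e \<in> adj K q"
  shows "e \<in> K"
proof -
  obtain k u where h: "k \<in> K" "u \<in> carrier R" "e = k \<oplus> p \<otimes> u" using e(1) by (auto simp: adj_def)
  have kc: "k \<in> carrier R" using h(1) ideal_carr[OF K] by blast
  have "u \<in> M"
  proof (rule ccontr)
    assume "u \<notin> M"
    then have "p \<in> adj K q"
      using unit_combination_generates[OF kc c(1) one_closed Units_outside[OF h(2)]
          adj_ideal[OF K c(2)]] adj_supset[OF K c(2)] h e(2) kc by (metis r_one subsetD)
    then show False using pq by blast
  qed
  then show ?thesis using MK h ideal_add[OF K] by blast
qed

lemma ideal_scaled_plus:
  assumes N: "ideal N R" and K: "ideal K R" and y: "y \<in> carrier R"
  shows "ideal {k \<oplus> y \<otimes> w | k w. k \<in> K \<and> w \<in> N} R" (is "ideal ?Y R")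
proof (rule idealI_cring)
  show "?Y \<subseteq> carrier R" using y ideal_carr[OF N] ideal_carr[OF K] by auto
  have "\<zero> = \<zero> \<oplus> y \<otimes> \<zero>" using y by simp
  then show "\<zero> \<in> ?Y" using ideal_zero[OF N] ideal_zero[OF K] by blast
next
  fix u v assume "u \<in> ?Y" "v \<in> ?Y"
  then obtain k w l t where h: "k \<in> K" "w \<in> N" "l \<in> K" "t \<in> N" "u = k \<oplus> y \<otimes> w" "v = l \<oplus> y \<otimes> t"
    by blast
  have "k \<in> carrier R" "l \<in> carrier R" "w \<in> carrier R" "t \<in> carrier R"
    using h ideal_carr[OF N] ideal_carr[OF K] by auto
  then have "u \<oplus> v = (k \<oplus> l) \<oplus> y \<otimes> (w \<oplus> t)" unfolding h(5,6) using y by algebra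
  then show "u \<oplus> v \<in> ?Y" using h ideal_add[OF N] ideal_add[OF K] by blast
next
  fix u r assume "u \<in> ?Y" and r: "r \<in> carrier R"
  then obtain k w where h: "k \<in> K" "w \<in> N" "u = k \<oplus> y \<otimes> w" by blast
  have "k \<in> carrier R" "w \<in> carrier R" using h ideal_carr[OF N] ideal_carr[OF K] by auto
  then have "u \<otimes> r = (k \<otimes> r) \<oplus> y \<otimes> (w \<otimes> r)" unfolding h(3) using y r by algebra
  then show "u \<otimes> r \<in> ?Y" using h r ideal_mult[OF N] ideal_mult[OF K] by blast
qed

text \<open>Turns the search for y into linear algebra over R/M: the inclusion of L = (a, b) in y N
  may be checked modulo M L, since Nakayama applies to the two generators.\<close>

lemma reduction_nakayama:
  assumes c: "a \<in> carrier R" "b \<in> carrier R" and y: "y \<in> carrier R" and N: "ideal N R"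
    and sub: "Idl {a, b} \<subseteq> {k \<oplus> y \<otimes> w | k w. k \<in> ideal_prod R M (Idl {a, b}) \<and> w \<in> N}"
  shows "Idl {a, b} \<subseteq> {y \<otimes> w | w. w \<in> N}"
proof -
  have "\<zero> \<oplus> y \<otimes> w = y \<otimes> w" if "w \<in> N" for w
    using y ideal_carr[OF N that] by simp
  then have "{y \<otimes> w | w. w \<in> N} = {k \<oplus> y \<otimes> w | k w. k \<in> {\<zero>} \<and> w \<in> N}"
    by (metis (no_types, lifting) singletonD singletonI)
  then have K: "ideal {y \<otimes> w | w. w \<in> N} R" using ideal_scaled_plus[OF N zeroideal y] by simp
  have ex: "\<exists>l m n. l \<in> {y \<otimes> w | w. w \<in> N} \<and> m \<in> M \<and> n \<in> M \<and> x = l \<oplus> (a \<otimes> m \<oplus> b \<otimes> n)"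
    if x: "x \<in> Idl {a, b}" for x
  proof -
    obtain k w where h: "k \<in> ideal_prod R M (Idl {a, b})" "w \<in> N" "x = k \<oplus> y \<otimes> w"
      using subsetD[OF sub x] by blast
    obtain m n where mn: "m \<in> M" "n \<in> M" "k = a \<otimes> m \<oplus> b \<otimes> n" using M_mult_Idl2[OF c h(1)] by blast
    have "x = y \<otimes> w \<oplus> (a \<otimes> m \<oplus> b \<otimes> n)"
      using h mn c y M_carr ideal_carr[OF N] by (simp add: a_comm)
    then show ?thesis using h mn by blast
  qed
  have ab: "a \<in> Idl {a, b}" "b \<in> Idl {a, b}" using genideal_self[of "{a, b}"] c by auto
  obtain k m1 m2 where 1: "k \<in> {y \<otimes> w | w. w \<in> N}" "m1 \<in> M" "m2 \<in> M" "a = k \<oplus> (a \<otimes> m1 \<oplus> b \<otimes> m2)"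
    using ex[OF ab(1)] by blast
  obtain l m3 m4 where 2: "l \<in> {y \<otimes> w | w. w \<in> N}" "m3 \<in> M" "m4 \<in> M" "b = l \<oplus> (a \<otimes> m3 \<oplus> b \<otimes> m4)"
    using ex[OF ab(2)] by blast
  have "a \<in> {y \<otimes> w | w. w \<in> N}" "b \<in> {y \<otimes> w | w. w \<in> N}"
    using nakayama_two[OF K c 1(1) 2(1) 1(2,3) 2(2,3) 1(4) 2(4)] by auto
  then show ?thesis by (intro genideal_minimal K) simp
qed

theorem two_generated_power_reduction:
  assumes c: "a \<in> carrier R" "b \<in> carrier R" and L: "Mpow (Suc (Suc n)) = Idl {a, b}"
  shows "\<exists>y \<in> M. Mpow (Suc (Suc n)) \<subseteq> {y \<otimes> w | w. w \<in> Mpow (Suc n)}"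
proof (rule ccontr)
  define N where "N = Mpow (Suc n)"
  define K where "K = ideal_prod R M (Idl {a, b})"
  \<comment> \<open>Modulo K, \<open>Y y\<close> is the image of multiplication by y from N to L.
    That y is bad means that this image is not all of L/K.\<close>
  define Y where "Y y = {k \<oplus> y \<otimes> w | k w. k \<in> K \<and> w \<in> N}" for y
  let ?L = "Idl {a, b}"
  assume "\<not> ?thesis"
  then have bad: "\<not> ?L \<subseteq> Y y" if "y \<in> M" for y
    using reduction_nakayama[OF c M_carr[OF that] Mpow_ideal] that
    unfolding L Y_def K_def N_def by blast
  have sub: "{a, b} \<subseteq> carrier R" using c by simp
  have Lid: "ideal ?L R" using genideal_ideal[OF sub] .
  have N: "ideal N R" unfolding N_def using Mpow_ideal .
  have K: "ideal K R" unfolding K_def using ideal_prod_is_ideal[OF M_ideal Lid] .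
  have Yid: "ideal (Y y) R" if "y \<in> M" for y
    unfolding Y_def using ideal_scaled_plus[OF N K M_carr[OF that]] .
  have KY: "K \<subseteq> Y y" if "y \<in> M" for y
  proof
    fix k assume k: "k \<in> K"
    have "k = k \<oplus> y \<otimes> \<zero>" using ideal_carr[OF K k] M_carr[OF that] by simp
    then show "k \<in> Y y" unfolding Y_def using k ideal_zero[OF N] by blast
  qed
  have yY: "y \<otimes> w \<in> Y y" if "y \<in> M" "w \<in> N" for y w
  proof -
    have "y \<otimes> w = \<zero> \<oplus> y \<otimes> w" using that M_carr ideal_carr[OF N] by simp
    then show ?thesis unfolding Y_def using that ideal_zero[OF K] by blast
  qed
  have MK: "x \<otimes> m \<in> K" if "x \<in> ?L" "m \<in> M" for x m
  proof -
    have "m \<otimes> x \<in> K" unfolding K_def by (rule ideal_prod.prod[OF that(2,1)])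
    then show ?thesis using that M_carr ideal_carr[OF Lid] m_comm by metis
  qed
  have MN: "x \<otimes> w \<in> ?L" if "x \<in> M" "w \<in> N" for x w
    using ideal_prod.prod[OF that, of R] L unfolding N_def by simp
  have MP: "x \<otimes> w \<in> N" if "x \<in> M" "w \<in> Mpow n" for x w
    using ideal_prod.prod[OF that, of R] unfolding N_def by simp
  \<comment> \<open>Because the exponent is at least 2, L is generated by products with two factors
    from M split off, whose roles can be interchanged.\<close>
  have gens: "?L \<subseteq> J" if J: "ideal J R"
    and g: "\<And>x z w. x \<in> M \<Longrightarrow> z \<in> M \<Longrightarrow> w \<in> Mpow n \<Longrightarrow> x \<otimes> (z \<otimes> w) \<in> J" for J
  proof -
    have "ideal_prod R M (ideal_prod R M (Mpow n)) \<subseteq> J"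
    proof (rule ideal_prod_subset[OF J])
      fix i j assume i: "i \<in> M" and j: "j \<in> ideal_prod R M (Mpow n)"
      have "ideal_prod R M (Mpow n) \<subseteq> {x \<in> carrier R. i \<otimes> x \<in> J}"
        using g[OF i] M_carr ideal_carr[OF Mpow_ideal]
        by (intro ideal_prod_subset ideal_colon[OF J M_carr[OF i]]) auto
      then show "i \<otimes> j \<in> J" using j by blast
    qed
    then show ?thesis using L by simp
  qed
  \<comment> \<open>A bad x has an image of dimension at most one, so each of its nonzero elements
    modulo K spans it.\<close>
  have line: "x \<otimes> w \<in> adj K (x \<otimes> w')"
    if x: "x \<in> M" and w: "w \<in> N" "w' \<in> N" and nK: "x \<otimes> w' \<notin> K" for x w w'
  proof (rule ccontr)
    assume n: "x \<otimes> w \<notin> adj K (x \<otimes> w')"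
    have "?L \<subseteq> adj (adj K (x \<otimes> w')) (x \<otimes> w)"
      using exchange[OF c K MK MN[OF x w(2)] nK MN[OF x w(1)] n] by blast
    also have "\<dots> \<subseteq> Y x"
      using KY[OF x] yY[OF x] w by (intro adj_least Yid[OF x])
    finally show False using bad[OF x] by blast
  qed
  have zM: "\<zero> \<in> M" using ideal_zero[OF M_ideal] .
  have "\<not> ?L \<subseteq> K" using KY[OF zM] bad[OF zM] by blast
  then obtain x x2 w where x: "x \<in> M" "x2 \<in> M" "w \<in> Mpow n" "x \<otimes> (x2 \<otimes> w) \<notin> K"
    using gens[OF K] by blast
  define p where "p = x \<otimes> (x2 \<otimes> w)"
  have wc: "x \<in> carrier R" "x2 \<in> carrier R" "w \<in> carrier R"
    using x M_carr ideal_carr[OF Mpow_ideal] by auto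
  have pL: "p \<in> ?L" unfolding p_def using MN[OF x(1) MP[OF x(2,3)]] .
  have pK: "p \<notin> K" using x(4) by (simp add: p_def)
  have pc: "p \<in> carrier R" using ideal_carr[OF Lid pL] .
  have pY: "p \<in> Y x" unfolding p_def using yY[OF x(1) MP[OF x(2,3)]] .
  have "\<not> ?L \<subseteq> adj K p" using adj_least[OF Yid[OF x(1)] KY[OF x(1)] pY] bad[OF x(1)] by blast
  then obtain z z2 v where z: "z \<in> M" "z2 \<in> M" "v \<in> Mpow n" "z \<otimes> (z2 \<otimes> v) \<notin> adj K p"
    using gens[OF adj_ideal[OF K pc]] by blast
  define q where "q = z \<otimes> (z2 \<otimes> v)"
  have vc: "z \<in> carrier R" "z2 \<in> carrier R" "v \<in> carrier R"
    using z M_carr ideal_carr[OF Mpow_ideal] by auto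
  have qL: "q \<in> ?L" unfolding q_def using MN[OF z(1) MP[OF z(2,3)]] .
  have qc: "q \<in> carrier R" using ideal_carr[OF Lid qL] .
  have qp: "q \<notin> adj K p" using z(4) by (simp add: q_def)
  have qK: "q \<notin> K" using qp adj_supset[OF K pc] by blast
  have pq: "p \<notin> adj K q" using adj_sym_avoid[OF K pc qc MK[OF qL] pK qp] .
  have p2: "p = x2 \<otimes> (x \<otimes> w)" unfolding p_def using wc m_lcomm by simp
  have q2: "q = z2 \<otimes> (z \<otimes> v)" unfolding q_def using vc m_lcomm by simp
  \<comment> \<open>As a multiple of z this product lies on the line of q, and as a multiple of x2
    it lies on the line of p. These lines meet only in K.\<close>
  have e1: "z \<otimes> (x2 \<otimes> w) \<in> K"
  proof (rule adj_inter[OF K pc qc MK[OF pL] pq])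
    show "z \<otimes> (x2 \<otimes> w) \<in> adj K q"
      using line[OF z(1) MP[OF x(2,3)] MP[OF z(2,3)]] qK unfolding q_def by blast
    have "z \<otimes> (x2 \<otimes> w) = x2 \<otimes> (z \<otimes> w)" using wc vc m_lcomm by simp
    then show "z \<otimes> (x2 \<otimes> w) \<in> adj K p"
      using line[OF x(2) MP[OF z(1) x(3)] MP[OF x(1,3)]] pK unfolding p2 by simp
  qed
  have e2: "x \<otimes> (z2 \<otimes> v) \<in> K"
  proof (rule adj_inter[OF K pc qc MK[OF pL] pq])
    show "x \<otimes> (z2 \<otimes> v) \<in> adj K p"
      using line[OF x(1) MP[OF z(2,3)] MP[OF x(2,3)]] pK unfolding p_def by blast
    have "x \<otimes> (z2 \<otimes> v) = z2 \<otimes> (x \<otimes> v)" using wc vc m_lcomm by simp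
    then show "x \<otimes> (z2 \<otimes> v) \<in> adj K q"
      using line[OF z(2) MP[OF x(1) z(3)] MP[OF z(1,3)]] qK unfolding q2 by simp
  qed
  \<comment> \<open>Both cross terms vanish modulo K, so y takes x2 w to p and z2 v to q there, and
    its image is all of L/K.\<close>
  define y where "y = x \<oplus> z"
  have y: "y \<in> M" unfolding y_def using ideal_add[OF M_ideal x(1) z(1)] .
  have "p \<in> Y y"
  proof (rule ideal_add_cancel[OF Yid[OF y] _ _ pc])
    have "y \<otimes> (x2 \<otimes> w) = p \<oplus> z \<otimes> (x2 \<otimes> w)" unfolding y_def p_def using wc vc by algebra
    then show "p \<oplus> z \<otimes> (x2 \<otimes> w) \<in> Y y" using yY[OF y MP[OF x(2,3)]] by simp
    show "z \<otimes> (x2 \<otimes> w) \<in> Y y" using e1 KY[OF y] by blast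
  qed
  moreover have "q \<in> Y y"
  proof (rule ideal_add_cancel[OF Yid[OF y] _ _ qc])
    have "y \<otimes> (z2 \<otimes> v) = q \<oplus> x \<otimes> (z2 \<otimes> v)" unfolding y_def q_def using wc vc by algebra
    then show "q \<oplus> x \<otimes> (z2 \<otimes> v) \<in> Y y" using yY[OF y MP[OF z(2,3)]] by simp
    show "x \<otimes> (z2 \<otimes> v) \<in> Y y" using e2 KY[OF y] by blast
  qed
  ultimately have "adj (adj K p) q \<subseteq> Y y" using KY[OF y] by (intro adj_least Yid[OF y])
  then show False using exchange[OF c K MK pL pK qL qp] bad[OF y] by blast
qed

text \<open>The reduction y divides the nonzerodivisor r^(n+2), so it can be cancelled from M^(n+2)
  = y M^(n+1). Dividing the two generators by y gives two generators of M^(n+1), and the descent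
  ends at M itself.\<close>

lemma two_generated_power_descent:
  assumes reg: "r \<in> M" "nonzerodivisor R r"
    and L: "two_generated R (Mpow (Suc (Suc n)))"
  shows "\<exists>y \<in> M. \<exists>c \<in> M. nonzerodivisor R y \<and> M = Idl {y, c} \<and>
     (\<forall>u \<in> M. \<forall>v \<in> M. \<exists>w \<in> M. u \<otimes> v = y \<otimes> w)"
  using L
proof (induct n)
  have step: "\<exists>y \<in> M. nonzerodivisor R y \<and> two_generated R (Mpow (Suc n)) \<and>
      Mpow (Suc (Suc n)) \<subseteq> {y \<otimes> w | w. w \<in> Mpow (Suc n)}"
    if L: "two_generated R (Mpow (Suc (Suc n)))" for n
  proof -
    obtain a b where ab: "a \<in> carrier R" "b \<in> carrier R" "Mpow (Suc (Suc n)) = Idl {a, b}"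
      using L by (auto simp: two_generated_def)
    obtain y where y: "y \<in> M" and
      red: "Mpow (Suc (Suc n)) \<subseteq> {y \<otimes> w | w. w \<in> Mpow (Suc n)}"
      using two_generated_power_reduction[OF ab] by blast
    have yc: "y \<in> carrier R" using M_carr y by blast
    have Nid: "ideal (Mpow (Suc n)) R" using Mpow_ideal .
    have "r [^] Suc (Suc n) \<in> Mpow (Suc (Suc n))" using pow_mem_ideal_pow[OF M_ideal reg(1)] .
    then obtain w where w: "w \<in> Mpow (Suc n)" "r [^] Suc (Suc n) = y \<otimes> w" using red by blast
    have nzd: "nonzerodivisor R y"
      using nzd_factor[of y w] nzd_pow[OF reg(2), of "Suc (Suc n)"] w yc ideal_carr[OF Nid] by metis
    have abI: "a \<in> Idl {a, b}" "b \<in> Idl {a, b}" using genideal_self[of "{a, b}"] ab by auto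
    obtain a' b' where ab': "a' \<in> Mpow (Suc n)" "a = y \<otimes> a'"
      "b' \<in> Mpow (Suc n)" "b = y \<otimes> b'" using red abI ab(3) by blast
    have c': "a' \<in> carrier R" "b' \<in> carrier R" using ab' ideal_carr[OF Nid] by auto
    have "Mpow (Suc n) = Idl {a', b'}"
    proof
      show "Idl {a', b'} \<subseteq> Mpow (Suc n)" using ab' by (intro genideal_minimal Nid) simp
      show "Mpow (Suc n) \<subseteq> Idl {a', b'}"
      proof
        fix x assume x: "x \<in> Mpow (Suc n)"
        then have xc: "x \<in> carrier R" using ideal_carr[OF Nid] by blast
        have "y \<otimes> x \<in> Idl {a, b}" using ideal_prod.prod[OF y x, of R] ab(3) by simp
        then obtain u v where uv: "u \<in> carrier R" "v \<in> carrier R" "y \<otimes> x = a \<otimes> u \<oplus> b \<otimes> v"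
          using Idl2_iff[OF ab(1,2)] by blast
        have "y \<otimes> x = y \<otimes> (a' \<otimes> u \<oplus> b' \<otimes> v)"
          unfolding uv(3) ab'(2,4) using yc c' uv(1,2) by algebra
        then have "x = a' \<otimes> u \<oplus> b' \<otimes> v" using nzd_cancel[OF nzd xc] c' uv by simp
        then show "x \<in> Idl {a', b'}" using Idl2_iff[OF c'] uv by blast
      qed
    qed
    then show ?thesis using y nzd red c' by (auto simp: two_generated_def)
  qed
  {
    case 0
    obtain y where y: "y \<in> M" "nonzerodivisor R y" "two_generated R (Mpow (Suc 0))"
      "Mpow (Suc (Suc 0)) \<subseteq> {y \<otimes> w | w. w \<in> Mpow (Suc 0)}"
      using step[OF 0] by blast
    have M1: "Mpow (Suc 0) = M" using ideal_pow_1[OF M_ideal] .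
    have yM: "\<exists>w \<in> M. u \<otimes> v = y \<otimes> w" if "u \<in> M" "v \<in> M" for u v
    proof -
      have "u \<otimes> v \<in> Mpow (Suc (Suc 0))"
        using ideal_prod.prod[of u M v "Mpow (Suc 0)" R] that M1 by simp
      then show ?thesis using y(4) M1 by auto
    qed
    obtain a b where ab: "a \<in> carrier R" "b \<in> carrier R" "M = Idl {a, b}"
      using y(3) M1 by (auto simp: two_generated_def)
    have abM: "a \<in> M" "b \<in> M" using genideal_self[of "{a, b}"] ab by auto
    have yc: "y \<in> carrier R" using M_carr y(1) by blast
    obtain u v where uv: "u \<in> carrier R" "v \<in> carrier R" "y = a \<otimes> u \<oplus> b \<otimes> v"
      using y(1) ab(3) Idl2_iff[OF ab(1,2)] by blast
    \<comment> \<open>It remains to exchange one of the two generators for y, which is possible once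
      y has a unit coefficient.\<close>
    have key: "\<exists>c\<in>M. M = Idl {y, c}" if h: "a \<in> M" "b \<in> M" "u \<in> carrier R" "v \<in> carrier R"
        "y = a \<otimes> u \<oplus> b \<otimes> v" "M = Idl {a, b}" "v \<notin> M" for a b u v
    proof -
      have ac: "a \<in> carrier R" "b \<in> carrier R" using h M_carr by auto
      have id: "ideal (Idl {y, a}) R" using genideal_ideal[of "{y, a}"] yc ac by simp
      have self: "y \<in> Idl {y, a}" "a \<in> Idl {y, a}" using genideal_self[of "{y, a}"] yc ac by auto
      have "b \<in> Idl {y, a}"
        using unit_combination_generates[OF ac h(3) Units_outside[OF h(4,7)] id self(2)] self(1) h(5) by simp
      then have "Idl {a, b} \<subseteq> Idl {y, a}" using self by (intro genideal_minimal id) simp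
      moreover have "Idl {y, a} \<subseteq> M" using y(1) h(1) by (intro genideal_minimal M_ideal) simp
      ultimately show ?thesis using h(1,6) by blast
    qed
    have "\<exists>c\<in>M. M = Idl {y, c}"
    proof (cases "v \<in> M")
      case False
      then show ?thesis using key[OF abM uv ab(3)] by blast
    next
      case True
      show ?thesis
      proof (cases "u \<in> M")
        case False
        have "y = b \<otimes> v \<oplus> a \<otimes> u" using uv ab by (simp add: a_comm)
        moreover have "M = Idl {b, a}" using ab(3) by (simp add: insert_commute)
        ultimately show ?thesis using key[of b a v u] abM uv False by blast
      next
        \<comment> \<open>If neither coefficient is a unit, then y lies in M^2 = yM, and cancelling
          y puts 1 into M.\<close>
        case uM: True
        obtain w w' where ww: "w \<in> M" "w' \<in> M" "a \<otimes> u = y \<otimes> w" "b \<otimes> v = y \<otimes> w'"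
          using yM[OF abM(1) uM] yM[OF abM(2) True] by blast
        have wM: "w \<oplus> w' \<in> M" using ideal_add[OF M_ideal ww(1,2)] .
        have wc: "w \<in> carrier R" "w' \<in> carrier R" using ww M_carr by auto
        have "y = y \<otimes> w \<oplus> y \<otimes> w'" using uv(3) ww(3,4) by simp
        also have "\<dots> = y \<otimes> (w \<oplus> w')" using yc wc by algebra
        finally have "y \<otimes> \<one> = y \<otimes> (w \<oplus> w')" using yc by simp
        then have "\<one> = w \<oplus> w'" using nzd_cancel[OF y(2)] wc by simp
        then show ?thesis using wM one_notin_M by simp
      qed
    qed
    then show ?case using y yM by blast
  next
    case (Suc n)
    then show ?case using step by blast
  }
qed

end

section \<open>Ideals when the square of the maximal ideal is a multiple of an element\<close>

text \<open>The outcome of the descent. The conditions speak of elements of M only, so they can be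
  verified again in the completion, and the results on ideals derived from them serve both
  rings.\<close>

locale stable_local = local_cring +
  fixes y c :: 'a
  assumes y_mem: "y \<in> M" and c_mem: "c \<in> M" and M_gen: "M = Idl {y, c}"
    and M_square: "\<And>u v. u \<in> M \<Longrightarrow> v \<in> M \<Longrightarrow> \<exists>w \<in> M. u \<otimes> v = y \<otimes> w"
begin

lemma y_carr: "y \<in> carrier R" and c_carr: "c \<in> carrier R"
  using y_mem c_mem M_carr by auto

text \<open>M/yR has dimension at most one over R/M, because c M lies in yR. Hence any b outside yR
  can take the place of c.\<close>

lemma M_gen_swap:
  assumes b: "b \<in> M" "b \<notin> PIdl y"
  shows "M = Idl {y, b}"
proof
  have bc: "b \<in> carrier R" using M_carr b by simp
  have id: "ideal (Idl {y, b}) R" using genideal_ideal[of "{y, b}"] y_carr bc by simp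
  have self: "y \<in> Idl {y, b}" "b \<in> Idl {y, b}" using genideal_self[of "{y, b}"] y_carr bc by auto
  show "Idl {y, b} \<subseteq> M" using b y_mem by (intro genideal_minimal M_ideal) simp
  obtain r s where rs: "r \<in> carrier R" "s \<in> carrier R" "b = y \<otimes> r \<oplus> c \<otimes> s"
    using b(1) M_gen Idl2_iff[OF y_carr c_carr] by blast
  have "s \<notin> M"
  proof
    assume "s \<in> M"
    then obtain w where "w \<in> M" and w2: "c \<otimes> s = y \<otimes> w" using M_square c_mem by blast
    then have w: "w \<in> carrier R" "c \<otimes> s = y \<otimes> w" using M_carr by auto
    have "b = y \<otimes> (r \<oplus> w)" unfolding rs(3) w(2) using rs(1) w(1) y_carr by algebra
    then show False using b(2) PIdlI[OF y_carr, of "r \<oplus> w"] rs w by simp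
  qed
  then have "c \<in> Idl {y, b}"
    using unit_combination_generates[OF y_carr c_carr rs(1) Units_outside[OF rs(2)] id self(1)] self(2) rs(3)
    by simp
  then have "Idl {y, c} \<subseteq> Idl {y, b}" using self(1) by (intro genideal_minimal id) simp
  then show "M \<subseteq> Idl {y, b}" using M_gen by simp
qed

text \<open>The coefficient s is not a unit, since otherwise y^i would lie in I. So s = y p + b q,
  which raises the exponent of the remainder and changes the coefficient of b only by a multiple of
  y^i. This control makes the coefficients converge in the completion.\<close>

lemma ideal_step:
  assumes I: "ideal I R" "I \<subseteq> M" and b: "b \<in> I" "b \<notin> PIdl y"
    and no: "y [^] (i::nat) \<notin> I"
    and x: "b \<otimes> t \<oplus> y [^] i \<otimes> s \<in> I" "t \<in> carrier R" "s \<in> carrier R"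
  shows "\<exists>q \<in> carrier R. \<exists>p \<in> carrier R.
    b \<otimes> t \<oplus> y [^] i \<otimes> s = b \<otimes> (t \<oplus> y [^] i \<otimes> q) \<oplus> y [^] Suc i \<otimes> p"
proof -
  have bc: "b \<in> carrier R" using ideal_carr[OF I(1) b(1)] .
  have yi: "y [^] i \<in> carrier R" using y_carr by simp
  have "s \<in> M"
  proof (rule ccontr)
    assume "s \<notin> M"
    then show False
      using unit_combination_generates[OF bc yi x(2) Units_outside[OF x(3)] I(1) b(1) x(1)] no by blast
  qed
  then obtain p q where pq: "p \<in> carrier R" "q \<in> carrier R" "s = y \<otimes> p \<oplus> b \<otimes> q"
    using M_gen_swap[of b] b I(2) Idl2_iff[OF y_carr bc] by blast
  have "b \<otimes> t \<oplus> y [^] i \<otimes> s = b \<otimes> (t \<oplus> y [^] i \<otimes> q) \<oplus> (y [^] i \<otimes> y) \<otimes> p"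
    unfolding pq(3) using bc x(2) pq(1,2) yi y_carr by algebra
  then show ?thesis using pq by auto
qed

text \<open>Iterates \<open>ideal_step\<close> as long as the powers of y stay outside I. At the
  least i with y^i in I it yields I = (b, y^i).\<close>

lemma ideal_power_expansion:
  assumes I: "ideal I R" "I \<subseteq> M" and b: "b \<in> I" "b \<notin> PIdl y"
    and no: "\<And>j. j < i \<Longrightarrow> y [^] (j::nat) \<notin> I" and x: "x \<in> I"
  shows "\<exists>t \<in> carrier R. \<exists>s \<in> carrier R. x = b \<otimes> t \<oplus> y [^] i \<otimes> s"
  using no
proof (induct i)
  case 0
  have "x = b \<otimes> \<zero> \<oplus> y [^] (0::nat) \<otimes> x" using b x ideal_carr[OF I(1)] by simp
  then show ?case using x ideal_carr[OF I(1)] by blast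
next
  case (Suc i)
  then obtain t s where h: "t \<in> carrier R" "s \<in> carrier R" "x = b \<otimes> t \<oplus> y [^] i \<otimes> s"
    by (metis less_SucI)
  have "y [^] i \<notin> I" using Suc(2) by blast
  then obtain q p where "q \<in> carrier R" "p \<in> carrier R"
    "x = b \<otimes> (t \<oplus> y [^] i \<otimes> q) \<oplus> y [^] Suc i \<otimes> p"
    using ideal_step[OF I b _ _ h(1,2), of i] x unfolding h(3) by blast
  moreover have "t \<oplus> y [^] i \<otimes> q \<in> carrier R" using h(1) \<open>q \<in> carrier R\<close> y_carr by simp
  ultimately show ?case by blast
qed

text \<open>An ideal inside zR is z times its colon ideal, so generators of the colon ideal only
  have to be multiplied by z.\<close>

lemma scaled_Idl2:
  assumes I: "ideal I R" "I \<subseteq> PIdl z" and z: "z \<in> carrier R" and c: "a \<in> carrier R" "b \<in> carrier R"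
    and J: "{x \<in> carrier R. z \<otimes> x \<in> I} = Idl {a, b}"
  shows "I = Idl {z \<otimes> a, z \<otimes> b}"
proof
  have zc: "z \<otimes> a \<in> carrier R" "z \<otimes> b \<in> carrier R" using z c by auto
  have "a \<in> Idl {a, b}" "b \<in> Idl {a, b}" using genideal_self[of "{a, b}"] c by auto
  then have "z \<otimes> a \<in> I" "z \<otimes> b \<in> I" unfolding J[symmetric] by auto
  then show "Idl {z \<otimes> a, z \<otimes> b} \<subseteq> I" by (intro genideal_minimal I) simp
  show "I \<subseteq> Idl {z \<otimes> a, z \<otimes> b}"
  proof
    fix x assume x: "x \<in> I"
    then obtain r where r: "r \<in> carrier R" "x = z \<otimes> r" using I(2) PIdl_iff[OF z] by blast
    then have "r \<in> Idl {a, b}" using x unfolding J[symmetric] by simp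
    then obtain u v where uv: "u \<in> carrier R" "v \<in> carrier R" "r = a \<otimes> u \<oplus> b \<otimes> v"
      using Idl2_iff[OF c] by blast
    have "x = (z \<otimes> a) \<otimes> u \<oplus> (z \<otimes> b) \<otimes> v" unfolding r(2) uv(3) using c z uv(1,2) by algebra
    then show "x \<in> Idl {z \<otimes> a, z \<otimes> b}" using Idl2_iff[OF zc] uv by blast
  qed
qed

text \<open>Dividing by the largest power of y that divides all of I leaves an ideal not contained
  in yR. The element b found there is the one that starts the expansion.\<close>

lemma ideal_strip:
  assumes I: "ideal I R" and e: "I \<subseteq> PIdl (y [^] (e::nat))" "\<not> I \<subseteq> PIdl (y [^] Suc e)"
    and J: "{x \<in> carrier R. y [^] e \<otimes> x \<in> I} \<subseteq> M"
  shows "\<exists>b \<in> carrier R. y [^] e \<otimes> b \<in> I \<and> b \<in> M \<and> b \<notin> PIdl y"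
proof -
  obtain x where x: "x \<in> I" "x \<notin> PIdl (y [^] Suc e)" using e(2) by blast
  obtain b where b: "b \<in> carrier R" "x = y [^] e \<otimes> b"
    using e(1) x(1) PIdl_iff[of "y [^] e" x] y_carr by auto
  have "b \<notin> PIdl y"
  proof
    assume "b \<in> PIdl y"
    then obtain r where r: "r \<in> carrier R" "b = y \<otimes> r" using PIdl_iff[OF y_carr] by blast
    have "x = y [^] Suc e \<otimes> r" using b r y_carr by (simp add: m_assoc)
    then show False using x(2) PIdlI[of "y [^] Suc e" r] r y_carr by simp
  qed
  then show ?thesis using b x(1) J by blast
qed

text \<open>The colon ideal J of I by y^e still contains y^k. If it is proper, it is (b, y^i) with i
  least, and multiplication by y^e gives generators of I.\<close>

lemma two_generated_of_power_mem:
  assumes I: "ideal I R" and e: "I \<subseteq> PIdl (y [^] (e::nat))" "\<not> I \<subseteq> PIdl (y [^] Suc e)"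
    and k: "y [^] (k::nat) \<in> I"
  shows "two_generated R I"
proof -
  define J where "J = {x \<in> carrier R. y [^] e \<otimes> x \<in> I}"
  have yc: "y [^] n \<in> carrier R" for n :: nat using y_carr by simp
  have J: "ideal J R" unfolding J_def using ideal_colon[OF I yc] .
  have "\<exists>a\<in>carrier R. \<exists>b\<in>carrier R. J = Idl {a, b}"
  proof (cases "\<one> \<in> J")
    case True
    then have "J = carrier R" using ideal.one_imp_carrier[OF J] by blast
    then show ?thesis using two_generated_carrier by (simp add: two_generated_def)
  next
    case False
    then have JM: "J \<subseteq> M" using proper_subset_M[OF J] by blast
    obtain b where b: "b \<in> J" "b \<notin> PIdl y" using ideal_strip[OF I e] JM unfolding J_def by blast
    have bc: "b \<in> carrier R" using ideal_carr[OF J b(1)] .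
    have "y [^] k \<in> J" unfolding J_def using k yc ideal_mult'[OF I] by simp
    then obtain i where i: "y [^] (i::nat) \<in> J" "\<And>j. j < i \<Longrightarrow> y [^] j \<notin> J"
      using exists_least_iff[of "\<lambda>i. y [^] i \<in> J"] by blast
    have "J = Idl {b, y [^] i}"
    proof
      show "Idl {b, y [^] i} \<subseteq> J" using b i by (intro genideal_minimal J) simp
      show "J \<subseteq> Idl {b, y [^] i}"
        using ideal_power_expansion[OF J JM b i(2)] Idl2_iff[OF bc yc] by blast
    qed
    then show ?thesis using bc yc by blast
  qed
  then obtain a b where ab: "a \<in> carrier R" "b \<in> carrier R" "J = Idl {a, b}" by blast
  have "I = Idl {y [^] e \<otimes> a, y [^] e \<otimes> b}"
    using scaled_Idl2[OF I e(1) yc ab(1,2)] ab(3) unfolding J_def by blast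
  then show ?thesis unfolding two_generated_def using ab yc m_closed by metis
qed

lemma PIdl_power_antimono: "k \<le> n \<Longrightarrow> PIdl (y [^] (n::nat)) \<subseteq> PIdl (y [^] (k::nat))"
proof (rule cgenideal_minimal[OF cgenideal_ideal])
  assume "k \<le> n"
  then have "y [^] n = y [^] k \<otimes> y [^] (n - k)" using nat_pow_mult[OF y_carr, of k "n - k"] by simp
  then show "y [^] n \<in> PIdl (y [^] k)" using PIdlI[of "y [^] k" "y [^] (n - k)"] y_carr by simp
qed (use y_carr in simp)

lemma exists_strip_exponent:
  assumes I: "ideal I R" and n: "\<not> I \<subseteq> PIdl (y [^] (n::nat))"
  shows "\<exists>e. I \<subseteq> PIdl (y [^] (e::nat)) \<and> \<not> I \<subseteq> PIdl (y [^] Suc e)"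
proof -
  have "PIdl (y [^] (0::nat)) = carrier R"
    using unit_mem_ideal[OF cgenideal_ideal[OF one_closed] Units_one_closed cgenideal_self[OF one_closed]]
    by simp
  then have "I \<subseteq> PIdl (y [^] (0::nat))" using ideal_carr[OF I] by auto
  moreover obtain m where "\<not> I \<subseteq> PIdl (y [^] m)" "\<And>j. j < m \<Longrightarrow> I \<subseteq> PIdl (y [^] (j::nat))"
    using n exists_least_iff[of "\<lambda>m. \<not> I \<subseteq> PIdl (y [^] m)"] by blast
  ultimately show ?thesis by (metis lessI not0_implies_Suc)
qed

text \<open>In dimension one I contains some y^k. It is not contained in y^(k+1) R, since cancelling
  y^k would make y a unit; so there is a largest power of y that can be divided out.\<close>

lemma regular_ideal_two_generated:
  assumes dim: "krull_dim R = 1" and nzd: "nonzerodivisor R y" and I: "regular_ideal R I"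
  shows "two_generated R I"
proof -
  obtain r where r: "ideal I R" "r \<in> I" "nonzerodivisor R r" using I by (auto simp: regular_ideal_def)
  have rc: "r \<in> carrier R" using ideal_carr r by blast
  have "\<exists>k. y [^] (k::nat) \<in> I"
  proof (cases "r \<in> M")
    case True
    obtain k where "y [^] (k::nat) \<in> PIdl r" using rad_principal[OF dim r(3) True y_mem] by blast
    then show ?thesis using cgenideal_minimal[OF r(1,2)] by blast
  next
    case False
    then have "I = carrier R" using unit_mem_ideal[OF r(1) Units_outside[OF rc] r(2)] by blast
    then show ?thesis using y_carr by blast
  qed
  then obtain k where k: "y [^] (k::nat) \<in> I" by blast
  have yk: "y [^] k \<in> carrier R" using y_carr by simp
  have "\<not> I \<subseteq> PIdl (y [^] Suc k)"
  proof
    assume "I \<subseteq> PIdl (y [^] Suc k)"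
    then obtain s where s: "s \<in> carrier R" "y [^] k = y [^] Suc k \<otimes> s"
      using k PIdl_iff[of "y [^] Suc k"] y_carr by auto
    have "y [^] k \<otimes> \<one> = y [^] k \<otimes> (y \<otimes> s)" using s y_carr by (simp add: m_assoc)
    then have "\<one> = y \<otimes> s" using nzd_cancel[OF nzd_pow[OF nzd]] s y_carr by blast
    then show False using one_notin_M ideal_mult[OF M_ideal y_mem s(1)] by simp
  qed
  then obtain e where "I \<subseteq> PIdl (y [^] (e::nat))" "\<not> I \<subseteq> PIdl (y [^] Suc e)"
    using exists_strip_exponent[OF r(1)] by blast
  then show ?thesis using two_generated_of_power_mem[OF r(1) _ _ k] by blast
qed

end

section \<open>Length and the Hilbert-Samuel polynomial\<close>

context local_cring
begin

text \<open>Composition series from I up to J of length exactly n. Each step adds one element c with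
  cM in the ideal reached so far, so its quotient is one-dimensional over R/M. Naming c makes it
  possible to push a series through ring operations.\<close>

inductive compser :: "'a set \<Rightarrow> 'a set \<Rightarrow> nat \<Rightarrow> bool" where
  nil: "ideal I R \<Longrightarrow> compser I I 0"
| step: "compser I J n \<Longrightarrow> c \<in> carrier R \<Longrightarrow> (\<And>x. x \<in> M \<Longrightarrow> c \<otimes> x \<in> J) \<Longrightarrow> c \<notin> J \<Longrightarrow>
    compser I (adj J c) (Suc n)"

lemma compser_ideals: "compser I J n \<Longrightarrow> ideal I R \<and> ideal J R \<and> I \<subseteq> J"
proof (induct rule: compser.induct)
  case (step I J n c)
  then show ?case using adj_ideal adj_supset by blast
qed auto

lemma compser_trans:
  assumes "compser J K b" "compser I J a"
  shows "compser I K (a + b)"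
  using assms
proof (induct rule: compser.induct)
  case (step J K n c)
  then show ?case using compser.step[of I K "a + n" c] by simp
qed simp

text \<open>Only an upper bound, because adding an element to all terms of a series, or multiplying
  all terms by one, can make steps collapse.\<close>

definition compser_le :: "'a set \<Rightarrow> 'a set \<Rightarrow> nat \<Rightarrow> bool" where
  "compser_le I J n \<longleftrightarrow> (\<exists>n'\<le>n. compser I J n')"

lemma compser_le_refl: "ideal I R \<Longrightarrow> compser_le I I 0"
  unfolding compser_le_def using compser.nil by blast

lemma compser_le_step:
  assumes "compser_le I J n" "c \<in> carrier R" "\<And>x. x \<in> M \<Longrightarrow> c \<otimes> x \<in> J"
  shows "compser_le I (adj J c) (Suc n)"
proof -
  obtain n' where n': "n' \<le> n" "compser I J n'" using assms(1) compser_le_def by blast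
  show ?thesis
  proof (cases "c \<in> J")
    case True
    then have "adj J c = J" using adj_absorb compser_ideals[OF n'(2)] by blast
    then show ?thesis using n' le_SucI unfolding compser_le_def by metis
  next
    case False
    then show ?thesis using compser.step[OF n'(2) assms(2,3)] n'(1) unfolding compser_le_def by blast
  qed
qed

lemma compser_le_trans: "compser_le I J a \<Longrightarrow> compser_le J K b \<Longrightarrow> compser_le I K (a + b)"
  unfolding compser_le_def using compser_trans add_mono by meson

lemma adj_commute:
  assumes J: "ideal J R" and c: "c \<in> carrier R" "p \<in> carrier R"
  shows "adj (adj J c) p = adj (adj J p) c"
proof -
  have "adj (adj J c) p \<subseteq> adj (adj J p) c" if c: "c \<in> carrier R" "p \<in> carrier R" for c p
  proof -
    have Jp: "ideal (adj J p) R" and T: "ideal (adj (adj J p) c) R"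
      using adj_ideal J c by auto
    have "adj J c \<subseteq> adj (adj J p) c"
      using adj_supset[OF J c(2)] adj_supset[OF Jp c(1)] adj_self[OF Jp c(1)]
      by - (rule adj_least[OF T], blast+)
    then show ?thesis
      using adj_self[OF J c(2)] adj_supset[OF Jp c(1)] by - (rule adj_least[OF T], blast+)
  qed
  then show ?thesis using c by blast
qed

lemma compser_adj:
  assumes "compser I J n" "p \<in> carrier R"
  shows "compser_le (adj I p) (adj J p) n"
  using assms(1)
proof (induct rule: compser.induct)
  case (nil I)
  then show ?case using compser_le_refl adj_ideal assms(2) by blast
next
  case (step I J n c)
  have J: "ideal J R" using compser_ideals step by blast
  have "c \<otimes> x \<in> adj J p" if "x \<in> M" for x using step(4)[OF that] adj_supset[OF J assms(2)] by blast
  then have "compser_le (adj I p) (adj (adj J p) c) (Suc n)"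
    using compser_le_step[OF step(2,3)] by blast
  then show ?case using adj_commute[OF J step(3) assms(2)] by simp
qed

lemma scale_ideal:
  assumes I: "ideal I R" and p: "p \<in> carrier R"
  shows "ideal ((\<otimes>) p ` I) R"
proof -
  have "\<zero> \<oplus> p \<otimes> w = p \<otimes> w" if "w \<in> I" for w using p ideal_carr[OF I that] by simp
  then have "(\<otimes>) p ` I = {k \<oplus> p \<otimes> w | k w. k \<in> {\<zero>} \<and> w \<in> I}" by force
  then show ?thesis using ideal_scaled_plus[OF I zeroideal p] by simp
qed

lemma scale_adj:
  assumes J: "ideal J R" and c: "c \<in> carrier R" and p: "p \<in> carrier R"
  shows "(\<otimes>) p ` adj J c = adj ((\<otimes>) p ` J) (p \<otimes> c)"
proof -
  have eq: "p \<otimes> (j \<oplus> c \<otimes> r) = p \<otimes> j \<oplus> p \<otimes> c \<otimes> r" if "j \<in> J" "r \<in> carrier R" for j r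
    using ideal_carr[OF J that(1)] that(2) p c by algebra
  show ?thesis
  proof
    show "(\<otimes>) p ` adj J c \<subseteq> adj ((\<otimes>) p ` J) (p \<otimes> c)"
    proof
      fix x assume "x \<in> (\<otimes>) p ` adj J c"
      then obtain j r where "j \<in> J" "r \<in> carrier R" "x = p \<otimes> (j \<oplus> c \<otimes> r)" by (auto simp: adj_def)
      then show "x \<in> adj ((\<otimes>) p ` J) (p \<otimes> c)" using eq adjI by simp
    qed
    show "adj ((\<otimes>) p ` J) (p \<otimes> c) \<subseteq> (\<otimes>) p ` adj J c"
    proof
      fix x assume "x \<in> adj ((\<otimes>) p ` J) (p \<otimes> c)"
      then obtain j r where h: "j \<in> J" "r \<in> carrier R" "x = p \<otimes> j \<oplus> p \<otimes> c \<otimes> r" by (auto simp: adj_def)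
      then have "x = p \<otimes> (j \<oplus> c \<otimes> r)" using eq by simp
      then show "x \<in> (\<otimes>) p ` adj J c" using adjI[OF h(1,2)] by blast
    qed
  qed
qed

text \<open>Multiplication by p maps J/I onto pJ/pI, so the length cannot grow. This will bound the
  length of p^k R / p^(k+1) R by that of R/pR.\<close>

lemma compser_scale:
  assumes "compser I J n" "p \<in> carrier R"
  shows "compser_le ((\<otimes>) p ` I) ((\<otimes>) p ` J) n"
  using assms(1)
proof (induct rule: compser.induct)
  case (nil I)
  then show ?case using compser_le_refl scale_ideal assms(2) by blast
next
  case (step I J n c)
  have J: "ideal J R" using compser_ideals step by blast
  have "p \<otimes> c \<otimes> x \<in> (\<otimes>) p ` J" if "x \<in> M" for x
    using step(4)[OF that] m_assoc[OF assms(2) step(3) M_carr[OF that]] by blast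
  then have "compser_le ((\<otimes>) p ` I) (adj ((\<otimes>) p ` J) (p \<otimes> c)) (Suc n)"
    using compser_le_step[OF step(2)] step(3) assms(2) by blast
  then show ?case using scale_adj[OF J step(3) assms(2)] by simp
qed

text \<open>Counting the steps of the series at which an ideal K picks up a new element gives a
  strictly monotone function, as in the proof of the Jordan-Hoelder theorem.\<close>

lemma compser_height:
  assumes "compser I J n"
  shows "\<exists>h :: 'a set \<Rightarrow> nat. (\<forall>K. h K \<le> n) \<and>
    (\<forall>K K'. ideal K R \<longrightarrow> ideal K' R \<longrightarrow> I \<subseteq> K \<longrightarrow> K \<subset> K' \<longrightarrow> K' \<subseteq> J \<longrightarrow> h K < h K')"
  using assms
proof (induct rule: compser.induct)
  case (nil I)
  then show ?case by (intro exI[of _ "\<lambda>_. 0"]) auto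
next
  case (step I J n c)
  have J: "ideal J R" and IJ: "I \<subseteq> J" using compser_ideals[OF step(1)] by auto
  obtain h where h: "\<And>K. h K \<le> n"
    "\<And>K K'. ideal K R \<Longrightarrow> ideal K' R \<Longrightarrow> I \<subseteq> K \<Longrightarrow> K \<subset> K' \<Longrightarrow> K' \<subseteq> J \<Longrightarrow> h K < h K'"
    using step(2) by blast
  define g where "g K = h (K \<inter> J) + (if K \<subseteq> J then 0 else 1)" for K
  have "g K < g K'" if K: "ideal K R" "ideal K' R" "I \<subseteq> K" "K \<subset> K'" "K' \<subseteq> adj J c" for K K'
  proof (cases "K \<inter> J = K' \<inter> J")
    case False
    then have "K \<inter> J \<subset> K' \<inter> J" using K(4) by blast
    then have "h (K \<inter> J) < h (K' \<inter> J)" using h(2) i_intersect J K IJ by (metis Int_lower2 le_inf_iff)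
    moreover have "K' \<subseteq> J \<Longrightarrow> K \<subseteq> J" using K(4) by blast
    ultimately show ?thesis by (simp add: g_def)
  next
    case True
    obtain x where x: "x \<in> K'" "x \<notin> K" using K(4) by blast
    then have xJ: "x \<notin> J" using True by blast
    \<comment> \<open>An element z of K outside J would generate \<open>adj J c\<close> modulo J.
      Subtracting a multiple of z from x would lead into the common intersection with J, hence into
      K, and x would lie in K.\<close>
    have "K \<subseteq> J"
    proof
      fix z assume z: "z \<in> K"
      show "z \<in> J"
      proof (rule ccontr)
        assume zJ: "z \<notin> J"
        obtain j r where jr: "j \<in> J" "r \<in> carrier R" "z = j \<oplus> c \<otimes> r"
          using subsetD[OF K(5), of z] z K(4) unfolding adj_def by blast
        obtain i s where xi: "i \<in> J" "s \<in> carrier R" "x = i \<oplus> c \<otimes> s"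
          using subsetD[OF K(5) x(1)] unfolding adj_def by blast
        have jc: "j \<in> carrier R" "i \<in> carrier R" using jr xi ideal_carr[OF J] by auto
        have "r \<notin> M" using zJ jr step(4) ideal_add[OF J] by blast
        then have r: "r \<in> Units R" using Units_outside jr by blast
        define t where "t = inv r"
        have t: "t \<in> carrier R" "r \<otimes> t = \<one>" using r by (auto simp: t_def)
        have zc: "z \<in> carrier R" "x \<in> carrier R" using z x ideal_carr K by auto
        have "z \<otimes> (t \<otimes> s) = j \<otimes> (t \<otimes> s) \<oplus> c \<otimes> ((r \<otimes> t) \<otimes> s)"
          unfolding jr(3) using jc(1) t(1) xi(2) jr(2) step(3) by algebra
        then have zt: "z \<otimes> (t \<otimes> s) = j \<otimes> (t \<otimes> s) \<oplus> c \<otimes> s" using t xi by simp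
        have "x \<ominus> z \<otimes> (t \<otimes> s) = i \<ominus> j \<otimes> (t \<otimes> s)"
          unfolding zt xi(3) using jc t(1) xi(2) step(3) by algebra
        then have "x \<ominus> z \<otimes> (t \<otimes> s) \<in> J" using J jr xi t by (simp add: ideal_simps)
        moreover have "x \<ominus> z \<otimes> (t \<otimes> s) \<in> K'"
          using x z K(2,4) t xi by (meson ideal_diff ideal_mult m_closed psubsetD)
        ultimately have "x \<ominus> z \<otimes> (t \<otimes> s) \<in> K" using True by blast
        then have "x \<in> K" using ideal_diff_cancel[OF K(1) _ _ zc(2)] ideal_mult[OF K(1) z] t xi by simp
        then show False using x by blast
      qed
    qed
    then show ?thesis using True xJ x by (auto simp: g_def)
  qed
  moreover have "g K \<le> Suc n" for K using h(1)[of "K \<inter> J"] by (simp add: g_def)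
  ultimately show ?case by blast
qed

lemma compser_chain_le:
  assumes "compser I J n" and id: "\<And>i. i \<le> p \<Longrightarrow> ideal (K i) R" and K: "I \<subseteq> K 0" "K p \<subseteq> J"
    and st: "\<And>i. i < p \<Longrightarrow> K i \<subset> K (Suc i)"
  shows "p \<le> n"
proof -
  obtain h :: "'a set \<Rightarrow> nat" where h: "\<And>K. h K \<le> n"
    "\<And>K K'. ideal K R \<Longrightarrow> ideal K' R \<Longrightarrow> I \<subseteq> K \<Longrightarrow> K \<subset> K' \<Longrightarrow> K' \<subseteq> J \<Longrightarrow> h K < h K'"
    using compser_height[OF assms(1)] by blast
  have mono: "K i \<subseteq> K j" if "i \<le> j" "j \<le> p" for i j
    using that
  proof (induct j)
    case (Suc j)
    then show ?case using st[of j] by (cases "i = Suc j") auto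
  qed simp
  have "i \<le> h (K i)" if "i \<le> p" for i
    using that
  proof (induct i)
    case (Suc i)
    then have "I \<subseteq> K i" "K (Suc i) \<subseteq> J" using mono[of 0 i] mono[of "Suc i" p] K by auto
    then have "h (K i) < h (K (Suc i))" using h(2) id st Suc by simp
    then show ?case using Suc by simp
  qed simp
  then show ?thesis using h(1) order_trans by blast
qed

lemma compser_chain:
  assumes "compser I J n"
  shows "\<exists>K. K 0 = I \<and> K n = J \<and> (\<forall>i\<le>n. ideal (K i) R) \<and> (\<forall>i<n. K i \<subset> K (Suc i))"
  using assms
proof (induct rule: compser.induct)
  case (nil I)
  then show ?case by (intro exI[of _ "\<lambda>_. I"]) simp
next
  case (step I J n c)
  obtain K where K: "K 0 = I" "K n = J" "\<forall>i\<le>n. ideal (K i) R" "\<forall>i<n. K i \<subset> K (Suc i)"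
    using step(2) by blast
  have J: "ideal J R" using K by auto
  have "J \<subset> adj J c" using adj_supset[OF J step(3)] adj_self[OF J step(3)] step(5) by blast
  then show ?case using K adj_ideal[OF J step(3)]
    by (intro exI[of _ "K(Suc n := adj J c)"]) (auto simp: less_Suc_eq le_Suc_eq)
qed

text \<open>A series is a strict chain, and \<open>compser_chain_le\<close> bounds every strict
  chain between I and J. In particular the length of a series depends only on its ends.\<close>

lemma compser_mono:
  assumes "compser I J n" "compser I' J' n'" "I \<subseteq> I'" "J' \<subseteq> J"
  shows "n' \<le> n"
proof -
  obtain K where "K 0 = I'" "K n' = J'" "\<forall>i\<le>n'. ideal (K i) R" "\<forall>i<n'. K i \<subset> K (Suc i)"
    using compser_chain[OF assms(2)] by blast
  then show ?thesis using compser_chain_le[OF assms(1), of n' K] assms(3,4) by simp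
qed

lemma compser_colength:
  assumes "compser I (carrier R) n"
  shows "colength R I = enat n"
  unfolding colength_def
proof (rule antisym)
  show "Sup {enat n |n. \<exists>J. J 0 = I \<and> J n = carrier R \<and> (\<forall>i\<le>n. ideal (J i) R) \<and> (\<forall>i<n. J i \<subset> J (Suc i))} \<le> enat n"
    using compser_chain_le[OF assms] by (intro Sup_least) force
  show "enat n \<le> Sup {enat n |n. \<exists>J. J 0 = I \<and> J n = carrier R \<and> (\<forall>i\<le>n. ideal (J i) R) \<and> (\<forall>i<n. J i \<subset> J (Suc i))}"
    using compser_chain[OF assms] by (intro Sup_upper) blast
qed

lemma compser_sum:
  assumes h: "\<And>k. compser (Mpow (Suc k)) (Mpow k) (h k)"
  shows "compser (Mpow k) (carrier R) (\<Sum>j<k. h j)"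
proof (induct k)
  case 0
  then show ?case using compser.nil[OF oneideal] by simp
next
  case (Suc k)
  then show ?case using compser_trans[OF Suc h[of k]] by (simp add: add.commute)
qed

text \<open>The colength of M^k is the sum of h over the degrees below k, hence linear in k from k0
  on, and polynomials that agree at infinitely many points are equal. For e = 0 the leading
  coefficient of the result is d.\<close>

lemma hilbert_samuel_poly_eq:
  assumes h: "\<And>k. compser (Mpow (Suc k)) (Mpow k) (h k)"
    and e: "\<And>k. k \<ge> k0 \<Longrightarrow> h k = e"
  shows "\<exists>d. hilbert_samuel_poly R = [:d, real e:]"
proof -
  note cs = compser_sum[OF h]
  \<comment> \<open>Corrects for the degrees below k0, where h may differ from e.\<close>
  define d where "d = real (\<Sum>j<k0. h j) - real (k0 * e)"
  have sum: "real (\<Sum>j<k. h j) = poly [:d, real e:] (real k)" if "k \<ge> k0" for k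
    using that
  proof (induct rule: dec_induct)
    case base
    then show ?case by (simp add: d_def)
  next
    case (step n)
    then show ?case using e[of n] by (simp add: algebra_simps)
  qed
  have ev: "\<forall>\<^sub>F k in sequentially. \<exists>l. colength R (ideal_pow R (max_ideal R) k) = enat l \<and>
      real l = poly [:d, real e:] (real k)"
    unfolding eventually_sequentially max_ideal_eq using compser_colength[OF cs] sum by blast
  have "hilbert_samuel_poly R = [:d, real e:]"
    unfolding hilbert_samuel_poly_def
  proof (rule the_equality)
    show "\<forall>\<^sub>F k in sequentially. \<exists>l. colength R (ideal_pow R (max_ideal R) k) = enat l \<and>
      real l = poly [:d, real e:] (real k)" using ev .
    fix P assume "\<forall>\<^sub>F k in sequentially. \<exists>l. colength R (ideal_pow R (max_ideal R) k) = enat l \<and>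
      real l = poly P (real k)"
    then have "\<forall>\<^sub>F k in sequentially. poly (P - [:d, real e:]) (real k) = 0"
      using ev by eventually_elim auto
    then obtain n where n: "\<And>k. k \<ge> n \<Longrightarrow> poly (P - [:d, real e:]) (real k) = 0"
      unfolding eventually_sequentially by blast
    have "\<not> finite (real ` {n..})" using finite_imageD[of real "{n..}"] infinite_Ici[of n]
      by (auto simp: inj_on_def)
    moreover have "real ` {n..} \<subseteq> {x. poly (P - [:d, real e:]) x = 0}" using n by auto
    ultimately have "P - [:d, real e:] = 0" using poly_roots_finite finite_subset by blast
    then show "P = [:d, real e:]" by simp
  qed
  then show ?thesis by blast
qed

end

section \<open>Monomials\<close>

text \<open>A monomial of degree k in r variables is encoded as the multiset of its variable
  indices. Multisets carry a total order compatible with multiplication, which plays the role of a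
  monomial order.\<close>

definition monomials :: "nat \<Rightarrow> nat \<Rightarrow> nat multiset set" where
  "monomials r k = {u. size u = k \<and> set_mset u \<subseteq> {..<r}}"

lemma finite_monomials: "finite (monomials r k)"
proof (rule finite_subset)
  show "monomials r k \<subseteq> mset ` {xs. set xs \<subseteq> {..<r} \<and> length xs = k}"
  proof
    fix u assume u: "u \<in> monomials r k"
    obtain xs where xs: "mset xs = u" using ex_mset by blast
    then have "set xs \<subseteq> {..<r}" "length xs = k" using u by (auto simp: monomials_def)
    then show "u \<in> mset ` {xs. set xs \<subseteq> {..<r} \<and> length xs = k}" using xs by blast
  qed
qed (use finite_lists_length_eq in blast)

lemma size_le_card_times_bound:
  assumes "set_mset u \<subseteq> {..<r}" "\<And>i. i < r \<Longrightarrow> count u i \<le> n"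
  shows "size u \<le> r * n"
proof -
  have "size u \<le> (\<Sum>i<r. count u i)"
    unfolding size_multiset_overloaded_eq using assms(1) by (intro sum_mono2) auto
  also have "\<dots> \<le> (\<Sum>i<r. n)" using assms(2) by (intro sum_mono) simp
  finally show ?thesis by simp
qed

text \<open>An order ideal of monomials whose Hilbert function h is bounded by c on average contains no
  monomial with two exponents at least 2c; so in high degree exactly one exponent is large, and
  lowering it is injective. Hence h is eventually nonincreasing.\<close>

lemma order_ideal_hilbert_function:
  fixes S :: "nat multiset set"
  assumes down: "\<And>i u. add_mset i u \<in> S \<Longrightarrow> u \<in> S"
    and vars: "\<And>u. u \<in> S \<Longrightarrow> set_mset u \<subseteq> {..<r}"
    and bound: "\<And>k. (\<Sum>j<k. card {u \<in> S. size u = j}) \<le> c * k"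
  shows "\<exists>e k0. \<forall>k\<ge>k0. card {u \<in> S. size u = k} = e"
proof -
  define h where "h k = card {u \<in> S. size u = k}" for k
  have fin: "finite {u \<in> S. size u = k}" for k
    by (rule finite_subset[OF _ finite_monomials[of r k]]) (use vars in \<open>auto simp: monomials_def\<close>)
  have sub: "v \<in> S" if uS: "u \<in> S" and vu: "v \<subseteq># u" for u v
  proof -
    obtain w where w: "u = v + w" using vu by (auto simp: mset_subset_eq_exists_conv)
    have "v + w \<in> S \<Longrightarrow> v \<in> S" by (induct w) (auto dest: down)
    then show ?thesis using uS w by blast
  qed
  \<comment> \<open>Two exponents of at least E give t + 1 monomials in every degree t up to E, in
    total (E + 1)(E + 2)/2. For E = 2c + 1 this exceeds the permitted c (E + 1).\<close>
  define E where "E = 2 * c + 1"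
  have excl: "count u j < E" if u: "u \<in> S" and ij: "i \<noteq> j" "count u i \<ge> E" for u i j
  proof (rule ccontr)
    assume j: "\<not> count u j < E"
    have "Suc t \<le> h t" if t: "t \<le> E" for t
    proof -
      let ?f = "\<lambda>a. replicate_mset a i + replicate_mset (t - a) j"
      have cnt: "count (?f a) i = a" for a using ij(1) by simp
      have "inj_on ?f {..t}"
      proof (rule inj_onI)
        fix a b assume "?f a = ?f b"
        then have "count (?f a) i = count (?f b) i" by (rule arg_cong)
        then show "a = b" unfolding cnt .
      qed
      then have "Suc t = card (?f ` {..t})" by (simp add: card_image)
      also have "\<dots> \<le> h t"
        unfolding h_def
      proof (rule card_mono[OF fin], rule image_subsetI)
        fix a assume a: "a \<in> {..t}"
        have "?f a \<subseteq># u"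
          unfolding subseteq_mset_def using ij j a t by (auto split: if_splits)
        then show "?f a \<in> {u \<in> S. size u = t}" using sub[OF u] a by simp
      qed
      finally show ?thesis .
    qed
    then have "(\<Sum>t<Suc E. Suc t) \<le> (\<Sum>t<Suc E. h t)" by (intro sum_mono) simp
    also have "\<dots> \<le> c * Suc E" using bound unfolding h_def by blast
    finally have "2 * (\<Sum>t<Suc E. Suc t) \<le> 2 * (c * Suc E)" by simp
    moreover have "2 * (\<Sum>t<n. Suc t) = n * Suc n" for n by (induct n) auto
    ultimately have "Suc E * Suc (Suc E) \<le> 2 * c * Suc E" by simp
    then have "Suc (Suc E) \<le> 2 * c"
      by (metis mult.commute mult_le_cancel1 zero_less_Suc)
    then show False by (simp add: E_def)
  qed
  \<comment> \<open>In degree k + 1 > r (E + 1) some exponent is at least E + 2. Lowering it leaves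
    at least E + 1, so two monomials with the same image that were lowered at different places would
    have two exponents of at least E.\<close>
  have dec: "h (Suc k) \<le> h k" if k: "k \<ge> r * Suc E" for k
  proof -
    have ex: "\<exists>i. count u i \<ge> Suc (Suc E)" if u: "u \<in> S" "size u = Suc k" for u
    proof (rule ccontr)
      assume "\<not> ?thesis"
      then have "size u \<le> r * Suc E"
        by (intro size_le_card_times_bound[OF vars[OF u(1)]]) (simp add: not_le less_Suc_eq_le)
      then show False using u(2) k by simp
    qed
    define d where "d u = (SOME i. count u i \<ge> Suc (Suc E))" for u :: "nat multiset"
    have d: "count u (d u) \<ge> Suc (Suc E)" if "u \<in> S" "size u = Suc k" for u
      unfolding d_def using someI_ex[OF ex[OF that]] .
    have "inj_on (\<lambda>u. u - {#d u#}) {u \<in> S. size u = Suc k}"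
    proof (rule inj_onI)
      fix u v assume u: "u \<in> {u \<in> S. size u = Suc k}" and v: "v \<in> {u \<in> S. size u = Suc k}"
        and eq: "u - {#d u#} = v - {#d v#}"
      have du: "count u (d u) \<ge> Suc (Suc E)" "count v (d v) \<ge> Suc (Suc E)" using d u v by auto
      have mem: "d u \<in># u" "d v \<in># v" using du by (auto simp flip: count_greater_zero_iff)
      have "d u = d v"
      proof (rule ccontr)
        assume ne: "d u \<noteq> d v"
        have "count (u - {#d u#}) (d u) \<ge> Suc E" using du by simp
        then have "count v (d u) \<ge> E" using ne unfolding eq by simp
        moreover have "v \<in> S" using v by simp
        ultimately show False using excl[of v "d u" "d v"] ne du by simp
      qed
      then show "u = v" using eq mem by (metis insert_DiffM)
    qed
    then have "h (Suc k) = card ((\<lambda>u. u - {#d u#}) ` {u \<in> S. size u = Suc k})"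
      by (simp add: h_def card_image)
    also have "\<dots> \<le> h k"
      unfolding h_def
    proof (rule card_mono[OF fin], rule image_subsetI)
      fix u assume u: "u \<in> {u \<in> S. size u = Suc k}"
      then have "d u \<in># u" using d[of u] by (auto simp flip: count_greater_zero_iff)
      then show "u - {#d u#} \<in> {u \<in> S. size u = k}"
        using u sub[of u "u - {#d u#}"] by (simp add: size_Diff_singleton)
    qed
    finally show ?thesis .
  qed
  \<comment> \<open>From k1 on h does not increase, so it is constant once it attains its minimum
    there.\<close>
  define k1 where "k1 = r * Suc E"
  obtain k0 where k0: "k0 \<ge> k1" "\<And>k. k \<ge> k1 \<Longrightarrow> h k0 \<le> h k"
    using arg_min_nat_lemma[of "\<lambda>k. k \<ge> k1" k1 h] by blast
  have "h k = h k0" if "k \<ge> k0" for k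
    using that
  proof (induct rule: dec_induct)
    case (step k)
    then have "h (Suc k) \<le> h k0" using dec[of k] k0(1) by (simp add: k1_def)
    moreover have "h k0 \<le> h (Suc k)" using k0 step by simp
    ultimately show ?case by simp
  qed simp
  then show ?thesis unfolding h_def by blast
qed

section \<open>Products of ring elements along multisets of indices\<close>

context cring
begin

lemma Idl_insert_eq_adj:
  assumes A: "A \<subseteq> carrier R" and c: "c \<in> carrier R"
  shows "Idl (insert c A) = adj (Idl A) c"
proof
  have A': "insert c A \<subseteq> carrier R" using assms by simp
  have id: "ideal (Idl A) R" "ideal (Idl (insert c A)) R"
    using genideal_ideal[OF A] genideal_ideal[OF A'] by auto
  have "insert c A \<subseteq> adj (Idl A) c"
    using adj_self[OF id(1) c] adj_supset[OF id(1) c] genideal_self[OF A] by blast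
  then show "Idl (insert c A) \<subseteq> adj (Idl A) c" by (intro genideal_minimal adj_ideal id c)
  have self: "insert c A \<subseteq> Idl (insert c A)" using genideal_self[OF A'] .
  then have "Idl A \<subseteq> Idl (insert c A)" by (intro genideal_minimal id) simp
  then show "adj (Idl A) c \<subseteq> Idl (insert c A)" using self by (intro adj_least id) auto
qed

lemma Idl_ideal: "ideal I R \<Longrightarrow> Idl I = I"
  using genideal_minimal[of I I] genideal_self[of I] ideal_carr by blast

definition mon :: "(nat \<Rightarrow> 'a) \<Rightarrow> nat multiset \<Rightarrow> 'a" where
  "mon x u = foldr (\<lambda>i a. x i \<otimes> a) (sorted_list_of_multiset u) \<one>"

lemma mon_empty [simp]: "mon x {#} = \<one>"
  by (simp add: mon_def)

lemma mon_add_mset: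
  assumes x: "\<And>i. x i \<in> carrier R"
  shows "mon x (add_mset i u) = x i \<otimes> mon x u"
proof -
  have cl: "foldr (\<lambda>i a. x i \<otimes> a) l \<one> \<in> carrier R" for l by (induct l) (use x in auto)
  have "foldr (\<lambda>i a. x i \<otimes> a) (insort i l) \<one> = x i \<otimes> foldr (\<lambda>i a. x i \<otimes> a) l \<one>" for l
    by (induct l) (use x cl m_lcomm in auto)
  then show ?thesis by (simp add: mon_def)
qed

lemma mon_closed: "(\<And>i. x i \<in> carrier R) \<Longrightarrow> mon x u \<in> carrier R"
  by (induct u) (simp_all add: mon_add_mset)

lemma mon_replicate:
  assumes x: "\<And>i. x i \<in> carrier R"
  shows "mon x (replicate_mset n i + w) = x i [^] n \<otimes> mon x w"
proof (induct n)
  case 0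
  then show ?case using mon_closed[OF x] by simp
next
  case (Suc n)
  have "mon x (replicate_mset (Suc n) i + w) = x i \<otimes> (x i [^] n \<otimes> mon x w)"
    using Suc by (simp add: mon_add_mset[OF x])
  also have "\<dots> = x i [^] Suc n \<otimes> mon x w"
    using x mon_closed[OF x] by (simp add: m_assoc m_lcomm)
  finally show ?case .
qed

end

lemma (in cring) PIdlE:
  assumes "z \<in> PIdl p" "p \<in> carrier R"
  obtains t where "t \<in> carrier R" "z = p \<otimes> t"
  using assms(1) PIdl_iff[OF assms(2), of z] by (elim iffD1[elim_format] bexE) blast

text \<open>All values of x lie in M although only those below r generate it; this keeps side
  conditions i < r out of the rules for \<open>mon\<close>. A finite generating set is padded with
  zero.\<close>

locale generated_local = local_cring +
  fixes x :: "nat \<Rightarrow> 'a" and r :: nat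
  assumes x_mem: "\<And>i. x i \<in> M" and gen: "M = Idl (x ` {..<r})"
begin

lemma x_carr: "x i \<in> carrier R"
  using M_carr x_mem by blast

lemma mon_carr: "mon x u \<in> carrier R"
  using mon_closed[of x] x_carr by blast

lemma mon_add: "mon x (add_mset i u) = x i \<otimes> mon x u"
  using mon_add_mset[of x] x_carr by blast

lemma mon_mem: "mon x u \<in> Mpow (size u)"
proof (induct u)
  case (add i u)
  then show ?case using ideal_prod.prod[OF x_mem[of i] add, of R] by (simp add: mon_add)
qed simp

lemma ideal_pow_monomials: "Mpow k = Idl (mon x ` monomials r k)"
proof
  have sub: "mon x ` monomials r k \<subseteq> carrier R" for k using mon_carr by blast
  have id: "ideal (Idl (mon x ` monomials r k)) R" for k using genideal_ideal[OF sub] .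
  have self: "mon x ` monomials r k \<subseteq> Idl (mon x ` monomials r k)" for k using genideal_self[OF sub] .
  show "Idl (mon x ` monomials r k) \<subseteq> Mpow k"
    using mon_mem by (intro genideal_minimal Mpow_ideal) (auto simp: monomials_def)
  show "Mpow k \<subseteq> Idl (mon x ` monomials r k)"
  proof (induct k)
    case 0
    have "{#} \<in> monomials r 0" by (simp add: monomials_def)
    then have "\<one> \<in> Idl (mon x ` monomials r 0)" using self[of 0] mon_empty by (metis imageI subsetD)
    then have "Idl (mon x ` monomials r 0) = carrier R" using ideal.one_imp_carrier[OF id] by blast
    then show ?case by simp
  next
    case (Suc k)
    have "ideal_prod R (Idl (x ` {..<r})) (Idl (mon x ` monomials r k)) \<subseteq> Idl (mon x ` monomials r (Suc k))"
    proof (rule ideal_prod_Idl_subset[OF id _ sub])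
      show "x ` {..<r} \<subseteq> carrier R" using x_carr by blast
      fix a b assume "a \<in> x ` {..<r}" "b \<in> mon x ` monomials r k"
      then obtain i u where iu: "i < r" "u \<in> monomials r k" "a = x i" "b = mon x u" by blast
      then have "add_mset i u \<in> monomials r (Suc k)" by (simp add: monomials_def)
      then have "mon x (add_mset i u) \<in> Idl (mon x ` monomials r (Suc k))" using self by blast
      then show "a \<otimes> b \<in> Idl (mon x ` monomials r (Suc k))" using iu by (simp add: mon_add)
    qed
    moreover have "ideal_prod R M (Mpow k) \<subseteq> ideal_prod R M (Idl (mon x ` monomials r k))"
    proof
      fix z assume "z \<in> ideal_prod R M (Mpow k)"
      then show "z \<in> ideal_prod R M (Idl (mon x ` monomials r k))"
        by induct (use Suc in \<open>auto intro: ideal_prod.intros\<close>)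
    qed
    ultimately show ?case using gen by simp
  qed
qed

section \<open>Standard monomials and the Hilbert function\<close>

definition lower :: "nat \<Rightarrow> nat multiset set \<Rightarrow> 'a set" where
  "lower k U = Idl (Mpow (Suc k) \<union> mon x ` U)"

text \<open>For u in the variables below r, these are the monomials outside the initial ideal of the
  homogeneous relations between the classes of the x i in the associated graded ring of M, as in
  Macaulay's theorem on Hilbert functions.\<close>

definition standard :: "nat multiset \<Rightarrow> bool" where
  "standard u \<longleftrightarrow> mon x u \<notin> lower (size u) {v \<in> monomials r (size u). v < u}"

lemma lower_sub: "Mpow (Suc k) \<union> mon x ` U \<subseteq> carrier R"
  using mon_carr ideal_carr[OF Mpow_ideal] by blast

lemma lower_ideal: "ideal (lower k U) R"
  unfolding lower_def using genideal_ideal[OF lower_sub] .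

lemma lower_self: "Mpow (Suc k) \<subseteq> lower k U" "u \<in> U \<Longrightarrow> mon x u \<in> lower k U"
  unfolding lower_def using genideal_self[OF lower_sub[of k U]] by auto

lemma lower_least:
  "ideal J R \<Longrightarrow> Mpow (Suc k) \<subseteq> J \<Longrightarrow> (\<And>u. u \<in> U \<Longrightarrow> mon x u \<in> J) \<Longrightarrow> lower k U \<subseteq> J"
  unfolding lower_def by (rule genideal_minimal) auto

text \<open>Multiplication by x i turns an expression of u by smaller monomials into one of the
  larger monomial, because adding i preserves the order of multisets and raises the error term to
  the next power of M.\<close>

lemma standard_down:
  assumes std: "standard (add_mset i u)" and i: "i < r"
  shows "standard u"
proof (rule ccontr)
  assume "\<not> standard u"
  then have u: "mon x u \<in> lower (size u) {v \<in> monomials r (size u). v < u}" by (simp add: standard_def)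
  define K where "K = lower (size (add_mset i u)) {v \<in> monomials r (size (add_mset i u)). v < add_mset i u}"
  have K: "ideal K R" unfolding K_def using lower_ideal .
  have "lower (size u) {v \<in> monomials r (size u). v < u} \<subseteq> {z \<in> carrier R. x i \<otimes> z \<in> K}"
  proof (rule lower_least[OF ideal_colon[OF K x_carr]])
    show "Mpow (Suc (size u)) \<subseteq> {z \<in> carrier R. x i \<otimes> z \<in> K}"
    proof
      fix z assume z: "z \<in> Mpow (Suc (size u))"
      then have "x i \<otimes> z \<in> Mpow (Suc (size (add_mset i u)))"
        using ideal_prod.prod[OF x_mem[of i] z, of R] by simp
      then show "z \<in> {z \<in> carrier R. x i \<otimes> z \<in> K}"
        using lower_self(1) ideal_carr[OF Mpow_ideal z] unfolding K_def by blast
    qed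
    fix v assume v: "v \<in> {v \<in> monomials r (size u). v < u}"
    then have "add_mset i v \<in> {v \<in> monomials r (size (add_mset i u)). v < add_mset i u}"
      using i by (simp add: monomials_def)
    then have "mon x (add_mset i v) \<in> K" unfolding K_def by (rule lower_self(2))
    then show "mon x v \<in> {z \<in> carrier R. x i \<otimes> z \<in> K}" using mon_carr by (simp add: mon_add)
  qed
  then have "x i \<otimes> mon x u \<in> K" using u by blast
  then show False using std unfolding standard_def K_def by (simp add: mon_add)
qed

text \<open>The monomials of U are adjoined in increasing order. M takes each of them into M^(k+1),
  so every step has length at most one, and it is strict exactly if the monomial is not a
  combination of its predecessors.\<close>

lemma compser_monomials:
  assumes "finite U" "U \<subseteq> monomials r k"
  shows "compser (Mpow (Suc k)) (lower k U)
    (card {u \<in> U. mon x u \<notin> lower k {v \<in> U. v < u}})"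
  using assms
proof (induct U rule: finite_linorder_max_induct)
  case empty
  have "lower k {} = Mpow (Suc k)"
    unfolding lower_def using Idl_ideal[OF ideal_pow_ideal[OF M_ideal, of "Suc k"]] by simp
  then show ?case using compser.nil[OF ideal_pow_ideal[OF M_ideal, of "Suc k"]] by simp
next
  case (insert b A)
  have lt: "v < b" if "v \<in> A" for v using insert(2) that by blast
  have nb: "b \<notin> A" using lt by blast
  have eq: "{v \<in> insert b A. v < b} = A" using lt by auto
  have eq': "{v \<in> insert b A. v < u} = {v \<in> A. v < u}" if "u \<in> A" for u
    using lt[OF that] by auto
  let ?c = "{u \<in> A. mon x u \<notin> lower k {v \<in> A. v < u}}"
  have IH: "compser (Mpow (Suc k)) (lower k A) (card ?c)" using insert by simp
  have lo: "lower k (insert b A) = adj (lower k A) (mon x b)"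
    unfolding lower_def using Idl_insert_eq_adj[OF lower_sub mon_carr] by simp
  have sz: "size b = k" using insert(4) unfolding monomials_def by blast
  have Mb: "mon x b \<otimes> z \<in> lower k A" if z: "z \<in> M" for z
  proof -
    have mb: "mon x b \<in> Mpow k" using mon_mem[of b] unfolding sz .
    have "z \<otimes> mon x b \<in> Mpow (Suc k)"
      unfolding ideal_pow.simps(2) by (rule ideal_prod.prod[OF z mb])
    then have "z \<otimes> mon x b \<in> lower k A" by (rule subsetD[OF lower_self(1)])
    then show ?thesis unfolding m_comm[OF mon_carr M_carr[OF z]] .
  qed
  have iffA: "mon x u \<in> lower k {v \<in> insert b A. v < u} \<longleftrightarrow> mon x u \<in> lower k {v \<in> A. v < u}"
    if "u \<in> A" for u
    unfolding eq'[OF that] by (rule refl)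
  have iffb: "mon x b \<in> lower k {v \<in> insert b A. v < b} \<longleftrightarrow> mon x b \<in> lower k A"
    unfolding eq by (rule refl)
  show ?case
  proof (cases "mon x b \<in> lower k A")
    case True
    have "{u \<in> insert b A. mon x u \<notin> lower k {v \<in> insert b A. v < u}} = ?c"
      using iffA iffb True by blast
    moreover have "lower k (insert b A) = lower k A" using lo adj_absorb[OF lower_ideal True] by simp
    ultimately show ?thesis using IH by simp
  next
    case False
    have "{u \<in> insert b A. mon x u \<notin> lower k {v \<in> insert b A. v < u}} = insert b ?c"
      using iffA iffb False by blast
    moreover have "card (insert b ?c) = Suc (card ?c)" using insert(1) nb by simp
    ultimately show ?thesis using compser.step[OF IH mon_carr Mb False] lo by simp
  qed
qed

definition hilb :: "nat \<Rightarrow> nat" where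
  "hilb k = card {u \<in> monomials r k. standard u}"

lemma compser_hilb: "compser (Mpow (Suc k)) (Mpow k) (hilb k)"
proof -
  have "lower k (monomials r k) = Mpow k"
  proof
    show "lower k (monomials r k) \<subseteq> Mpow k"
      using mon_mem ideal_pow_Suc_subset[OF M_ideal, of k]
      by (intro lower_least Mpow_ideal) (auto simp: monomials_def)
    show "Mpow k \<subseteq> lower k (monomials r k)"
      unfolding ideal_pow_monomials using lower_self(2)
      by (intro genideal_minimal lower_ideal) blast
  qed
  moreover have "{u \<in> monomials r k. mon x u \<notin> lower k {v \<in> monomials r k. v < u}} =
      {u \<in> monomials r k. standard u}"
    by (auto simp: standard_def monomials_def)
  ultimately show ?thesis using compser_monomials[of "monomials r k" k] finite_monomials unfolding hilb_def by simp
qed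

lemmas compser_hilb_sum = compser_sum[OF compser_hilb]

text \<open>Let c be the length of R/M^N. As M^N lies in pR, the length of R/pR is at most c;
  scaling by powers of p bounds that of R/p^k R by c k, and p^k lies in M^k. So \<open>hilb\<close>
  is bounded by c on average, as \<open>order_ideal_hilbert_function\<close> requires.\<close>

lemma hilb_eventually_const:
  assumes p: "p \<in> M" and N: "Mpow N \<subseteq> PIdl p"
  shows "\<exists>e k0. \<forall>k\<ge>k0. hilb k = e"
proof -
  define c where "c = (\<Sum>j<N. hilb j)"
  have pc: "p \<in> carrier R" using M_carr p by blast
  have pp: "p \<in> PIdl p" and pid: "ideal (PIdl p) R" using cgenideal_self cgenideal_ideal pc by auto
  have "compser_le (adj (Mpow N) p) (adj (carrier R) p) c"
    unfolding c_def using compser_adj[OF compser_hilb_sum pc] .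
  moreover have "adj (Mpow N) p = PIdl p"
    using adj_least[OF pid N pp] cgenideal_minimal[OF adj_ideal adj_self]
      Mpow_ideal pc by blast
  moreover have "adj (carrier R) p = carrier R" using adj_absorb[OF oneideal] pc by simp
  ultimately have base: "compser_le (PIdl p) (carrier R) c" by simp
  then obtain c' where c': "c' \<le> c" "compser (PIdl p) (carrier R) c'" by (auto simp: compser_le_def)
  have pk: "p [^] k \<in> carrier R" for k :: nat using pc by simp
  have chain: "compser_le (PIdl (p [^] k)) (carrier R) (c * k)" for k :: nat
  proof (induct k)
    case 0
    have "PIdl \<one> = carrier R"
      using unit_mem_ideal[OF cgenideal_ideal[OF one_closed] Units_one_closed cgenideal_self[OF one_closed]] .
    then show ?case using compser_le_refl[OF oneideal] by simp
  next
    case (Suc k)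
    have "(\<otimes>) (p [^] k) ` carrier R = PIdl (p [^] k)" using PIdl_iff[OF pk[of k]] by blast
    moreover have "(\<otimes>) (p [^] k) ` (PIdl p) = PIdl (p [^] Suc k)"
    proof (intro subset_antisym subsetI)
      fix z assume "z \<in> (\<otimes>) (p [^] k) ` (PIdl p)"
      then obtain w where w: "w \<in> PIdl p" "z = p [^] k \<otimes> w" by (rule imageE)
      obtain t where t: "t \<in> carrier R" "w = p \<otimes> t" using w(1) pc by (rule PIdlE)
      have "z = p [^] Suc k \<otimes> t" unfolding w(2) t(2) using pc t(1) by (simp add: m_assoc)
      then show "z \<in> PIdl (p [^] Suc k)" using PIdlI[OF pk[of "Suc k"] t(1)] by simp
    next
      fix z assume "z \<in> PIdl (p [^] Suc k)"
      then obtain t where t: "t \<in> carrier R" "z = p [^] Suc k \<otimes> t" using pk by (rule PIdlE)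
      have "z = p [^] k \<otimes> (p \<otimes> t)" unfolding t(2) using pc t(1) by (simp add: m_assoc)
      then show "z \<in> (\<otimes>) (p [^] k) ` (PIdl p)" using PIdlI[OF pc t(1)] by (rule image_eqI)
    qed
    ultimately have "compser_le (PIdl (p [^] Suc k)) (PIdl (p [^] k)) c'"
      using compser_scale[OF c'(2) pk[of k]] by simp
    from compser_le_trans[OF this Suc] c'(1)
    have "compser_le (PIdl (p [^] Suc k)) (carrier R) (c' + c * k)" "c' + c * k \<le> c * Suc k" by auto
    then show ?case unfolding compser_le_def by (meson order_trans)
  qed
  define S where "S = {u. set_mset u \<subseteq> {..<r} \<and> standard u}"
  have hS: "hilb j = card {u \<in> S. size u = j}" for j
    unfolding hilb_def S_def monomials_def by (rule arg_cong[where f = card]) auto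
  have "\<exists>e k0. \<forall>k\<ge>k0. card {u \<in> S. size u = k} = e"
  proof (rule order_ideal_hilbert_function)
    show "u \<in> S" if "add_mset i u \<in> S" for i u using that standard_down by (auto simp: S_def)
    show "set_mset u \<subseteq> {..<r}" if "u \<in> S" for u using that by (simp add: S_def)
    fix k
    obtain n where n: "n \<le> c * k" "compser (PIdl (p [^] k)) (carrier R) n"
      using chain[of k] by (auto simp: compser_le_def)
    have "PIdl (p [^] k) \<subseteq> Mpow k"
      using pow_mem_ideal_pow[OF M_ideal p] cgenideal_minimal[OF Mpow_ideal] by blast
    then have "(\<Sum>j<k. hilb j) \<le> n" using compser_mono[OF n(2) compser_hilb_sum] by simp
    then show "(\<Sum>j<k. card {u \<in> S. size u = j}) \<le> c * k" using n(1) by (simp add: hS)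
  qed
  then show ?thesis unfolding hS .
qed

text \<open>Pigeonhole: if n is a common exponent that takes every generator into pR, then a
  monomial of degree r n + 1 contains the n-th power of some generator.\<close>

lemma ideal_pow_subset_PIdl:
  assumes p: "p \<in> carrier R" and rad: "\<And>i. i < r \<Longrightarrow> \<exists>n. x i [^] (n::nat) \<in> PIdl p"
  shows "\<exists>N. Mpow N \<subseteq> PIdl p"
proof -
  have pid: "ideal (PIdl p) R" using cgenideal_ideal[OF p] .
  obtain f :: "nat \<Rightarrow> nat" where f: "\<And>i. i < r \<Longrightarrow> x i [^] f i \<in> PIdl p" using rad by metis
  define n where "n = (\<Sum>i<r. f i)"
  have n: "x i [^] n \<in> PIdl p" if i: "i < r" for i
  proof -
    have "f i \<le> n" unfolding n_def using i by (intro member_le_sum) auto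
    then have "x i [^] n = x i [^] f i \<otimes> x i [^] (n - f i)"
      using nat_pow_mult[OF x_carr, of i "f i" "n - f i"] by simp
    then show ?thesis using ideal_mult[OF pid f[OF i]] x_carr by simp
  qed
  have "mon x u \<in> PIdl p" if u: "u \<in> monomials r (Suc (r * n))" for u
  proof -
    have "\<exists>i<r. n \<le> count u i"
    proof (rule ccontr)
      assume "\<not> ?thesis"
      then have "size u \<le> r * n"
        using u by (intro size_le_card_times_bound) (auto simp: monomials_def not_le)
      then show False using u by (simp add: monomials_def)
    qed
    then obtain i where i: "i < r" "n \<le> count u i" by blast
    then have "u = replicate_mset n i + (u - replicate_mset n i)"
      by (simp flip: count_le_replicate_mset_subset_eq)
    then have "mon x u = x i [^] n \<otimes> mon x (u - replicate_mset n i)"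
      using mon_replicate[of x n i "u - replicate_mset n i"] x_carr by simp
    then show ?thesis using ideal_mult[OF pid n[OF i(1)] mon_carr] by simp
  qed
  then have "Mpow (Suc (r * n)) \<subseteq> PIdl p"
    unfolding ideal_pow_monomials by (intro genideal_minimal pid) blast
  then show ?thesis by blast
qed

end

text \<open>Enumerates the generators, so that later arguments see only lengths and no
  monomials.\<close>

theorem (in local_cring) hilbert_function_eventually_const:
  assumes A: "finite A" "A \<subseteq> M" "M = Idl A" and p: "p \<in> M"
    and rad: "\<And>a. a \<in> A \<Longrightarrow> \<exists>n. a [^] (n::nat) \<in> PIdl p"
  shows "\<exists>h N e k0. Mpow N \<subseteq> PIdl p \<and>
    (\<forall>k. compser (Mpow (Suc k)) (Mpow k) (h k)) \<and> (\<forall>k\<ge>k0. h k = e)"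
proof -
  obtain f and r :: nat where f: "A = f ` {i. i < r}" using finite_imp_nat_seg_image_inj_on[OF A(1)] by blast
  define x where "x i = (if i < r then f i else \<zero>)" for i
  have xA: "x ` {..<r} = A" using f by (auto simp: x_def)
  interpret g: generated_local R M x r
  proof unfold_locales
    show "x i \<in> M" for i
      using f A(2) ideal_zero[OF M_ideal] by (cases "i < r") (auto simp: x_def)
    show "M = Idl (x ` {..<r})" using A(3) xA by simp
  qed
  have "\<exists>n. x i [^] (n::nat) \<in> PIdl p" if "i < r" for i using rad[of "x i"] that xA by blast
  then obtain N where N: "Mpow N \<subseteq> PIdl p" using g.ideal_pow_subset_PIdl[OF M_carr[OF p]] by blast
  then show ?thesis using g.hilb_eventually_const[OF p N] g.compser_hilb by blast
qed

section \<open>The adic completion\<close>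

locale adic_local = local_cring +
  fixes m :: 'a
  assumes m_mem: "m \<in> M" and m_nzd: "nonzerodivisor R m"
begin

abbreviation S :: "(nat \<Rightarrow> 'a set) ring" where "S \<equiv> adic_completion R m"
abbreviation I :: "nat \<Rightarrow> 'a set" where "I k \<equiv> PIdl (m [^] k)"

abbreviation S_mult (infixl "\<otimes>\<^sub>S" 70) where "x \<otimes>\<^sub>S z \<equiv> x \<otimes>\<^bsub>S\<^esub> z"
abbreviation S_add (infixl "\<oplus>\<^sub>S" 65) where "x \<oplus>\<^sub>S z \<equiv> x \<oplus>\<^bsub>S\<^esub> z"
abbreviation S_minus (infixl "\<ominus>\<^sub>S" 65) where "x \<ominus>\<^sub>S z \<equiv> x \<ominus>\<^bsub>S\<^esub> z"
abbreviation S_pow (infixr "[^]\<^sub>S" 75) where "x [^]\<^sub>S k \<equiv> x [^]\<^bsub>S\<^esub> (k :: nat)"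
abbreviation S_zero ("\<zero>\<^sub>S") where "\<zero>\<^sub>S \<equiv> \<zero>\<^bsub>S\<^esub>"
abbreviation S_one ("\<one>\<^sub>S") where "\<one>\<^sub>S \<equiv> \<one>\<^bsub>S\<^esub>"

text \<open>A sequence of representatives of an element of the inverse limit. Computations with
  representatives in R replace the componentwise operations on cosets.\<close>

definition coherent :: "(nat \<Rightarrow> 'a) \<Rightarrow> bool" where
  "coherent a \<longleftrightarrow> (\<forall>k. a k \<in> carrier R \<and> a (Suc k) \<ominus> a k \<in> I k)"

definition lim_class :: "(nat \<Rightarrow> 'a) \<Rightarrow> nat \<Rightarrow> 'a set" where
  "lim_class a = (\<lambda>k. I k +> a k)"

lemma m_carr: "m \<in> carrier R" and m_pow_carr: "m [^] (k::nat) \<in> carrier R"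
  using m_mem M_carr by auto

lemma I_ideal: "ideal (I k) R"
  using cgenideal_ideal[OF m_pow_carr] .

lemma I_antimono: "k \<le> n \<Longrightarrow> I n \<subseteq> I k"
proof (rule cgenideal_minimal[OF I_ideal])
  assume "k \<le> n"
  then have "m [^] n = m [^] k \<otimes> m [^] (n - k)" using nat_pow_mult[OF m_carr, of k "n - k"] by simp
  then show "m [^] n \<in> I k" using PIdlI[OF m_pow_carr m_pow_carr] by simp
qed

lemma I_0: "I 0 = carrier R"
  using unit_mem_ideal[OF cgenideal_ideal[OF one_closed] Units_one_closed cgenideal_self[OF one_closed]]
  by simp

lemma I_subset_M: "I (Suc k) \<subseteq> M"
proof (rule cgenideal_minimal[OF M_ideal])
  show "m [^] Suc k \<in> M" using ideal_mult'[OF M_ideal m_mem m_pow_carr[of k]] by simp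
qed

lemma coherent_carr: "coherent a \<Longrightarrow> a k \<in> carrier R"
  by (simp add: coherent_def)

lemma coherent_step: "coherent a \<Longrightarrow> a (Suc k) \<ominus> a k \<in> I k"
  by (simp add: coherent_def)

lemma coherent_const: "r \<in> carrier R \<Longrightarrow> coherent (\<lambda>_. r)"
  unfolding coherent_def using ideal_zero[OF I_ideal] by (simp add: a_minus_def r_neg)

lemma coherent_diff_mem:
  assumes a: "coherent a" and ij: "i \<le> j"
  shows "a j \<ominus> a i \<in> I i"
  using ij
proof (induct j rule: dec_induct)
  case base
  then show ?case using coherent_carr[OF a, of i] ideal_zero[OF I_ideal] by (simp add: a_minus_def r_neg)
next
  case (step j)
  have c: "a (Suc j) \<in> carrier R" "a j \<in> carrier R" "a i \<in> carrier R" using coherent_carr[OF a] by auto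
  have "a (Suc j) \<ominus> a i = (a (Suc j) \<ominus> a j) \<oplus> (a j \<ominus> a i)" using c by algebra
  moreover have "a (Suc j) \<ominus> a j \<in> I i" using coherent_step[OF a, of j] I_antimono[OF step(1)] by blast
  ultimately show ?case using ideal_add[OF I_ideal _ step(3)] by simp
qed

lemma coherent_mem_mono:
  assumes a: "coherent a" and k: "a k \<in> I k" "k \<le> j"
  shows "a j \<in> I k"
  using ideal_diff_cancel[OF I_ideal coherent_diff_mem[OF a k(2)] k(1) coherent_carr[OF a]] .

lemma coherent_add:
  assumes "coherent a" "coherent b"
  shows "coherent (\<lambda>k. a k \<oplus> b k)"
  unfolding coherent_def
proof (intro allI conjI)
  fix k
  have c: "a k \<in> carrier R" "b k \<in> carrier R" "a (Suc k) \<in> carrier R" "b (Suc k) \<in> carrier R"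
    using coherent_carr assms by auto
  show "a k \<oplus> b k \<in> carrier R" using c by simp
  have "(a (Suc k) \<oplus> b (Suc k)) \<ominus> (a k \<oplus> b k) = (a (Suc k) \<ominus> a k) \<oplus> (b (Suc k) \<ominus> b k)"
    using c by algebra
  then show "(a (Suc k) \<oplus> b (Suc k)) \<ominus> (a k \<oplus> b k) \<in> I k"
    using ideal_add[OF I_ideal coherent_step[OF assms(1)] coherent_step[OF assms(2)]] by simp
qed

lemma coherent_neg:
  assumes "coherent a"
  shows "coherent (\<lambda>k. \<ominus> a k)"
  unfolding coherent_def
proof (intro allI conjI)
  fix k
  have c: "a k \<in> carrier R" "a (Suc k) \<in> carrier R" using coherent_carr assms by auto
  show "\<ominus> a k \<in> carrier R" using c by simp
  have "\<ominus> a (Suc k) \<ominus> \<ominus> a k = \<ominus> (a (Suc k) \<ominus> a k)" using c by algebra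
  then show "\<ominus> a (Suc k) \<ominus> \<ominus> a k \<in> I k"
    using ideal_neg[OF I_ideal coherent_step[OF assms]] by simp
qed

lemma coherent_mult:
  assumes "coherent a" "coherent b"
  shows "coherent (\<lambda>k. a k \<otimes> b k)"
  unfolding coherent_def
proof (intro allI conjI)
  fix k
  have c: "a k \<in> carrier R" "b k \<in> carrier R" "a (Suc k) \<in> carrier R" "b (Suc k) \<in> carrier R"
    using coherent_carr assms by auto
  show "a k \<otimes> b k \<in> carrier R" using c by simp
  have "(a (Suc k) \<otimes> b (Suc k)) \<ominus> (a k \<otimes> b k) =
      (a (Suc k) \<ominus> a k) \<otimes> b (Suc k) \<oplus> (b (Suc k) \<ominus> b k) \<otimes> a k"
    using c by algebra
  then show "(a (Suc k) \<otimes> b (Suc k)) \<ominus> (a k \<otimes> b k) \<in> I k"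
    using ideal_add[OF I_ideal ideal_mult[OF I_ideal coherent_step[OF assms(1)] c(4)]
        ideal_mult[OF I_ideal coherent_step[OF assms(2)] c(1)]] by simp
qed

lemma mem_coset_iff:
  assumes "a \<in> carrier R"
  shows "r \<in> I k +> a \<longleftrightarrow> r \<in> carrier R \<and> r \<ominus> a \<in> I k"
proof
  assume "r \<in> I k +> a"
  then obtain i where i: "i \<in> I k" "r = i \<oplus> a" by (auto simp: a_r_coset_def')
  have ic: "i \<in> carrier R" using ideal_carr[OF I_ideal i(1)] .
  have "i \<oplus> a \<ominus> a = i" using ic assms by algebra
  then show "r \<in> carrier R \<and> r \<ominus> a \<in> I k" using i ic assms by simp
next
  assume r: "r \<in> carrier R \<and> r \<ominus> a \<in> I k"
  then have rc: "r \<in> carrier R" by simp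
  have "r = (r \<ominus> a) \<oplus> a" using rc assms by algebra
  then show "r \<in> I k +> a" using r by (auto simp: a_r_coset_def')
qed

lemma lim_class_eq_iff:
  assumes "coherent a" "coherent b"
  shows "lim_class a = lim_class b \<longleftrightarrow> (\<forall>k. a k \<ominus> b k \<in> I k)"
  unfolding lim_class_def fun_eq_iff
  using quotient_eq_iff_same_a_r_cos[OF I_ideal] coherent_carr assms by metis

lemma lim_class_carr: "coherent a \<Longrightarrow> lim_class a \<in> carrier S"
proof -
  assume a: "coherent a"
  have "I (Suc k) +> a (Suc k) \<subseteq> I k +> a k" for k
  proof
    fix r assume "r \<in> I (Suc k) +> a (Suc k)"
    then have r: "r \<in> carrier R" "r \<ominus> a (Suc k) \<in> I (Suc k)"
      using mem_coset_iff[OF coherent_carr[OF a, of "Suc k"], of r "Suc k"] by blast+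
    have c: "a k \<in> carrier R" "a (Suc k) \<in> carrier R" using coherent_carr[OF a] by auto
    have "r \<ominus> a k = (r \<ominus> a (Suc k)) \<oplus> (a (Suc k) \<ominus> a k)" using c r(1) by algebra
    moreover have "r \<ominus> a (Suc k) \<in> I k" using r(2) I_antimono[of k "Suc k"] by auto
    ultimately show "r \<in> I k +> a k"
      using ideal_add[OF I_ideal _ coherent_step[OF a]] mem_coset_iff[OF c(1)] r(1) by simp
  qed
  moreover have "I k +> a k \<in> carrier (R Quot I k)" for k
    using coherent_carr[OF a] unfolding FactRing_def A_RCOSETS_def' by auto
  ultimately show ?thesis by (simp add: adic_completion_def lim_class_def)
qed

lemma completion_cases:
  assumes "x \<in> carrier S"
  obtains a where "coherent a" "x = lim_class a"
proof -
  have x: "x k \<in> carrier (R Quot I k)" "x (Suc k) \<subseteq> x k" for k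
    using assms by (auto simp: adic_completion_def)
  have "\<exists>a\<in>carrier R. x k = I k +> a" for k
    using x(1)[of k] unfolding FactRing_def A_RCOSETS_def' by auto
  then obtain a where a: "\<And>k. a k \<in> carrier R" "\<And>k. x k = I k +> a k" by metis
  have "a (Suc k) \<ominus> a k \<in> I k" for k
  proof -
    have "a (Suc k) \<in> x (Suc k)"
      unfolding a(2) mem_coset_iff[OF a(1)] using a(1) ideal_zero[OF I_ideal, of "Suc k"]
      by (simp add: a_minus_def r_neg)
    then have "a (Suc k) \<in> x k" using x(2) by blast
    then show ?thesis unfolding a(2) mem_coset_iff[OF a(1)] by simp
  qed
  then have "coherent a" using a(1) by (simp add: coherent_def)
  moreover have "x = lim_class a" using a(2) by (auto simp: lim_class_def)
  ultimately show ?thesis using that by blast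
qed

lemma lim_class_mult:
  assumes "coherent a" "coherent b"
  shows "lim_class a \<otimes>\<^sub>S lim_class b = lim_class (\<lambda>k. a k \<otimes> b k)"
  using ideal.rcoset_mult_add[OF I_ideal] coherent_carr assms
  by (auto simp: adic_completion_def lim_class_def FactRing_def)

lemma lim_class_add:
  assumes "coherent a" "coherent b"
  shows "lim_class a \<oplus>\<^sub>S lim_class b = lim_class (\<lambda>k. a k \<oplus> b k)"
  using ideal.a_rcos_sum[OF I_ideal] coherent_carr assms
  by (auto simp: adic_completion_def lim_class_def FactRing_def)

lemma lim_class_one: "\<one>\<^sub>S = lim_class (\<lambda>_. \<one>)"
  by (simp add: adic_completion_def lim_class_def FactRing_def)

lemma lim_class_zero: "\<zero>\<^sub>S = lim_class (\<lambda>_. \<zero>)"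
  using a_rcos_zero[OF I_ideal ideal_zero[OF I_ideal]]
  by (simp add: adic_completion_def lim_class_def FactRing_def)

lemmas lim_class_simps = lim_class_add lim_class_mult lim_class_one lim_class_zero
  coherent_add coherent_mult coherent_const lim_class_carr

lemma completion_cring: "cring S"
proof (rule cringI)
  show "abelian_group S"
  proof (rule abelian_groupI)
    fix x y z assume "x \<in> carrier S" "y \<in> carrier S" "z \<in> carrier S"
    then obtain a b c where h: "coherent a" "x = lim_class a" "coherent b" "y = lim_class b"
      "coherent c" "z = lim_class c" by (metis completion_cases)
    show "x \<oplus>\<^sub>S y \<oplus>\<^sub>S z = x \<oplus>\<^sub>S (y \<oplus>\<^sub>S z)"
      using h coherent_carr by (simp add: lim_class_simps a_assoc)
  next
    fix x y assume "x \<in> carrier S" "y \<in> carrier S"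
    then obtain a b where h: "coherent a" "x = lim_class a" "coherent b" "y = lim_class b"
      by (metis completion_cases)
    show "x \<oplus>\<^sub>S y \<in> carrier S" using h by (simp add: lim_class_simps)
    show "x \<oplus>\<^sub>S y = y \<oplus>\<^sub>S x" using h coherent_carr by (simp add: lim_class_simps a_comm)
  next
    show "\<zero>\<^sub>S \<in> carrier S" by (simp add: lim_class_simps)
  next
    fix x assume "x \<in> carrier S"
    then obtain a where h: "coherent a" "x = lim_class a" by (metis completion_cases)
    show "\<zero>\<^sub>S \<oplus>\<^sub>S x = x" using h coherent_carr by (simp add: lim_class_simps)
    have "lim_class (\<lambda>k. \<ominus> a k) \<oplus>\<^sub>S x = \<zero>\<^sub>S"
      using h coherent_carr coherent_neg by (simp add: lim_class_simps l_neg)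
    then show "\<exists>y\<in>carrier S. y \<oplus>\<^sub>S x = \<zero>\<^sub>S"
      using lim_class_carr[OF coherent_neg[OF h(1)]] by blast
  qed
  show "comm_monoid S"
  proof (rule comm_monoidI)
    fix x y z assume "x \<in> carrier S" "y \<in> carrier S" "z \<in> carrier S"
    then obtain a b c where h: "coherent a" "x = lim_class a" "coherent b" "y = lim_class b"
      "coherent c" "z = lim_class c" by (metis completion_cases)
    show "x \<otimes>\<^sub>S y \<otimes>\<^sub>S z = x \<otimes>\<^sub>S (y \<otimes>\<^sub>S z)"
      using h coherent_carr by (simp add: lim_class_simps m_assoc)
  next
    fix x y assume "x \<in> carrier S" "y \<in> carrier S"
    then obtain a b where h: "coherent a" "x = lim_class a" "coherent b" "y = lim_class b"
      by (metis completion_cases)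
    show "x \<otimes>\<^sub>S y \<in> carrier S" using h by (simp add: lim_class_simps)
    show "x \<otimes>\<^sub>S y = y \<otimes>\<^sub>S x" using h coherent_carr by (simp add: lim_class_simps m_comm)
  next
    show "\<one>\<^sub>S \<in> carrier S" by (simp add: lim_class_simps)
  next
    fix x assume "x \<in> carrier S"
    then obtain a where h: "coherent a" "x = lim_class a" by (metis completion_cases)
    show "\<one>\<^sub>S \<otimes>\<^sub>S x = x" using h coherent_carr by (simp add: lim_class_simps)
  qed
  fix x y z assume "x \<in> carrier S" "y \<in> carrier S" "z \<in> carrier S"
  then obtain a b c where h: "coherent a" "x = lim_class a" "coherent b" "y = lim_class b"
    "coherent c" "z = lim_class c" by (metis completion_cases)
  show "(x \<oplus>\<^sub>S y) \<otimes>\<^sub>S z = x \<otimes>\<^sub>S z \<oplus>\<^sub>S y \<otimes>\<^sub>S z"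
    using h coherent_carr by (simp add: lim_class_simps l_distr)
qed

end

context adic_local
begin

sublocale S: cring S
  by (rule completion_cring)

definition embed :: "'a \<Rightarrow> nat \<Rightarrow> 'a set" where
  "embed r = lim_class (\<lambda>_. r)"

abbreviation IS :: "nat \<Rightarrow> (nat \<Rightarrow> 'a set) set" where
  "IS k \<equiv> PIdl\<^bsub>S\<^esub> (embed m [^]\<^sub>S k)"

text \<open>Read off at index 1: the entry at index 0 is determined only modulo R, whereas I 1 is
  contained in M, so that the condition does not depend on the representatives.\<close>

definition MS :: "(nat \<Rightarrow> 'a set) set" where
  "MS = {lim_class a | a. coherent a \<and> a (Suc 0) \<in> M}"

lemma embed_carr: "r \<in> carrier R \<Longrightarrow> embed r \<in> carrier S"
  unfolding embed_def by (intro lim_class_carr coherent_const)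

lemma embed_mult:
  "r \<in> carrier R \<Longrightarrow> s \<in> carrier R \<Longrightarrow> embed (r \<otimes> s) = embed r \<otimes>\<^sub>S embed s"
  unfolding embed_def by (simp add: lim_class_mult coherent_const)

lemma embed_add:
  "r \<in> carrier R \<Longrightarrow> s \<in> carrier R \<Longrightarrow> embed (r \<oplus> s) = embed r \<oplus>\<^sub>S embed s"
  unfolding embed_def by (simp add: lim_class_add coherent_const)

lemma embed_one: "embed \<one> = \<one>\<^sub>S" and embed_zero: "embed \<zero> = \<zero>\<^sub>S"
  unfolding embed_def by (simp_all add: lim_class_one lim_class_zero)

lemma embed_pow: "r \<in> carrier R \<Longrightarrow> embed (r [^] (n::nat)) = embed r [^]\<^sub>S n"
  by (induct n) (simp_all add: embed_one embed_mult)

lemma lim_class_neg: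
  assumes a: "coherent a"
  shows "\<ominus>\<^bsub>S\<^esub> lim_class a = lim_class (\<lambda>k. \<ominus> a k)"
proof -
  have "lim_class (\<lambda>k. \<ominus> a k) \<oplus>\<^sub>S lim_class a = lim_class (\<lambda>k. \<ominus> a k \<oplus> a k)"
    using lim_class_add[OF coherent_neg[OF a] a] .
  also have "\<dots> = \<zero>\<^sub>S" using coherent_carr[OF a] by (simp add: lim_class_zero l_neg)
  finally show ?thesis
    using S.minus_equality lim_class_carr[OF a] lim_class_carr[OF coherent_neg[OF a]] by blast
qed

lemma lim_class_diff:
  assumes "coherent a" "coherent b"
  shows "lim_class a \<ominus>\<^sub>S lim_class b = lim_class (\<lambda>k. a k \<ominus> b k)"
  using assms by (simp add: a_minus_def lim_class_neg lim_class_add coherent_neg)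

lemma coherent_diff: "coherent a \<Longrightarrow> coherent b \<Longrightarrow> coherent (\<lambda>k. a k \<ominus> b k)"
  by (simp add: a_minus_def coherent_add coherent_neg)

lemma embed_m_pow_carr: "embed m [^]\<^sub>S (k::nat) \<in> carrier S"
  using embed_carr[OF m_carr] by simp

text \<open>The kernel of the projection to R/m^k R is generated by m^k. This rests on m being a
  nonzerodivisor: the quotients of the entries by m^k form a coherent sequence because m^k can be
  cancelled.\<close>

lemma lim_class_mem_power_iff:
  assumes a: "coherent a"
  shows "lim_class a \<in> IS k \<longleftrightarrow> a k \<in> I k"
proof
  assume "lim_class a \<in> IS k"
  then obtain x where x: "x \<in> carrier S" "lim_class a = embed (m [^] k) \<otimes>\<^sub>S x"
    using S.PIdl_iff[OF embed_m_pow_carr, of "lim_class a" k] embed_pow[OF m_carr, of k] by auto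
  obtain b where b: "coherent b" "x = lim_class b" using completion_cases[OF x(1)] .
  have cb: "coherent (\<lambda>j. m [^] k \<otimes> b j)"
    using coherent_mult[OF coherent_const[OF m_pow_carr] b(1)] .
  have "lim_class a = lim_class (\<lambda>j. m [^] k \<otimes> b j)"
    using x(2) b(2) lim_class_mult[OF coherent_const[OF m_pow_carr] b(1)] by (simp add: embed_def)
  then have d: "a k \<ominus> m [^] k \<otimes> b k \<in> I k" using lim_class_eq_iff[OF a cb] by blast
  have "m [^] k \<otimes> b k \<in> I k" using PIdlI[OF m_pow_carr coherent_carr[OF b(1)]] .
  then show "a k \<in> I k" using ideal_diff_cancel[OF I_ideal d] coherent_carr[OF a] by blast
next
  assume k: "a k \<in> I k"
  \<comment> \<open>Division by m^k costs k places of precision, so the quotient at index j is taken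
    from the entry at index k + j.\<close>
  have "\<exists>q\<in>carrier R. a (k + j) = m [^] k \<otimes> q" for j
    using coherent_mem_mono[OF a k, of "k + j"] PIdl_iff[OF m_pow_carr] by auto
  then obtain q where q: "\<And>j. q j \<in> carrier R" "\<And>j. a (k + j) = m [^] k \<otimes> q j" by metis
  have cq: "coherent q"
    unfolding coherent_def
  proof (intro allI conjI q(1))
    fix j
    have "a (Suc (k + j)) \<ominus> a (k + j) \<in> I (k + j)" using coherent_step[OF a] .
    then obtain t where t: "t \<in> carrier R" "a (k + Suc j) \<ominus> a (k + j) = m [^] (k + j) \<otimes> t"
      using PIdl_iff[OF m_pow_carr] by auto
    have "m [^] k \<otimes> (q (Suc j) \<ominus> q j) = a (k + Suc j) \<ominus> a (k + j)"
      unfolding q(2) using q(1)[of j] q(1)[of "Suc j"] m_pow_carr[of k] by algebra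
    also have "\<dots> = m [^] k \<otimes> (m [^] j \<otimes> t)"
      using t m_carr by (simp add: nat_pow_mult[symmetric] m_assoc)
    finally have "q (Suc j) \<ominus> q j = m [^] j \<otimes> t"
      using nzd_cancel[OF nzd_pow[OF m_nzd]] q(1) t(1) m_pow_carr by simp
    then show "q (Suc j) \<ominus> q j \<in> I j" using PIdlI[OF m_pow_carr t(1)] by simp
  qed
  have cb: "coherent (\<lambda>j. m [^] k \<otimes> q j)"
    using coherent_mult[OF coherent_const[OF m_pow_carr] cq] .
  have "a j \<ominus> m [^] k \<otimes> q j \<in> I j" for j
  proof -
    have c: "a j \<in> carrier R" "a (k + j) \<in> carrier R" using coherent_carr[OF a] by auto
    have "a j \<ominus> a (k + j) = \<ominus> (a (k + j) \<ominus> a j)" using c by algebra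
    then show ?thesis using ideal_neg[OF I_ideal coherent_diff_mem[OF a, of j "k + j"]] q(2) by simp
  qed
  then have "lim_class a = lim_class (\<lambda>j. m [^] k \<otimes> q j)" using lim_class_eq_iff[OF a cb] by blast
  also have "\<dots> = embed m [^]\<^sub>S k \<otimes>\<^sub>S lim_class q"
    unfolding embed_pow[OF m_carr, symmetric]
    unfolding embed_def by (rule lim_class_mult[OF coherent_const[OF m_pow_carr] cq, symmetric])
  finally show "lim_class a \<in> IS k"
    using S.PIdlI[OF embed_m_pow_carr lim_class_carr[OF cq]] by simp
qed

lemma embed_mem_power_iff:
  "r \<in> carrier R \<Longrightarrow> embed r \<in> IS k \<longleftrightarrow> r \<in> I k"
  using lim_class_mem_power_iff[OF coherent_const] by (simp add: embed_def)

lemma completion_hausdorff: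
  assumes x: "x \<in> carrier S" and "\<And>k::nat. x \<in> IS k"
  shows "x = \<zero>\<^sub>S"
proof -
  obtain a where a: "coherent a" "x = lim_class a" using completion_cases[OF x] .
  have "a k \<in> I k" for k using assms(2) lim_class_mem_power_iff[OF a(1)] a(2) by blast
  then have "\<forall>k. a k \<ominus> \<zero> \<in> I k" using coherent_carr[OF a(1)] by (simp add: a_minus_def)
  then have "lim_class a = lim_class (\<lambda>_. \<zero>)"
    using lim_class_eq_iff[OF a(1) coherent_const[OF zero_closed]] by blast
  then show ?thesis using a(2) lim_class_zero by simp
qed

text \<open>The limit is the diagonal of the representing sequences. It is coherent because passing
  to the next sequence and to the next index each changes the entry by an element of I k.\<close>

lemma completion_complete:
  assumes s: "\<And>k. s k \<in> carrier S"
    and cauchy: "\<And>k. s (Suc k) \<ominus>\<^sub>S s k \<in> IS k"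
  shows "\<exists>t\<in>carrier S. \<forall>k. t \<ominus>\<^sub>S s k \<in> IS k"
proof -
  have "\<exists>a. coherent a \<and> s k = lim_class a" for k using completion_cases[OF s] by metis
  then obtain b where b: "\<And>k. coherent (b k)" "\<And>k. s k = lim_class (b k)" by metis
  have bc: "b k j \<in> carrier R" for k j using coherent_carr[OF b(1)] .
  have ct: "coherent (\<lambda>k. b k k)"
    unfolding coherent_def
  proof (intro allI conjI bc)
    fix k
    have "lim_class (\<lambda>j. b (Suc k) j \<ominus> b k j) \<in> IS k"
      using cauchy[of k] b(2) lim_class_diff[OF b(1) b(1)] by simp
    then have 1: "b (Suc k) k \<ominus> b k k \<in> I k"
      using lim_class_mem_power_iff[OF coherent_diff[OF b(1) b(1)]] by blast
    have 2: "b (Suc k) (Suc k) \<ominus> b (Suc k) k \<in> I k" using coherent_step[OF b(1)] .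
    have "b (Suc k) (Suc k) \<ominus> b k k = (b (Suc k) (Suc k) \<ominus> b (Suc k) k) \<oplus> (b (Suc k) k \<ominus> b k k)"
      using bc[of "Suc k" "Suc k"] bc[of "Suc k" k] bc[of k k] by algebra
    then show "b (Suc k) (Suc k) \<ominus> b k k \<in> I k" using ideal_add[OF I_ideal 2 1] by simp
  qed
  have "lim_class (\<lambda>k. b k k) \<ominus>\<^sub>S s k \<in> IS k" for k :: nat
  proof -
    have "b k k \<ominus> b k k \<in> I k" using bc ideal_zero[OF I_ideal] by (simp add: a_minus_def r_neg)
    then show ?thesis
      unfolding b(2) lim_class_diff[OF ct b(1)] lim_class_mem_power_iff[OF coherent_diff[OF ct b(1)]] .
  qed
  then show ?thesis using lim_class_carr[OF ct] by blast
qed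

lemma completion_dense:
  assumes x: "x \<in> carrier S"
  shows "\<exists>r\<in>carrier R. x \<ominus>\<^sub>S embed r \<in> IS k"
proof -
  obtain a where a: "coherent a" "x = lim_class a" using completion_cases[OF x] .
  have ac: "a k \<in> carrier R" using coherent_carr[OF a(1)] .
  have cc: "coherent (\<lambda>_. a k)" using coherent_const[OF ac] .
  have "a k \<ominus> a k \<in> I k" using ac ideal_zero[OF I_ideal] by (simp add: a_minus_def r_neg)
  then have "x \<ominus>\<^sub>S embed (a k) \<in> IS k"
    unfolding a(2) embed_def[of "a k"] lim_class_diff[OF a(1) cc]
      lim_class_mem_power_iff[OF coherent_diff[OF a(1) cc]] .
  then show ?thesis using ac by blast
qed

lemma lim_class_mem_MS:
  assumes a: "coherent a"
  shows "lim_class a \<in> MS \<longleftrightarrow> a (Suc 0) \<in> M"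
proof
  assume "lim_class a \<in> MS"
  then obtain b where b: "lim_class a = lim_class b" "coherent b" "b (Suc 0) \<in> M" by (auto simp: MS_def)
  then have "a (Suc 0) \<ominus> b (Suc 0) \<in> M" using lim_class_eq_iff[OF a b(2)] I_subset_M[of 0] by blast
  then show "a (Suc 0) \<in> M" using ideal_diff_cancel[OF M_ideal _ b(3)] coherent_carr[OF a] by blast
qed (use a in \<open>auto simp: MS_def\<close>)

lemma embed_mem_MS: "r \<in> carrier R \<Longrightarrow> embed r \<in> MS \<longleftrightarrow> r \<in> M"
  using lim_class_mem_MS[OF coherent_const] by (simp add: embed_def)

text \<open>Modulo M all entries of positive index agree, since m lies in M. So an element outside
  \<open>MS\<close> has units as entries at all positive indices, and their inverses again form a
  coherent sequence.\<close>

lemma completion_local: "local_cring S MS"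
proof (intro local_cring.intro local_cring_axioms.intro S.is_cring)
  show "ideal MS S"
  proof (rule S.idealI_cring)
    show "MS \<subseteq> carrier S" using lim_class_carr by (auto simp: MS_def)
    show "\<zero>\<^sub>S \<in> MS"
      unfolding lim_class_zero lim_class_mem_MS[OF coherent_const[OF zero_closed]]
      by (rule ideal_zero[OF M_ideal])
  next
    fix x y assume "x \<in> MS" "y \<in> MS"
    then obtain a b where h: "x = lim_class a" "coherent a" "a (Suc 0) \<in> M"
      "y = lim_class b" "coherent b" "b (Suc 0) \<in> M" by (auto simp: MS_def)
    show "x \<oplus>\<^sub>S y \<in> MS"
      unfolding h(1,4) lim_class_add[OF h(2,5)] lim_class_mem_MS[OF coherent_add[OF h(2,5)]]
      using ideal_add[OF M_ideal h(3,6)] .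
  next
    fix x y assume x: "x \<in> MS" and y: "y \<in> carrier S"
    obtain a where h: "x = lim_class a" "coherent a" "a (Suc 0) \<in> M" using x by (auto simp: MS_def)
    obtain b where b: "coherent b" "y = lim_class b" using completion_cases[OF y] .
    show "x \<otimes>\<^sub>S y \<in> MS"
      unfolding h(1) b(2) lim_class_mult[OF h(2) b(1)] lim_class_mem_MS[OF coherent_mult[OF h(2) b(1)]]
      using ideal_mult[OF M_ideal h(3) coherent_carr[OF b(1)]] .
  qed
  show "\<one>\<^sub>S \<notin> MS"
    unfolding lim_class_one lim_class_mem_MS[OF coherent_const[OF one_closed]] by (rule one_notin_M)
  fix x assume x: "x \<in> carrier S" "x \<notin> MS"
  obtain a where a: "coherent a" "x = lim_class a" using completion_cases[OF x(1)] .
  have ac: "a k \<in> carrier R" for k using coherent_carr[OF a(1)] .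
  have a1: "a (Suc 0) \<notin> M" using x(2) a lim_class_mem_MS by blast
  have nM: "a (Suc k) \<notin> M" for k
  proof
    assume aM: "a (Suc k) \<in> M"
    have "a (Suc k) \<ominus> a (Suc 0) \<in> M" using coherent_diff_mem[OF a(1), of "Suc 0" "Suc k"] I_subset_M[of 0] by auto
    then have "a (Suc k) \<ominus> (a (Suc k) \<ominus> a (Suc 0)) \<in> M" using ideal_diff[OF M_ideal aM] by blast
    moreover have "a (Suc k) \<ominus> (a (Suc k) \<ominus> a (Suc 0)) = a (Suc 0)"
      using ac[of "Suc k"] ac[of "Suc 0"] by algebra
    ultimately show False using a1 by simp
  qed
  \<comment> \<open>Index 0 imposes no condition and a 0 need not be a unit, so 1 serves as a
    placeholder.\<close>
  define b where "b k = (if k = 0 then \<one> else inv (a k))" for k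
  have b: "b k \<in> carrier R" "k > 0 \<Longrightarrow> a k \<otimes> b k = \<one>" for k
  proof -
    have "a k \<in> Units R" if "k > 0" using Units_outside[OF ac] nM[of "k - 1"] that by simp
    then show "b k \<in> carrier R" "k > 0 \<Longrightarrow> a k \<otimes> b k = \<one>" by (auto simp: b_def)
  qed
  have cb: "coherent b"
    unfolding coherent_def
  proof (intro allI conjI b(1))
    fix k
    show "b (Suc k) \<ominus> b k \<in> I k"
    proof (cases "k = 0")
      case True
      then show ?thesis using b(1)[of k] b(1)[of "Suc k"] I_0 by simp
    next
      case False
      then have ak: "a k \<otimes> b k = \<one>" "a (Suc k) \<otimes> b (Suc k) = \<one>" using b(2) by auto
      have "b (Suc k) \<ominus> b k = (a k \<otimes> b k) \<otimes> b (Suc k) \<ominus> (a (Suc k) \<otimes> b (Suc k)) \<otimes> b k"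
        unfolding ak using b(1) by simp
      also have "\<dots> = (a (Suc k) \<ominus> a k) \<otimes> (\<ominus> (b k \<otimes> b (Suc k)))"
        using ac[of k] ac[of "Suc k"] b(1)[of k] b(1)[of "Suc k"] by algebra
      also have "\<dots> \<in> I k" using ideal_mult[OF I_ideal coherent_step[OF a(1)]] b(1) by simp
      finally show ?thesis .
    qed
  qed
  have "a k \<otimes> b k \<ominus> \<one> \<in> I k" for k
  proof (cases "k = 0")
    case True
    then show ?thesis using ac[of k] b(1)[of k] I_0 by simp
  next
    case False
    then show ?thesis using b(2)[of k] ideal_zero[OF I_ideal] by (simp add: a_minus_def r_neg)
  qed
  then have "lim_class (\<lambda>k. a k \<otimes> b k) = lim_class (\<lambda>_. \<one>)"
    using lim_class_eq_iff[OF coherent_mult[OF a(1) cb] coherent_const[OF one_closed]] by blast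
  then have "x \<otimes>\<^sub>S lim_class b = \<one>\<^sub>S"
    using a(2) lim_class_mult[OF a(1) cb] lim_class_one by simp
  then show "x \<in> Units S"
    using x(1) lim_class_carr[OF cb] S.m_comm[OF x(1) lim_class_carr[OF cb]] unfolding Units_def by auto
qed

end

section \<open>The completion in the two-generated case\<close>

lemma (in cring) diff_add_diff:
  "a \<in> carrier R \<Longrightarrow> b \<in> carrier R \<Longrightarrow> c \<in> carrier R \<Longrightarrow> (a \<ominus> b) \<oplus> (b \<ominus> c) = a \<ominus> c"
  by algebra

context adic_local
begin

sublocale S: local_cring S MS
  by (rule completion_local)

lemma embed_pow_mem: "r \<in> carrier R \<Longrightarrow> r [^] (n::nat) \<in> PIdl m \<Longrightarrow> embed r [^]\<^sub>S n \<in> PIdl\<^bsub>S\<^esub> (embed m)"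
  using embed_mem_power_iff[of "r [^] n" 1] m_carr embed_carr[OF m_carr] by (simp add: embed_pow)

lemma PIdl_embed_m_subset: "PIdl\<^bsub>S\<^esub> (embed m) \<subseteq> MS"
  using embed_mem_MS[OF m_carr] m_mem by (intro S.cgenideal_minimal S.M_ideal) simp

text \<open>Density at precision 1. As m itself lies in M, it follows that the maximal ideal of the
  completion is generated by the image of M.\<close>

lemma MS_mem_cases:
  assumes x: "x \<in> MS"
  obtains r z where "r \<in> M" "z \<in> PIdl\<^bsub>S\<^esub> (embed m)" "x = embed r \<oplus>\<^sub>S z"
proof -
  have xc: "x \<in> carrier S" using S.M_carr x .
  obtain r where r: "r \<in> carrier R" "x \<ominus>\<^sub>S embed r \<in> PIdl\<^bsub>S\<^esub> (embed m)"
    using completion_dense[OF xc, of 1] embed_carr[OF m_carr] by auto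
  have rc: "embed r \<in> carrier S" using embed_carr[OF r(1)] .
  have "x \<ominus>\<^sub>S (x \<ominus>\<^sub>S embed r) \<in> MS"
    using S.ideal_diff[OF S.M_ideal x] PIdl_embed_m_subset r(2) by blast
  moreover have "x \<ominus>\<^sub>S (x \<ominus>\<^sub>S embed r) = embed r" using xc rc by algebra
  ultimately have "r \<in> M" using embed_mem_MS[OF r(1)] by simp
  moreover have "x = embed r \<oplus>\<^sub>S (x \<ominus>\<^sub>S embed r)" using xc rc by algebra
  ultimately show ?thesis using that r(2) by blast
qed

end

text \<open>M is the radical of mR. In this form dimension one enters the comparison with the
  completion.\<close>

locale adic_radical = adic_local +
  assumes radical: "\<And>x. x \<in> M \<Longrightarrow> \<exists>n. x [^] (n::nat) \<in> PIdl m"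

locale stable_adic = adic_radical + stable_local
begin

text \<open>The images of y and c generate because multiples of m are combinations of them as well.
  Among the products of generators only c c has to be rewritten by a relation from R; the others
  contain the factor y.\<close>

sublocale S: stable_local S MS "embed y" "embed c"
proof
  have yc: "embed y \<in> carrier S" "embed c \<in> carrier S" using embed_carr y_carr c_carr by auto
  have eI: "embed r \<in> Idl\<^bsub>S\<^esub> {embed y, embed c}" if "r \<in> M" for r
  proof -
    obtain u v where uv: "u \<in> carrier R" "v \<in> carrier R" "r = y \<otimes> u \<oplus> c \<otimes> v"
      using \<open>r \<in> M\<close> M_gen Idl2_iff[OF y_carr c_carr] by blast
    have "embed r = embed y \<otimes>\<^sub>S embed u \<oplus>\<^sub>S embed c \<otimes>\<^sub>S embed v"
      using uv y_carr c_carr by (simp add: embed_add embed_mult)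
    then show ?thesis using S.Idl2_iff[OF yc] embed_carr uv by blast
  qed
  show ym: "embed y \<in> MS" and cm: "embed c \<in> MS"
    using embed_mem_MS y_mem c_mem y_carr c_carr by auto
  have id: "ideal (Idl\<^bsub>S\<^esub> {embed y, embed c}) S"
    using S.genideal_ideal[of "{embed y, embed c}"] yc by simp
  show "MS = Idl\<^bsub>S\<^esub> {embed y, embed c}"
  proof
    show "Idl\<^bsub>S\<^esub> {embed y, embed c} \<subseteq> MS" using ym cm by (intro S.genideal_minimal S.M_ideal) simp
    show "MS \<subseteq> Idl\<^bsub>S\<^esub> {embed y, embed c}"
    proof
      fix x assume "x \<in> MS"
      then obtain r z where h: "r \<in> M" "z \<in> PIdl\<^bsub>S\<^esub> (embed m)" "x = embed r \<oplus>\<^sub>S z"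
        by (rule MS_mem_cases)
      then show "x \<in> Idl\<^bsub>S\<^esub> {embed y, embed c}"
        using S.ideal_add[OF id eI[OF h(1)]] S.cgenideal_minimal[OF id eI[OF m_mem]] by blast
    qed
  qed
  then have MSE: "x \<in> MS \<Longrightarrow> \<exists>s\<in>carrier S. \<exists>t\<in>carrier S.
      x = embed y \<otimes>\<^sub>S s \<oplus>\<^sub>S embed c \<otimes>\<^sub>S t" for x
    using S.Idl2_iff[OF yc] by blast
  obtain w where wM: "w \<in> M" and ww: "c \<otimes> c = y \<otimes> w" using M_square[OF c_mem c_mem] by blast
  have w: "w \<in> carrier R" "c \<otimes> c = y \<otimes> w" using M_carr[OF wM] ww by auto
  have cc: "embed c \<otimes>\<^sub>S embed c = embed y \<otimes>\<^sub>S embed w"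
    using w c_carr y_carr by (simp add: embed_mult[symmetric])
  fix u v assume u: "u \<in> MS" and v: "v \<in> MS"
  obtain s t where st: "s \<in> carrier S" "t \<in> carrier S" "u = embed y \<otimes>\<^sub>S s \<oplus>\<^sub>S embed c \<otimes>\<^sub>S t"
    using MSE[OF u] by blast
  obtain s' t' where st': "s' \<in> carrier S" "t' \<in> carrier S" "v = embed y \<otimes>\<^sub>S s' \<oplus>\<^sub>S embed c \<otimes>\<^sub>S t'"
    using MSE[OF v] by blast
  have wc: "embed w \<in> carrier S" using embed_carr w by blast
  \<comment> \<open>The quotient by y of (y s + c t) v, with v = y s' + c t' in the second summand
    and c c replaced by y w. It lies in \<open>MS\<close> because v, c and w do.\<close>
  define q where "q = s \<otimes>\<^sub>S v \<oplus>\<^sub>S embed c \<otimes>\<^sub>S t \<otimes>\<^sub>S s' \<oplus>\<^sub>S embed w \<otimes>\<^sub>S (t \<otimes>\<^sub>S t')"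
  have vc: "v \<in> carrier S" using S.M_carr v .
  have "embed w \<in> MS" using embed_mem_MS[OF w(1)] wM by simp
  then have qc: "q \<in> MS"
    unfolding q_def using st(1,2) st'(1,2) S.ideal_simps[OF S.M_ideal] v cm by simp
  have "u \<otimes>\<^sub>S v = embed y \<otimes>\<^sub>S (s \<otimes>\<^sub>S v) \<oplus>\<^sub>S (embed c \<otimes>\<^sub>S t) \<otimes>\<^sub>S v"
    unfolding st(3) using st(1,2) vc yc by algebra
  also have "(embed c \<otimes>\<^sub>S t) \<otimes>\<^sub>S v = embed y \<otimes>\<^sub>S (embed c \<otimes>\<^sub>S t \<otimes>\<^sub>S s') \<oplus>\<^sub>S (embed c \<otimes>\<^sub>S embed c) \<otimes>\<^sub>S (t \<otimes>\<^sub>S t')"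
    unfolding st'(3) using st(1,2) st'(1,2) yc by algebra
  also have "embed y \<otimes>\<^sub>S (s \<otimes>\<^sub>S v) \<oplus>\<^sub>S \<dots> = embed y \<otimes>\<^sub>S q"
    unfolding cc q_def using st(1,2) st'(1,2) yc vc wc by algebra
  finally show "\<exists>w\<in>MS. u \<otimes>\<^sub>S v = embed y \<otimes>\<^sub>S w" using qc by blast
qed

text \<open>If y^n = m t, then y^(nk) is a multiple of m^k. So y-adic convergence and separation
  follow from the m-adic ones, at the price of the factor n in the exponent.\<close>

lemma y_power_cofinal: "\<exists>n. \<forall>k. PIdl\<^bsub>S\<^esub> (embed y [^]\<^sub>S (n * k)) \<subseteq> IS k"
proof -
  have mc: "embed m \<in> carrier S" using embed_carr[OF m_carr] .
  obtain n where "y [^] (n::nat) \<in> PIdl m" using radical[OF y_mem] by blast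
  then have "embed y [^]\<^sub>S n \<in> PIdl\<^bsub>S\<^esub> (embed m)" using embed_pow_mem[OF y_carr] by blast
  then obtain t where t: "t \<in> carrier S" "embed y [^]\<^sub>S n = embed m \<otimes>\<^sub>S t" using mc by (rule S.PIdlE)
  have "PIdl\<^bsub>S\<^esub> (embed y [^]\<^sub>S (n * k)) \<subseteq> IS k" for k
  proof (rule S.cgenideal_minimal[OF S.cgenideal_ideal])
    have "embed y [^]\<^sub>S (n * k) = (embed y [^]\<^sub>S n) [^]\<^sub>S k"
      using S.nat_pow_pow[OF S.y_carr] by simp
    also have "\<dots> = embed m [^]\<^sub>S k \<otimes>\<^sub>S t [^]\<^sub>S k"
      unfolding t(2) using S.nat_pow_distrib[OF mc t(1)] .
    finally show "embed y [^]\<^sub>S (n * k) \<in> IS k"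
      using S.PIdlI[of "embed m [^]\<^sub>S k" "t [^]\<^sub>S k"] mc t by simp
  qed (use mc in simp)
  then show ?thesis by blast
qed

lemma y_hausdorff:
  assumes x: "x \<in> carrier S" and "\<And>k::nat. x \<in> PIdl\<^bsub>S\<^esub> (embed y [^]\<^sub>S k)"
  shows "x = \<zero>\<^sub>S"
  using completion_hausdorff[OF x] y_power_cofinal assms(2) by blast

text \<open>No power of y lies in J, so the expansion x = b t + y^i s never stops. Successive
  coefficients t differ by multiples of y^i, hence converge, and in the limit the remainder
  disappears.\<close>

lemma ideal_avoiding_powers:
  assumes I: "ideal J S" "J \<subseteq> MS" and b: "b \<in> J" "b \<notin> PIdl\<^bsub>S\<^esub> (embed y)"
    and no: "\<And>j. embed y [^]\<^sub>S (j::nat) \<notin> J"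
  shows "J = PIdl\<^bsub>S\<^esub> b"
proof
  show "PIdl\<^bsub>S\<^esub> b \<subseteq> J" using S.cgenideal_minimal[OF I(1) b(1)] .
  have bc: "b \<in> carrier S" using S.ideal_carr[OF I(1) b(1)] .
  have yk: "embed y [^]\<^sub>S k \<in> carrier S" for k :: nat using S.y_carr by simp
  obtain n where n: "\<And>k. PIdl\<^bsub>S\<^esub> (embed y [^]\<^sub>S (n * k)) \<subseteq> IS k"
    using y_power_cofinal by blast
  show "J \<subseteq> PIdl\<^bsub>S\<^esub> b"
  proof
    fix x assume x: "x \<in> J"
    have xc: "x \<in> carrier S" using S.ideal_carr[OF I(1) x] .
    \<comment> \<open>The pairs (t, s) are obtained by dependent choice, because the next t has to
      refine the given one.\<close>
    let ?P = "\<lambda>i (t, s). t \<in> carrier S \<and> s \<in> carrier S \<and> x = b \<otimes>\<^sub>S t \<oplus>\<^sub>S embed y [^]\<^sub>S (i::nat) \<otimes>\<^sub>S s"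
    let ?Q = "\<lambda>i (t, s) (t', s'). t' \<ominus>\<^sub>S t \<in> PIdl\<^bsub>S\<^esub> (embed y [^]\<^sub>S (i::nat))"
    have "\<exists>f. \<forall>i. ?P i (f i) \<and> ?Q i (f i) (f (Suc i))"
    proof (rule dependent_nat_choice)
      have "?P 0 (\<zero>\<^sub>S, x)" using xc bc by simp
      then show "\<exists>p. ?P 0 p" by blast
    next
      fix p i assume p: "?P i p"
      obtain t s where ts: "p = (t, s)" by (cases p)
      then have h: "t \<in> carrier S" "s \<in> carrier S"
        "x = b \<otimes>\<^sub>S t \<oplus>\<^sub>S embed y [^]\<^sub>S i \<otimes>\<^sub>S s" using p by auto
      obtain q r where qr: "q \<in> carrier S" "r \<in> carrier S"
        "x = b \<otimes>\<^sub>S (t \<oplus>\<^sub>S embed y [^]\<^sub>S i \<otimes>\<^sub>S q) \<oplus>\<^sub>S embed y [^]\<^sub>S Suc i \<otimes>\<^sub>S r"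
        using S.ideal_step[OF I b no[of i] _ h(1,2)] x unfolding h(3) by blast
      have "(t \<oplus>\<^sub>S embed y [^]\<^sub>S i \<otimes>\<^sub>S q) \<ominus>\<^sub>S t = embed y [^]\<^sub>S i \<otimes>\<^sub>S q"
        using h(1) qr(1) yk[of i] by algebra
      then have "?Q i p (t \<oplus>\<^sub>S embed y [^]\<^sub>S i \<otimes>\<^sub>S q, r)"
        using ts S.PIdlI[OF yk qr(1)] by simp
      moreover have "?P (Suc i) (t \<oplus>\<^sub>S embed y [^]\<^sub>S i \<otimes>\<^sub>S q, r)"
        using h(1) qr yk[of i] by simp
      ultimately show "\<exists>p'. ?P (Suc i) p' \<and> ?Q i p p'" by blast
    qed
    then obtain f where ff: "\<forall>i. ?P i (f i) \<and> ?Q i (f i) (f (Suc i))" by (rule exE)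
    have f: "?P i (f i)" "?Q i (f i) (f (Suc i))" for i
      using spec[OF ff, of i] by (rule conjunct1, rule conjunct2)
    define T where "T i = fst (f i)" for i
    define s where "s i = snd (f i)" for i
    have T: "T i \<in> carrier S" "s i \<in> carrier S" "x = b \<otimes>\<^sub>S T i \<oplus>\<^sub>S embed y [^]\<^sub>S i \<otimes>\<^sub>S s i" for i
      using f(1)[of i] by (auto simp: T_def s_def case_prod_unfold)
    have st: "T (Suc i) \<ominus>\<^sub>S T i \<in> PIdl\<^bsub>S\<^esub> (embed y [^]\<^sub>S i)" for i
      using f(2)[of i] by (simp add: T_def case_prod_unfold)
    have st': "T (i + d) \<ominus>\<^sub>S T i \<in> PIdl\<^bsub>S\<^esub> (embed y [^]\<^sub>S i)" for i d
    proof (induct d)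
      case 0
      then show ?case using T(1) S.ideal_zero[OF S.cgenideal_ideal[OF yk]] by (simp add: a_minus_def S.r_neg)
    next
      case (Suc d)
      have "T (Suc (i + d)) \<ominus>\<^sub>S T (i + d) \<in> PIdl\<^bsub>S\<^esub> (embed y [^]\<^sub>S i)"
        using st[of "i + d"] S.PIdl_power_antimono[of i "i + d"] by auto
      from S.ideal_add[OF S.cgenideal_ideal[OF yk] this Suc]
      have "(T (Suc (i + d)) \<ominus>\<^sub>S T (i + d)) \<oplus>\<^sub>S (T (i + d) \<ominus>\<^sub>S T i) \<in> PIdl\<^bsub>S\<^esub> (embed y [^]\<^sub>S i)" .
      moreover have "(T (Suc (i + d)) \<ominus>\<^sub>S T (i + d)) \<oplus>\<^sub>S (T (i + d) \<ominus>\<^sub>S T i) = T (i + Suc d) \<ominus>\<^sub>S T i"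
        using S.diff_add_diff[OF T(1) T(1) T(1)] by simp
      ultimately show ?case by simp
    qed
    \<comment> \<open>Along the indices n k consecutive terms differ by multiples of m^k, the rate
      that \<open>completion_complete\<close> expects.\<close>
    have "\<exists>t\<in>carrier S. \<forall>k. t \<ominus>\<^sub>S T (n * k) \<in> IS k"
    proof (rule completion_complete[OF T(1)])
      fix k
      show "T (n * Suc k) \<ominus>\<^sub>S T (n * k) \<in> IS k"
        using st'[of "n * k" n] n[of k] by (auto simp: add.commute)
    qed
    then obtain t where t: "t \<in> carrier S"
      "\<And>k. t \<ominus>\<^sub>S T (n * k) \<in> IS k" by blast
    have "x \<ominus>\<^sub>S b \<otimes>\<^sub>S t = \<zero>\<^sub>S"
    proof (rule completion_hausdorff)
      show "x \<ominus>\<^sub>S b \<otimes>\<^sub>S t \<in> carrier S" using xc bc t by simp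
      fix k :: nat
      have id: "ideal (IS k) S" using S.cgenideal_ideal[OF embed_m_pow_carr] .
      define z where "z = embed y [^]\<^sub>S (n * k) \<otimes>\<^sub>S s (n * k)"
      have z: "z \<in> IS k"
        unfolding z_def using S.PIdlI[OF yk T(2)] n[of k] by blast
      have zc: "z \<in> carrier S" using S.ideal_carr[OF id z] .
      have "x \<ominus>\<^sub>S b \<otimes>\<^sub>S t = (b \<otimes>\<^sub>S T (n * k) \<oplus>\<^sub>S z) \<ominus>\<^sub>S b \<otimes>\<^sub>S t"
        using T(3)[of "n * k"] unfolding z_def by simp
      also have "\<dots> = z \<ominus>\<^sub>S (t \<ominus>\<^sub>S T (n * k)) \<otimes>\<^sub>S b"
        using bc zc t(1) T(1)[of "n * k"] by algebra
      also have "\<dots> \<in> IS k"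
        using S.ideal_diff[OF id z S.ideal_mult[OF id t(2) bc]] .
      finally show "x \<ominus>\<^sub>S b \<otimes>\<^sub>S t \<in> IS k" .
    qed
    then have "x = b \<otimes>\<^sub>S t" using xc bc t by simp
    then show "x \<in> PIdl\<^bsub>S\<^esub> b" using S.PIdlI[OF bc t(1)] by simp
  qed
qed

text \<open>By separation a nonzero ideal is not contained in all y^n S, so a largest power y^e can
  be divided out. If J contains a power of y it has two generators; otherwise the quotient by y^e
  avoids all powers of y and is principal.\<close>

theorem completion_noetherian: "noetherian_ring S"
proof (rule S.noetherian_ringI)
  fix J assume J: "ideal J S"
  have yk: "embed y [^]\<^sub>S k \<in> carrier S" for k :: nat using S.y_carr by simp
  have two: "\<exists>A\<subseteq>carrier S. finite A \<and> J = Idl\<^bsub>S\<^esub> A" if "two_generated S J"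
  proof -
    obtain a b where "a \<in> carrier S" "b \<in> carrier S" "J = Idl\<^bsub>S\<^esub> {a, b}"
      using \<open>two_generated S J\<close> by (auto simp: two_generated_def)
    then show ?thesis by (intro exI[of _ "{a, b}"]) simp
  qed
  show "\<exists>A\<subseteq>carrier S. finite A \<and> J = Idl\<^bsub>S\<^esub> A"
  proof (cases "J = {\<zero>\<^sub>S}")
    case True
    then show ?thesis using S.genideal_zero by (intro exI[of _ "{\<zero>\<^sub>S}"]) simp
  next
    case False
    then obtain x where x: "x \<in> J" "x \<noteq> \<zero>\<^sub>S" using S.ideal_zero[OF J] by blast
    then obtain n where "x \<notin> PIdl\<^bsub>S\<^esub> (embed y [^]\<^sub>S (n::nat))"
      using y_hausdorff S.ideal_carr[OF J] by blast
    then have "\<not> J \<subseteq> PIdl\<^bsub>S\<^esub> (embed y [^]\<^sub>S n)" using x(1) by blast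
    then obtain e where e: "J \<subseteq> PIdl\<^bsub>S\<^esub> (embed y [^]\<^sub>S (e::nat))"
      "\<not> J \<subseteq> PIdl\<^bsub>S\<^esub> (embed y [^]\<^sub>S Suc e)"
      using S.exists_strip_exponent[OF J] by blast
    show ?thesis
    proof (cases "\<exists>k. embed y [^]\<^sub>S (k::nat) \<in> J")
      case True
      then show ?thesis using S.two_generated_of_power_mem[OF J e] two by blast
    next
      case no: False
      define K where "K = {x \<in> carrier S. embed y [^]\<^sub>S e \<otimes>\<^sub>S x \<in> J}"
      have K: "ideal K S" unfolding K_def using S.ideal_colon[OF J yk] .
      have noK: "embed y [^]\<^sub>S j \<notin> K" for j :: nat
        using no S.nat_pow_mult[OF S.y_carr, of e j] unfolding K_def by simp
      have KM: "K \<subseteq> MS" using noK[of 0] S.proper_subset_M[OF K] by simp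
      obtain b where b: "b \<in> K" "b \<notin> PIdl\<^bsub>S\<^esub> (embed y)"
        using S.ideal_strip[OF J e] KM unfolding K_def by blast
      have bc: "b \<in> carrier S" using S.ideal_carr[OF K b(1)] .
      \<comment> \<open>The generator is doubled to fit \<open>scaled_Idl2\<close>.\<close>
      have "K = Idl\<^bsub>S\<^esub> {b, b}"
        using ideal_avoiding_powers[OF K KM b noK] S.cgenideal_eq_genideal[OF bc] by simp
      then have "J = Idl\<^bsub>S\<^esub> {embed y [^]\<^sub>S e \<otimes>\<^sub>S b, embed y [^]\<^sub>S e \<otimes>\<^sub>S b}"
        using S.scaled_Idl2[OF J e(1) yk bc bc] unfolding K_def by blast
      then show ?thesis using bc yk by (intro exI[of _ "{embed y [^]\<^sub>S e \<otimes>\<^sub>S b}"]) simp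
    qed
  qed
qed

text \<open>Q is not the maximal ideal, so it contains no power of y. If it lay in yS, then Q = yQ
  and Q would vanish by separation; hence Q = bS for some b outside P. From b b = y w follows w = b
  s, so b (b - y s) = 0 and b - y s lies in P. Then y s lies in Q, so s = b t, and (1 - y t) b lies
  in P, which forces b into P.\<close>

lemma no_prime_chain:
  assumes P: "primeideal P S" "primeideal Q S" "primeideal N S" "P \<subset> Q" "Q \<subset> N"
  shows False
proof -
  have id: "ideal P S" "ideal Q S" using P by (simp_all add: primeideal.axioms(1))
  have Qpr: "a \<in> Q \<or> b \<in> Q" if "a \<in> carrier S" "b \<in> carrier S" "a \<otimes>\<^sub>S b \<in> Q" for a b
    using P(2) that by (auto simp: primeideal_def primeideal_axioms_def)
  have Ppr: "a \<in> P \<or> b \<in> P" if "a \<in> carrier S" "b \<in> carrier S" "a \<otimes>\<^sub>S b \<in> P" for a b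
    using P(1) that by (auto simp: primeideal_def primeideal_axioms_def)
  have QM: "Q \<subset> MS" using S.prime_subset_M[OF P(3)] P(5) by blast
  have one: "\<one>\<^sub>S \<notin> Q" using QM S.one_notin_M by blast
  have yQ: "embed y \<notin> Q"
  proof
    assume y: "embed y \<in> Q"
    have "MS \<subseteq> Q"
    proof
      fix u assume u: "u \<in> MS"
      obtain w where w: "w \<in> carrier S" "u \<otimes>\<^sub>S u = embed y \<otimes>\<^sub>S w"
        using S.M_square[OF u u] S.M_carr by blast
      have "u \<otimes>\<^sub>S u \<in> Q" unfolding w(2) using S.ideal_mult[OF id(2) y w(1)] .
      then show "u \<in> Q" using Qpr S.M_carr[OF u] by blast
    qed
    then show False using QM by blast
  qed
  have no: "embed y [^]\<^sub>S j \<notin> Q" for j :: nat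
  proof (induct j)
    case (Suc j)
    then show ?case using Qpr[of "embed y [^]\<^sub>S j" "embed y"] yQ S.y_carr by auto
  qed (use one in simp)
  have "\<not> Q \<subseteq> PIdl\<^bsub>S\<^esub> (embed y)"
  proof
    assume sub: "Q \<subseteq> PIdl\<^bsub>S\<^esub> (embed y)"
    have "x \<in> PIdl\<^bsub>S\<^esub> (embed y [^]\<^sub>S (k::nat))" if "x \<in> Q" for x k
      using that
    proof (induct k arbitrary: x)
      case 0
      have "x = \<one>\<^sub>S \<otimes>\<^sub>S x" using S.ideal_carr[OF id(2) 0] by simp
      then show ?case using S.PIdlI[OF S.one_closed S.ideal_carr[OF id(2) 0]] by simp
    next
      case (Suc k)
      obtain z where z: "z \<in> carrier S" "x = embed y \<otimes>\<^sub>S z"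
        using subsetD[OF sub Suc(2)] S.y_carr by (rule S.PIdlE)
      then have "z \<in> Q" using Qpr[OF S.y_carr z(1)] Suc(2) yQ by blast
      then have "z \<in> PIdl\<^bsub>S\<^esub> (embed y [^]\<^sub>S k)" by (rule Suc(1))
      moreover have yk: "embed y [^]\<^sub>S k \<in> carrier S" using S.y_carr by simp
      ultimately obtain t where t: "t \<in> carrier S" "z = embed y [^]\<^sub>S k \<otimes>\<^sub>S t" by (rule S.PIdlE)
      have "x = embed y [^]\<^sub>S Suc k \<otimes>\<^sub>S t"
        unfolding z(2) t(2) using S.y_carr t(1) by (simp add: S.m_assoc S.m_lcomm)
      then show ?case using S.PIdlI[of "embed y [^]\<^sub>S Suc k" t] S.y_carr t by simp
    qed
    then have "x = \<zero>\<^sub>S" if "x \<in> Q" for x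
      using y_hausdorff[OF S.ideal_carr[OF id(2) that]] that by blast
    then show False using P(4) S.ideal_zero[OF id(1)] by blast
  qed
  then obtain b where b: "b \<in> Q" "b \<notin> PIdl\<^bsub>S\<^esub> (embed y)" by blast
  have bc: "b \<in> carrier S" using S.ideal_carr[OF id(2) b(1)] .
  have Qb: "Q = PIdl\<^bsub>S\<^esub> b" using ideal_avoiding_powers[OF id(2) _ b no] QM by blast
  have bP: "b \<notin> P" using S.cgenideal_minimal[OF id(1), of b] Qb P(4) by blast
  have bM: "b \<in> MS" using b(1) QM by blast
  obtain w where w: "w \<in> carrier S" "b \<otimes>\<^sub>S b = embed y \<otimes>\<^sub>S w"
    using S.M_square[OF bM bM] S.M_carr by blast
  have "embed y \<otimes>\<^sub>S w \<in> Q" unfolding w(2)[symmetric] using S.ideal_mult[OF id(2) b(1) bc] .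
  then have "w \<in> PIdl\<^bsub>S\<^esub> b" using Qpr[OF S.y_carr w(1)] yQ Qb by blast
  then obtain s where s: "s \<in> carrier S" "w = b \<otimes>\<^sub>S s" using bc by (rule S.PIdlE)
  have "b \<otimes>\<^sub>S (b \<ominus>\<^sub>S embed y \<otimes>\<^sub>S s) = b \<otimes>\<^sub>S b \<ominus>\<^sub>S embed y \<otimes>\<^sub>S (b \<otimes>\<^sub>S s)"
    using bc s(1) S.y_carr by algebra
  also have "\<dots> = \<zero>\<^sub>S" unfolding w(2) s(2) using bc s(1) S.y_carr by (simp add: a_minus_def S.r_neg)
  finally have "b \<otimes>\<^sub>S (b \<ominus>\<^sub>S embed y \<otimes>\<^sub>S s) \<in> P" using S.ideal_zero[OF id(1)] by simp
  then have d: "b \<ominus>\<^sub>S embed y \<otimes>\<^sub>S s \<in> P"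
    using Ppr[OF bc, of "b \<ominus>\<^sub>S embed y \<otimes>\<^sub>S s"] bP bc s(1) S.y_carr by simp
  have "b \<ominus>\<^sub>S (b \<ominus>\<^sub>S embed y \<otimes>\<^sub>S s) \<in> Q" using S.ideal_diff[OF id(2) b(1)] d P(4) by blast
  moreover have "b \<ominus>\<^sub>S (b \<ominus>\<^sub>S embed y \<otimes>\<^sub>S s) = embed y \<otimes>\<^sub>S s"
    using bc s(1) S.y_carr by algebra
  ultimately have "s \<in> PIdl\<^bsub>S\<^esub> b" using Qpr[OF S.y_carr s(1)] yQ Qb by simp
  then obtain t where t: "t \<in> carrier S" "s = b \<otimes>\<^sub>S t" using bc by (rule S.PIdlE)
  have "(\<one>\<^sub>S \<ominus>\<^sub>S embed y \<otimes>\<^sub>S t) \<otimes>\<^sub>S b = b \<ominus>\<^sub>S embed y \<otimes>\<^sub>S (b \<otimes>\<^sub>S t)"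
    using bc t(1) S.y_carr by (simp add: a_minus_def S.l_distr S.l_minus S.m_assoc S.m_comm[of t b])
  then have "(\<one>\<^sub>S \<ominus>\<^sub>S embed y \<otimes>\<^sub>S t) \<otimes>\<^sub>S b \<in> P" using d t(2) by simp
  then show False
    using S.unit_mult_mem_ideal[OF id(1) S.one_minus_unit[OF S.ideal_mult[OF S.M_ideal S.y_mem t(1)]] bc] bP
    by blast
qed

text \<open>An upper bound determines the factor in the multiplicity, because the factorials of 0
  and 1 agree.\<close>

lemma completion_krull_dim: "krull_dim S \<le> 1"
  unfolding krull_dim_def
proof (rule Sup_least)
  fix d assume "d \<in> {enat n |n. \<exists>P. (\<forall>i\<le>n. primeideal (P i) S) \<and> (\<forall>i<n. P i \<subset> P (Suc i))}"
  then obtain n P where d: "d = enat n" and P: "\<forall>i\<le>n. primeideal (P i) S" "\<forall>i<n. P i \<subset> P (Suc i)" by blast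
  have "n \<le> 1"
  proof (rule ccontr)
    assume "\<not> n \<le> 1"
    then show False using no_prime_chain[of "P 0" "P 1" "P 2"] P by (simp add: numeral_2_eq_2)
  qed
  then show "d \<le> 1" by (simp add: d one_enat_def)
qed

end

section \<open>Comparison of the ring and its completion\<close>

lemma (in cring) ideal_pow_power_subset:
  assumes I: "ideal I R" and p: "p \<in> carrier R" and N: "ideal_pow R I N \<subseteq> PIdl p"
  shows "ideal_pow R I (N * j) \<subseteq> PIdl (p [^] (j::nat))"
proof (induct j)
  case 0
  have "PIdl \<one> = carrier R"
    using unit_mem_ideal[OF cgenideal_ideal[OF one_closed] Units_one_closed cgenideal_self[OF one_closed]] .
  then show ?case by simp
next
  case (Suc j)
  have pj: "p [^] j \<in> carrier R" "p [^] Suc j \<in> carrier R" using p by auto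
  have "ideal_pow R I (N + N * j) \<subseteq> PIdl (p [^] Suc j)"
  proof (rule ideal_pow_Idl_gen[OF I cgenideal_ideal[OF pj(2)]])
    fix u v assume "u \<in> ideal_pow R I N" "v \<in> ideal_pow R I (N * j)"
    then have uv: "u \<in> PIdl p" "v \<in> PIdl (p [^] j)" using N Suc by auto
    obtain s where s: "s \<in> carrier R" "u = p \<otimes> s" using uv(1) p by (rule PIdlE)
    obtain t where t: "t \<in> carrier R" "v = p [^] j \<otimes> t" using uv(2) pj(1) by (rule PIdlE)
    have "u \<otimes> v = (p [^] j \<otimes> p) \<otimes> (s \<otimes> t)" unfolding s(2) t(2) using p pj s(1) t(1) by algebra
    then show "u \<otimes> v \<in> PIdl (p [^] Suc j)" using PIdlI[OF pj(2), of "s \<otimes> t"] s t by simp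
  qed
  then show ?case by simp
qed

text \<open>x + z and x are congruent modulo J, hence so are their powers.\<close>

lemma (in cring) pow_add_mem:
  assumes J: "ideal J R" and z: "z \<in> J" and x: "x \<in> carrier R" and xn: "x [^] (n::nat) \<in> J"
  shows "(x \<oplus> z) [^] n \<in> J"
proof -
  have zc: "z \<in> carrier R" using ideal_carr[OF J z] .
  have "(x \<oplus> z) [^] n \<ominus> x [^] n \<in> J"
  proof (induct n)
    case 0
    then show ?case using ideal_zero[OF J] by (simp add: a_minus_def r_neg)
  next
    case (Suc n)
    have c: "(x \<oplus> z) [^] n \<in> carrier R" "x [^] n \<in> carrier R" using x zc by auto
    have "(x \<oplus> z) [^] n \<otimes> (x \<oplus> z) \<ominus> x [^] n \<otimes> x =
        ((x \<oplus> z) [^] n \<ominus> x [^] n) \<otimes> x \<oplus> z \<otimes> (x \<oplus> z) [^] n"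
      using c x zc by algebra
    also have "\<dots> \<in> J" using ideal_add[OF J ideal_mult[OF J Suc x] ideal_mult[OF J z c(1)]] .
    finally show ?case by simp
  qed
  then show ?thesis using ideal_diff_cancel[OF J _ xn] x zc by simp
qed

section \<open>Powers with two generators and series of length at most two\<close>

context local_cring
begin

lemma compser_le_two_generated:
  assumes c: "a \<in> carrier R" "b \<in> carrier R" and L: "Mpow k = Idl {a, b}"
  shows "compser_le (Mpow (Suc k)) (Mpow k) 2"
proof -
  let ?K = "Mpow (Suc k)"
  have K: "ideal ?K R" and Lid: "ideal (Mpow k) R"
    by (rule Mpow_ideal)+
  have ab: "a \<in> Mpow k" "b \<in> Mpow k"
    using genideal_self[of "{a, b}"] c unfolding L by auto
  have MK: "z \<otimes> x \<in> ?K" if "z \<in> Mpow k" "x \<in> M" for z x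
    using ideal_prod.prod[OF that(2,1), of R] m_comm[OF ideal_carr[OF Lid that(1)] M_carr[OF that(2)]] by simp
  have T: "ideal (adj ?K a) R" using adj_ideal[OF K c(1)] .
  have 1: "compser_le ?K (adj ?K a) 1"
    using compser_le_step[OF compser_le_refl[OF K] c(1) MK[OF ab(1)]] by simp
  have "b \<otimes> x \<in> adj ?K a" if "x \<in> M" for x
    using MK[OF ab(2) that] adj_supset[OF K c(1)] by blast
  then have "compser_le ?K (adj (adj ?K a) b) (Suc 1)" using compser_le_step[OF 1 c(2)] by blast
  moreover have "adj (adj ?K a) b = Mpow k"
  proof
    show "adj (adj ?K a) b \<subseteq> Mpow k"
      using ideal_pow_Suc_subset[OF M_ideal, of k] ab
      by (intro adj_least[OF Lid] adj_least[OF Lid, of ?K a])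
    have "{a, b} \<subseteq> adj (adj ?K a) b"
      using adj_self[OF K c(1)] adj_supset[OF T c(2)] adj_self[OF T c(2)] by auto
    then show "Mpow k \<subseteq> adj (adj ?K a) b"
      unfolding L by (intro genideal_minimal adj_ideal[OF T c(2)])
  qed
  ultimately show ?thesis by (simp add: numeral_2_eq_2)
qed

text \<open>Shorter series are padded by adjoining zero, so that two elements can be named in every
  case.\<close>

lemma compser_at_most_two:
  assumes "compser I J n" "n \<le> 2"
  shows "\<exists>a \<in> J. \<exists>b \<in> J. J = adj (adj I a) b"
proof -
  have I: "ideal I R" and J: "ideal J R" and IJ: "I \<subseteq> J" using compser_ideals[OF assms(1)] by auto
  have z: "adj I \<zero> = I" using adj_absorb[OF I ideal_zero[OF I]] .
  have inv: "\<exists>c J'. c \<in> carrier R \<and> compser I J' k \<and> J = adj J' c" if "compser I J (Suc k)" for J k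
    using that by cases auto
  have inv0: "J = I" if "compser I J 0" for J using that by cases auto
  have "n = 0 \<or> n = Suc 0 \<or> n = Suc (Suc 0)" using assms(2) by auto
  then consider "n = 0" | "n = Suc 0" | "n = Suc (Suc 0)" by blast
  then have "\<exists>a \<in> carrier R. \<exists>b \<in> carrier R. J = adj (adj I a) b"
  proof cases
    case 1
    then show ?thesis using assms(1) inv0 z zero_closed by metis
  next
    case 2
    then show ?thesis using assms(1) inv inv0 z zero_closed by metis
  next
    case 3
    then show ?thesis using assms(1) inv inv0 by metis
  qed
  then obtain a b where ab: "a \<in> carrier R" "b \<in> carrier R" "J = adj (adj I a) b" by blast
  have "a \<in> J" "b \<in> J"
    unfolding ab(3) using adj_self[OF I ab(1)] adj_supset[OF adj_ideal[OF I ab(1)] ab(2)]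
      adj_self[OF adj_ideal[OF I ab(1)] ab(2)] by auto
  then show ?thesis using ab(3) by blast
qed

lemma ideal_pow_stable:
  assumes "Mpow (Suc k) = Mpow k"
  shows "Mpow (k + j) = Mpow k"
proof (induct j)
  case (Suc j)
  then show ?case using assms by simp
qed simp

end

section \<open>Powers of M when M^2 = yM\<close>

context stable_local
begin

text \<open>Induction from M^2 = yM gives M^(k+1) = y^k M, and M has the generators y and c.\<close>

lemma ideal_pow_two_generated:
  "Mpow (Suc k) = Idl {y [^] k \<otimes> y, y [^] k \<otimes> c}"
proof -
  have yk: "y [^] k \<in> carrier R" for k :: nat using y_carr by simp
  have sub: "Mpow (Suc k) \<subseteq> (\<otimes>) (y [^] k) ` M" for k
  proof (induct k)
    case 0
    have "(\<otimes>) \<one> ` M = M" using M_carr by force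
    then show ?case using ideal_pow_1[OF M_ideal] by simp
  next
    case (Suc k)
    show ?case unfolding ideal_pow.simps(2)[of R M "Suc k"]
    proof (rule ideal_prod_subset[OF scale_ideal[OF M_ideal yk]])
      fix i j assume i: "i \<in> M" and "j \<in> Mpow (Suc k)"
      then obtain z where z: "z \<in> M" "j = y [^] k \<otimes> z" using Suc by blast
      obtain w where w: "w \<in> M" "i \<otimes> z = y \<otimes> w" using M_square[OF i z(1)] by blast
      have "i \<otimes> j = y [^] k \<otimes> (i \<otimes> z)" unfolding z(2) using M_carr[OF i] M_carr[OF z(1)] yk m_lcomm by simp
      also have "\<dots> = y [^] Suc k \<otimes> w" unfolding w(2) using M_carr[OF w(1)] yk y_carr by (simp add: m_assoc)
      finally show "i \<otimes> j \<in> (\<otimes>) (y [^] Suc k) ` M" using w(1) by blast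
    qed
  qed
  have c: "y [^] k \<otimes> y \<in> carrier R" "y [^] k \<otimes> c \<in> carrier R" using yk y_carr c_carr by auto
  show ?thesis
  proof
    have "y [^] k \<otimes> z \<in> Mpow (k + Suc 0)" if "z \<in> M" for z
      using ideal_pow_mult[OF M_ideal pow_mem_ideal_pow[OF M_ideal y_mem], of z "Suc 0" k]
        ideal_pow_1[OF M_ideal] that by simp
    then have "y [^] k \<otimes> y \<in> Mpow (Suc k)" "y [^] k \<otimes> c \<in> Mpow (Suc k)"
      using y_mem c_mem by auto
    then show "Idl {y [^] k \<otimes> y, y [^] k \<otimes> c} \<subseteq> Mpow (Suc k)"
      by (intro genideal_minimal Mpow_ideal) simp
    show "Mpow (Suc k) \<subseteq> Idl {y [^] k \<otimes> y, y [^] k \<otimes> c}"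
    proof
      fix x assume "x \<in> Mpow (Suc k)"
      then obtain z where z: "z \<in> M" "x = y [^] k \<otimes> z" using sub by blast
      obtain r s where rs: "r \<in> carrier R" "s \<in> carrier R" "z = y \<otimes> r \<oplus> c \<otimes> s"
        using z(1) M_gen Idl2_iff[OF y_carr c_carr] by blast
      have "x = (y [^] k \<otimes> y) \<otimes> r \<oplus> (y [^] k \<otimes> c) \<otimes> s"
        unfolding z(2) rs(3) using yk[of k] y_carr c_carr rs(1,2) by algebra
      then show "x \<in> Idl {y [^] k \<otimes> y, y [^] k \<otimes> c}" using Idl2_iff[OF c] rs by blast
    qed
  qed
qed

end

section \<open>Hilbert function of the completion and descent of generators to R\<close>

context adic_radical
begin

lemma completion_local_ring: "local_ring S"
  by (rule S.is_local_ring)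

lemma completion_radical:
  assumes x: "x \<in> MS"
  shows "\<exists>n. x [^]\<^sub>S (n::nat) \<in> PIdl\<^bsub>S\<^esub> (embed m)"
proof -
  obtain r z where h: "r \<in> M" "z \<in> PIdl\<^bsub>S\<^esub> (embed m)" "x = embed r \<oplus>\<^sub>S z"
    using x by (rule MS_mem_cases)
  have rc: "r \<in> carrier R" using M_carr h(1) .
  obtain n where "r [^] (n::nat) \<in> PIdl m" using radical[OF h(1)] by blast
  then have "embed r [^]\<^sub>S n \<in> PIdl\<^bsub>S\<^esub> (embed m)" using embed_pow_mem[OF rc] by blast
  then have "x [^]\<^sub>S n \<in> PIdl\<^bsub>S\<^esub> (embed m)"
    unfolding h(3) using S.pow_add_mem[OF S.cgenideal_ideal[OF embed_carr[OF m_carr]] h(2) embed_carr[OF rc]]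
    by blast
  then show ?thesis by blast
qed

lemma completion_hilbert_function:
  assumes A: "finite A" "A \<subseteq> carrier S" "MS = Idl\<^bsub>S\<^esub> A"
  shows "\<exists>h N e k0 d. S.Mpow N \<subseteq> PIdl\<^bsub>S\<^esub> (embed m) \<and>
    (\<forall>k. S.compser (S.Mpow (Suc k)) (S.Mpow k) (h k)) \<and> (\<forall>k\<ge>k0. h k = e) \<and>
    hilbert_samuel_poly S = [:d, real e:]"
proof -
  have AM: "A \<subseteq> MS" using S.genideal_self[OF A(2)] A(3) by blast
  have mM: "embed m \<in> MS" using embed_mem_MS[OF m_carr] m_mem by simp
  obtain h N e k0 where h: "S.Mpow N \<subseteq> PIdl\<^bsub>S\<^esub> (embed m)"
    "\<forall>k. S.compser (S.Mpow (Suc k)) (S.Mpow k) (h k)" "\<forall>k\<ge>k0. h k = e"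
    using S.hilbert_function_eventually_const[OF A(1) AM A(3) mM] completion_radical AM by blast
  then show ?thesis using S.hilbert_samuel_poly_eq[of h k0 e] by blast
qed

text \<open>Equality at one place makes all later powers equal. Powers of exponent at least N (k +
  1) consist of multiples of m^(k+1), so m^k would be a multiple of m^(k+1) already in R, and m a
  unit. This is what makes the eventual length e positive.\<close>

lemma completion_powers_distinct:
  assumes N: "S.Mpow N \<subseteq> PIdl\<^bsub>S\<^esub> (embed m)"
  shows "S.Mpow (Suc k) \<noteq> S.Mpow k"
proof
  assume eq: "S.Mpow (Suc k) = S.Mpow k"
  have mc: "embed m \<in> carrier S" using embed_carr[OF m_carr] .
  have mM: "embed m \<in> MS" using embed_mem_MS[OF m_carr] m_mem by simp
  have "embed m [^]\<^sub>S k \<in> S.Mpow (k + N * Suc k)"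
    using S.pow_mem_ideal_pow[OF S.M_ideal mM, of k] S.ideal_pow_stable[OF eq] by simp
  then have "embed m [^]\<^sub>S k \<in> IS (Suc k)"
    using S.ideal_pow_antimono[OF S.M_ideal le_add2[of "N * Suc k" k]]
      S.ideal_pow_power_subset[OF S.M_ideal mc N, of "Suc k"] by blast
  then have "m [^] k \<in> I (Suc k)"
    using embed_mem_power_iff[OF m_pow_carr, of k "Suc k"] embed_pow[OF m_carr, of k] by simp
  then obtain t where t: "t \<in> carrier R" "m [^] k = m [^] Suc k \<otimes> t" using m_pow_carr by (rule PIdlE)
  have "m [^] k \<otimes> \<one> = m [^] k \<otimes> (m \<otimes> t)" using t m_carr by (simp add: m_assoc)
  then have "\<one> = m \<otimes> t" using nzd_cancel[OF nzd_pow[OF m_nzd]] t m_carr by blast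
  then show False using one_notin_M ideal_mult[OF M_ideal m_mem t(1)] by simp
qed

lemma embed_mem_ideal_pow: "r \<in> Mpow k \<Longrightarrow> embed r \<in> S.Mpow k"
proof (induct k arbitrary: r)
  case 0
  then show ?case using embed_carr by simp
next
  case (Suc k)
  have c: "z \<in> carrier R" if "z \<in> ideal_prod R M (Mpow k)" for z
    using ideal_carr[OF ideal_prod_is_ideal[OF M_ideal Mpow_ideal] that] .
  from Suc(2) have "r \<in> ideal_prod R M (Mpow k)" by simp
  then have "embed r \<in> ideal_prod S MS (S.Mpow k)"
  proof induct
    case (prod i j)
    have "i \<in> carrier R" "j \<in> carrier R"
      using prod M_carr ideal_carr[OF Mpow_ideal] by auto
    then show ?case
      using ideal_prod.prod[of "embed i" MS "embed j" "S.Mpow k" S] embed_mem_MS prod Suc(1)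
      by (simp add: embed_mult)
  next
    case (sum s1 s2)
    then show ?case using ideal_prod.sum[of "embed s1" S MS "S.Mpow k" "embed s2"] c
      by (simp add: embed_add)
  qed
  then show ?case by simp
qed

text \<open>Products are approximated factor by factor. The precision is at least 1, so that the
  error of a factor from \<open>MS\<close> stays in \<open>MS\<close> and its approximation lies in
  M.\<close>

lemma ideal_pow_completion_approx:
  assumes "x \<in> S.Mpow k"
  shows "\<exists>r \<in> Mpow k. x \<ominus>\<^sub>S embed r \<in> IS (Suc j)"
  using assms
proof (induct k arbitrary: x)
  case 0
  then show ?case using completion_dense[of x "Suc j"] by simp
next
  case (Suc k)
  let ?P = "IS (Suc j)"
  have P: "ideal ?P S" using S.cgenideal_ideal[OF embed_m_pow_carr] .
  have PM: "?P \<subseteq> MS"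
  proof (rule S.cgenideal_minimal[OF S.M_ideal])
    have "embed m \<in> MS" using embed_mem_MS[OF m_carr] m_mem by simp
    then show "embed m [^]\<^sub>S Suc j \<in> MS"
      using S.ideal_mult'[OF S.M_ideal _ embed_m_pow_carr[of j]] by simp
  qed
  have Mk: "ideal (Mpow k) R" "ideal (Mpow (Suc k)) R"
    using Mpow_ideal by blast+
  from Suc(2) have "x \<in> ideal_prod S MS (S.Mpow k)" by simp
  then show ?case
  proof induct
    case (prod i z)
    have ic: "i \<in> carrier S" using S.M_carr prod(1) .
    have zc: "z \<in> carrier S" using S.ideal_carr[OF S.Mpow_ideal prod(2)] .
    obtain r where r: "r \<in> carrier R" "i \<ominus>\<^sub>S embed r \<in> ?P" using completion_dense[OF ic] by blast
    obtain s where s: "s \<in> Mpow k" "z \<ominus>\<^sub>S embed s \<in> ?P" using Suc(1)[OF prod(2)] by blast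
    have sc: "s \<in> carrier R" using ideal_carr[OF Mk(1) s(1)] .
    have c: "embed r \<in> carrier S" "embed s \<in> carrier S" using embed_carr r(1) sc by auto
    have "i \<ominus>\<^sub>S (i \<ominus>\<^sub>S embed r) \<in> MS" using S.ideal_diff[OF S.M_ideal prod(1)] PM r(2) by blast
    moreover have "i \<ominus>\<^sub>S (i \<ominus>\<^sub>S embed r) = embed r" using ic c by algebra
    ultimately have rM: "r \<in> M" using embed_mem_MS[OF r(1)] by simp
    have "i \<otimes>\<^sub>S z \<ominus>\<^sub>S embed r \<otimes>\<^sub>S embed s =
        (i \<ominus>\<^sub>S embed r) \<otimes>\<^sub>S z \<oplus>\<^sub>S (z \<ominus>\<^sub>S embed s) \<otimes>\<^sub>S embed r"
      using ic zc c by algebra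
    also have "\<dots> \<in> ?P" using S.ideal_add[OF P S.ideal_mult[OF P r(2) zc] S.ideal_mult[OF P s(2) c(1)]] .
    finally have "i \<otimes>\<^sub>S z \<ominus>\<^sub>S embed (r \<otimes> s) \<in> ?P" using embed_mult[OF r(1) sc] by simp
    moreover have "r \<otimes> s \<in> Mpow (Suc k)" using ideal_prod.prod[OF rM s(1), of R] by simp
    ultimately show ?case by blast
  next
    case (sum s1 s2)
    then obtain r1 r2 where h: "r1 \<in> Mpow (Suc k)" "s1 \<ominus>\<^sub>S embed r1 \<in> ?P"
      "r2 \<in> Mpow (Suc k)" "s2 \<ominus>\<^sub>S embed r2 \<in> ?P" by blast
    have sc: "s1 \<in> carrier S" "s2 \<in> carrier S"
      using sum S.ideal_carr[OF S.ideal_prod_is_ideal[OF S.M_ideal S.Mpow_ideal]] by auto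
    have rc: "r1 \<in> carrier R" "r2 \<in> carrier R" using h ideal_carr[OF Mk(2)] by auto
    have c: "embed r1 \<in> carrier S" "embed r2 \<in> carrier S" using embed_carr rc by auto
    have "(s1 \<oplus>\<^sub>S s2) \<ominus>\<^sub>S (embed r1 \<oplus>\<^sub>S embed r2) = (s1 \<ominus>\<^sub>S embed r1) \<oplus>\<^sub>S (s2 \<ominus>\<^sub>S embed r2)"
      using sc c by algebra
    also have "\<dots> \<in> ?P" using S.ideal_add[OF P h(2,4)] .
    finally have "(s1 \<oplus>\<^sub>S s2) \<ominus>\<^sub>S embed (r1 \<oplus> r2) \<in> ?P" using embed_add[OF rc] by simp
    then show ?case using ideal_add[OF Mk(2) h(1,3)] by blast
  qed
qed

text \<open>M^k is not known to be finitely generated in R, so Nakayama does not apply to it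
  directly. Instead, the completion shows that M^k lies in (a', b') + m^(k+1) R. For the element m^k
  this puts a unit multiple of m^k into (a', b'), so that (a', b') absorbs the error term m^(k+1)
  R.\<close>

lemma two_generated_descends:
  assumes N: "S.Mpow N \<subseteq> PIdl\<^bsub>S\<^esub> (embed m)"
    and ab: "a \<in> S.Mpow k" "b \<in> S.Mpow k"
    and gen: "S.Mpow k = S.adj (S.adj (S.Mpow (Suc k)) a) b"
  shows "two_generated R (Mpow k)"
proof -
  have mc: "embed m \<in> carrier S" using embed_carr[OF m_carr] .
  have pid: "ideal (S.Mpow n) S" for n using S.Mpow_ideal .
  have abc: "a \<in> carrier S" "b \<in> carrier S" using ab S.ideal_carr[OF pid] by auto
  \<comment> \<open>Substituting the generation formula repeatedly into its own error term pushes
    the error into the power k + j for every j.\<close>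
  define T where "T j = S.adj (S.adj (S.Mpow (k + j)) a) b" for j
  have T1: "ideal (S.adj (S.Mpow j) a) S" for j using S.adj_ideal[OF pid abc(1)] .
  have Tid: "ideal (T j) S" for j unfolding T_def using S.adj_ideal[OF T1 abc(2)] .
  have abT: "a \<in> T j" "b \<in> T j" for j
    unfolding T_def using S.adj_self[OF pid abc(1)] S.adj_supset[OF T1 abc(2)] S.adj_self[OF T1 abc(2)] by auto
  have powT: "S.Mpow (k + j) \<subseteq> T j" for j
    unfolding T_def using S.adj_supset[OF pid abc(1)] S.adj_supset[OF T1 abc(2)] by blast
  have sub: "S.Mpow k \<subseteq> T j" for j
  proof (induct j)
    case 0
    then show ?case using powT[of 0] by simp
  next
    case (Suc j)
    have "S.Mpow (Suc k) \<subseteq> T (Suc j)"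
      unfolding ideal_pow.simps(2)
    proof (rule S.ideal_prod_subset[OF Tid])
      fix i x assume i: "i \<in> MS" and "x \<in> S.Mpow k"
      then have "x \<in> S.adj (S.adj (S.Mpow (k + j)) a) b" using Suc unfolding T_def by blast
      then obtain z r s where h: "z \<in> S.Mpow (k + j)" "r \<in> carrier S" "s \<in> carrier S"
        "x = (z \<oplus>\<^sub>S a \<otimes>\<^sub>S r) \<oplus>\<^sub>S b \<otimes>\<^sub>S s" unfolding S.adj_def by blast
      have c: "z \<in> carrier S" "i \<in> carrier S" using S.ideal_carr[OF pid h(1)] S.M_carr[OF i] .
      have "i \<otimes>\<^sub>S x = (i \<otimes>\<^sub>S z \<oplus>\<^sub>S a \<otimes>\<^sub>S (i \<otimes>\<^sub>S r)) \<oplus>\<^sub>S b \<otimes>\<^sub>S (i \<otimes>\<^sub>S s)"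
        unfolding h(4) using c abc h(2,3) by algebra
      moreover have "i \<otimes>\<^sub>S z \<in> T (Suc j)"
        using ideal_prod.prod[OF i h(1), of S] powT[of "Suc j"] by auto
      ultimately show "i \<otimes>\<^sub>S x \<in> T (Suc j)"
        using abT[of "Suc j"] c h by (simp add: S.ideal_simps[OF Tid])
    qed
    then have "S.adj (S.Mpow (Suc k)) a \<subseteq> T (Suc j)"
      using abT(1) by (rule S.adj_least[OF Tid])
    then have "S.adj (S.adj (S.Mpow (Suc k)) a) b \<subseteq> T (Suc j)"
      using abT(2) by (rule S.adj_least[OF Tid])
    then show ?case by (subst gen)
  qed
  \<comment> \<open>Precision k + 1 is one more than the exponent of m^k, the element used for the
    Nakayama argument. Raising the power of \<open>MS\<close> by N (k + 1) reaches it.\<close>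
  let ?P = "IS (Suc k)"
  have P: "ideal ?P S" using S.cgenideal_ideal[OF embed_m_pow_carr] .
  have powP: "S.Mpow (k + N * Suc k) \<subseteq> ?P"
    using S.ideal_pow_antimono[OF S.M_ideal, of "N * Suc k" "k + N * Suc k"]
      S.ideal_pow_power_subset[OF S.M_ideal mc N, of "Suc k"] by auto
  have ex: "\<exists>z\<in>?P. \<exists>s\<in>carrier S. \<exists>t\<in>carrier S. x = (z \<oplus>\<^sub>S a \<otimes>\<^sub>S s) \<oplus>\<^sub>S b \<otimes>\<^sub>S t"
    if x: "x \<in> S.Mpow k" for x
  proof -
    have "x \<in> S.adj (S.adj (S.Mpow (k + N * Suc k)) a) b"
      using subsetD[OF sub x, of "N * Suc k"] unfolding T_def .
    then show ?thesis using powP unfolding S.adj_def by blast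
  qed
  have kc: "ideal (Mpow k) R" using Mpow_ideal .
  obtain a' where a': "a' \<in> Mpow k" "a \<ominus>\<^sub>S embed a' \<in> ?P"
    using ideal_pow_completion_approx[OF ab(1)] by blast
  obtain b' where b': "b' \<in> Mpow k" "b \<ominus>\<^sub>S embed b' \<in> ?P"
    using ideal_pow_completion_approx[OF ab(2)] by blast
  have c': "a' \<in> carrier R" "b' \<in> carrier R" using a' b' ideal_carr[OF kc] by auto
  let ?F = "Idl {a', b'}"
  have F: "ideal ?F R" using genideal_ideal[of "{a', b'}"] c' by simp
  have approx: "\<exists>f\<in>?F. r \<ominus> f \<in> I (Suc k)" if r: "r \<in> Mpow k" for r
  proof -
    have rc: "r \<in> carrier R" using ideal_carr[OF kc r] .
    obtain z s t where h: "z \<in> ?P" "s \<in> carrier S" "t \<in> carrier S"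
      "embed r = (z \<oplus>\<^sub>S a \<otimes>\<^sub>S s) \<oplus>\<^sub>S b \<otimes>\<^sub>S t" using ex[OF embed_mem_ideal_pow[OF r]] by blast
    obtain s' where s': "s' \<in> carrier R" "s \<ominus>\<^sub>S embed s' \<in> ?P" using completion_dense[OF h(2)] by blast
    obtain t' where t': "t' \<in> carrier R" "t \<ominus>\<^sub>S embed t' \<in> ?P" using completion_dense[OF h(3)] by blast
    have zc: "z \<in> carrier S" using S.ideal_carr[OF P h(1)] .
    have ec: "embed a' \<in> carrier S" "embed b' \<in> carrier S" "embed s' \<in> carrier S" "embed t' \<in> carrier S"
      using embed_carr c' s' t' by auto
    have mult: "u \<otimes>\<^sub>S v \<ominus>\<^sub>S u' \<otimes>\<^sub>S v' \<in> ?P" if c: "u \<in> carrier S" "v \<in> carrier S" "u' \<in> carrier S" "v' \<in> carrier S"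
      and d: "u \<ominus>\<^sub>S u' \<in> ?P" "v \<ominus>\<^sub>S v' \<in> ?P" for u v u' v'
    proof -
      have "u \<otimes>\<^sub>S v \<ominus>\<^sub>S u' \<otimes>\<^sub>S v' = (u \<ominus>\<^sub>S u') \<otimes>\<^sub>S v \<oplus>\<^sub>S (v \<ominus>\<^sub>S v') \<otimes>\<^sub>S u'"
        using c by algebra
      then show ?thesis using S.ideal_add[OF P S.ideal_mult[OF P d(1) c(2)] S.ideal_mult[OF P d(2) c(3)]] by simp
    qed
    define f where "f = a' \<otimes> s' \<oplus> b' \<otimes> t'"
    have fc: "f \<in> carrier R" using c' s' t' by (simp add: f_def)
    have ef: "embed f = embed a' \<otimes>\<^sub>S embed s' \<oplus>\<^sub>S embed b' \<otimes>\<^sub>S embed t'"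
      using c' s' t' by (simp add: f_def embed_add embed_mult)
    have "embed r \<ominus>\<^sub>S embed f = z \<oplus>\<^sub>S (a \<otimes>\<^sub>S s \<ominus>\<^sub>S embed a' \<otimes>\<^sub>S embed s')
        \<oplus>\<^sub>S (b \<otimes>\<^sub>S t \<ominus>\<^sub>S embed b' \<otimes>\<^sub>S embed t')"
      unfolding h(4) ef using zc ec abc h(2,3) by algebra
    also have "\<dots> \<in> ?P"
      using S.ideal_add[OF P S.ideal_add[OF P h(1) mult[OF abc(1) h(2) ec(1,3) a'(2) s'(2)]]
          mult[OF abc(2) h(3) ec(2,4) b'(2) t'(2)]] .
    finally have "embed (r \<ominus> f) \<in> ?P"
      using lim_class_diff[OF coherent_const[OF rc] coherent_const[OF fc]] by (simp add: embed_def)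
    then have "r \<ominus> f \<in> I (Suc k)" using embed_mem_power_iff[of "r \<ominus> f" "Suc k"] rc fc by simp
    moreover have "f \<in> ?F" unfolding f_def using Idl2_iff[OF c'] s' t' by blast
    ultimately show ?thesis by blast
  qed
  have "m [^] k \<in> ?F"
  proof -
    obtain f where f: "f \<in> ?F" "m [^] k \<ominus> f \<in> I (Suc k)"
      using approx[OF pow_mem_ideal_pow[OF M_ideal m_mem]] by blast
    have fc: "f \<in> carrier R" using ideal_carr[OF F f(1)] .
    obtain u where u: "u \<in> carrier R" "m [^] k \<ominus> f = m [^] Suc k \<otimes> u" using f(2) m_pow_carr by (rule PIdlE)
    have "(\<one> \<ominus> m \<otimes> u) \<otimes> m [^] k = m [^] k \<ominus> (m [^] k \<otimes> m) \<otimes> u"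
      using u(1) m_carr m_pow_carr[of k] by algebra
    also have "\<dots> = m [^] k \<ominus> m [^] Suc k \<otimes> u" by simp
    also have "\<dots> = f" unfolding u(2)[symmetric] using fc m_pow_carr[of k] by algebra
    finally show ?thesis
      using unit_mult_mem_ideal[OF F one_minus_unit[OF ideal_mult[OF M_ideal m_mem u(1)]] m_pow_carr] f(1) by simp
  qed
  then have IF: "I (Suc k) \<subseteq> ?F"
    using order_trans[OF I_antimono[of k "Suc k"] cgenideal_minimal[OF F]] by simp
  have "Mpow k = ?F"
  proof
    show "?F \<subseteq> Mpow k" using a' b' by (intro genideal_minimal kc) simp
    show "Mpow k \<subseteq> ?F"
      using approx IF ideal_diff_cancel[OF F] ideal_carr[OF kc] by blast
  qed
  then show ?thesis unfolding two_generated_def using c' by blast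
qed

lemma two_generated_power_of_multiplicity:
  assumes noeth: "noetherian_ring S" and mult: "local_multiplicity S \<le> 2"
  shows "\<exists>n\<ge>2. two_generated R (Mpow n)"
proof -
  obtain A where A: "A \<subseteq> carrier S" "finite A" "MS = Idl\<^bsub>S\<^esub> A"
    using noetherian_ring.finetely_gen[OF noeth S.M_ideal] by blast
  obtain h N e k0 d where h: "S.Mpow N \<subseteq> PIdl\<^bsub>S\<^esub> (embed m)"
    "\<And>k. S.compser (S.Mpow (Suc k)) (S.Mpow k) (h k)" "\<And>k. k \<ge> k0 \<Longrightarrow> h k = e"
    "hilbert_samuel_poly S = [:d, real e:]"
    using completion_hilbert_function[OF A(2,1,3)] by blast
  have e: "e \<le> 2"
  \<comment> \<open>For e = 0 the leading coefficient is d and says nothing about e. Otherwise e is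
    the leading coefficient, and the factorial, being at least 1, can only make the multiplicity
    larger.\<close>
  proof (cases "e = 0")
    case False
    then have "local_multiplicity S = fact (the_enat (krull_dim S)) * real e"
      by (simp add: local_multiplicity_def h(4))
    moreover have "real e \<le> fact (the_enat (krull_dim S)) * real e"
      using mult_right_mono[OF fact_ge_1, of "real e"] by simp
    ultimately show ?thesis using mult by simp
  qed simp
  \<comment> \<open>Large enough for the length to equal e, and at least 2 as (1) demands.\<close>
  define k where "k = max k0 2"
  have "h k \<le> 2" using h(3)[of k] e by (simp add: k_def)
  then obtain a b where "a \<in> S.Mpow k" "b \<in> S.Mpow k"
    "S.Mpow k = S.adj (S.adj (S.Mpow (Suc k)) a) b"
    using S.compser_at_most_two[OF h(2)[of k]] by blast
  then have "two_generated R (Mpow k)" using two_generated_descends[OF h(1)] by blast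
  then show ?thesis by (intro exI[of _ k]) (simp add: k_def)
qed

end

text \<open>The eventual length e is at least 1, since consecutive powers differ, and at most 2,
  since positive powers have two generators. So e is the leading coefficient, and the factorial of a
  dimension at most one is 1.\<close>

lemma (in stable_adic) completion_multiplicity: "local_multiplicity S \<le> 2"
proof -
  have yc: "{embed y, embed c} \<subseteq> carrier S" using S.y_carr S.c_carr by simp
  obtain h N e k0 d where h: "S.Mpow N \<subseteq> PIdl\<^bsub>S\<^esub> (embed m)"
    "\<And>k. S.compser (S.Mpow (Suc k)) (S.Mpow k) (h k)" "\<And>k. k \<ge> k0 \<Longrightarrow> h k = e"
    "hilbert_samuel_poly S = [:d, real e:]"
    using completion_hilbert_function[OF _ yc S.M_gen] by blast
  have "h k0 \<noteq> 0"
  proof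
    assume "h k0 = 0"
    then have "S.compser (S.Mpow (Suc k0)) (S.Mpow k0) 0" using h(2)[of k0] by simp
    then have "S.Mpow k0 = S.Mpow (Suc k0)" by cases auto
    then show False using completion_powers_distinct[OF h(1), of k0] by simp
  qed
  then have e0: "e \<noteq> 0" using h(3) by simp
  have "S.compser_le (S.Mpow (Suc (Suc k0))) (S.Mpow (Suc k0)) 2"
    by (rule S.compser_le_two_generated[OF _ _ S.ideal_pow_two_generated])
      (use S.y_carr S.c_carr in simp_all)
  then obtain n where "n \<le> 2" "S.compser (S.Mpow (Suc (Suc k0))) (S.Mpow (Suc k0)) n"
    by (auto simp: S.compser_le_def)
  then have e2: "e \<le> 2" using S.compser_mono[OF _ h(2)[of "Suc k0"]] h(3)[of "Suc k0"] by fastforce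
  obtain n where n: "krull_dim S = enat n" "n \<le> 1"
    using completion_krull_dim by (cases "krull_dim S") (auto simp: one_enat_def)
  have "fact n = (1::real)" using n(2) by (cases n) auto
  then show ?thesis using e0 e2 by (simp add: local_multiplicity_def h(4) n(1))
qed

theorem theorem5p4:
  fixes R :: "('a, 'b) ring_scheme" and m :: 'a
  assumes "local_ring R"
    and "krull_dim R = 1"
    and "regular_ideal R (max_ideal R)"
    and "m \<in> max_ideal R"
    and "nonzerodivisor R m"
  shows "((\<exists>n\<ge>2. two_generated R (ideal_pow R (max_ideal R) n))
           \<longleftrightarrow> (noetherian_ring (adic_completion R m) \<and> local_ring (adic_completion R m)
                \<and> local_multiplicity (adic_completion R m) \<le> 2))
       \<and> ((\<exists>n\<ge>2. two_generated R (ideal_pow R (max_ideal R) n))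
           \<longleftrightarrow> (\<forall>I. regular_ideal R I \<longrightarrow> two_generated R I))"
proof -
  define M where "M = max_ideal R"
  have R: "cring R" using assms(1) by (simp add: local_ring_def)
  interpret local_cring R M
    unfolding M_def by (rule cring.local_ring_local_cring[OF R assms(1)])
  have m: "m \<in> M" using assms(4) by (simp add: M_def)
  have A: "adic_radical R M m"
  proof (intro adic_radical.intro adic_radical_axioms.intro adic_local.intro adic_local_axioms.intro)
    show "local_cring R M" by (rule local_cring_axioms)
    show "m \<in> M" by (rule m)
    show "nonzerodivisor R m" by (rule assms(5))
    show "\<exists>n. x [^]\<^bsub>R\<^esub> (n::nat) \<in> PIdl\<^bsub>R\<^esub> m" if "x \<in> M" for x
      by (rule rad_principal[OF assms(2,5) m that])
  qed
  have one_imp: "noetherian_ring (adic_completion R m) \<and> local_multiplicity (adic_completion R m) \<le> 2 \<and>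
      (\<forall>I. regular_ideal R I \<longrightarrow> two_generated R I)"
    if n: "n \<ge> 2" and two: "two_generated R (Mpow n)" for n
  proof -
    obtain j where "n = 2 + j" using le_Suc_ex[OF n] by (rule exE)
    then have "n = Suc (Suc j)" by simp
    then have "two_generated R (Mpow (Suc (Suc j)))" using two by (simp only:)
    from two_generated_power_descent[OF m assms(5) this]
    obtain y c where yc: "y \<in> M" "c \<in> M" "nonzerodivisor R y" "M = Idl\<^bsub>R\<^esub> {y, c}"
      "\<forall>u \<in> M. \<forall>v \<in> M. \<exists>w \<in> M. u \<otimes>\<^bsub>R\<^esub> v = y \<otimes>\<^bsub>R\<^esub> w"
      by (elim bexE conjE)
    have T: "stable_local R M y c" and T': "stable_adic R M m y c"
    proof -
      show T: "stable_local R M y c"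
      proof (intro stable_local.intro stable_local_axioms.intro)
        show "local_cring R M" by (rule local_cring_axioms)
        show "\<exists>w\<in>M. u \<otimes>\<^bsub>R\<^esub> v = y \<otimes>\<^bsub>R\<^esub> w" if "u \<in> M" "v \<in> M" for u v
          using yc(5) that by blast
      qed (rule yc)+
      show "stable_adic R M m y c" by (rule stable_adic.intro[OF A T])
    qed
    show ?thesis
      using stable_adic.completion_noetherian[OF T'] stable_adic.completion_multiplicity[OF T']
        stable_local.regular_ideal_two_generated[OF T assms(2) yc(3)] by blast
  qed
  \<comment> \<open>The square of M contains the nonzerodivisor m^2, so (3) applies to it and gives
    (1) with n = 2.\<close>
  have three_imp: "\<exists>n\<ge>2. two_generated R (Mpow n)"
    if "\<forall>I. regular_ideal R I \<longrightarrow> two_generated R I"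
  proof -
    have "regular_ideal R (Mpow 2)"
      unfolding regular_ideal_def
      using Mpow_ideal pow_mem_ideal_pow[OF M_ideal m, of 2] nzd_pow[OF assms(5), of 2] by blast
    then show ?thesis using that by blast
  qed
  show ?thesis
    unfolding M_def[symmetric]
    using one_imp three_imp adic_radical.two_generated_power_of_multiplicity[OF A]
      adic_radical.completion_local_ring[OF A] by blast
qed

end
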